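(* The theories $\mathsf{CT}^{-}[\mathsf{I}\Delta_0+\mathsf{Exp}]+\mathsf{DC}$ and $\mathsf{CT}_0[\mathsf{PA}]$ axiomatize the same first-order theory (i.e., they have exactly the same theorems in the language $\mathcal{L}_{\mathsf{A}}\cup\{\mathsf{T}\}$).
   Context: $\mathcal{L}_{\mathsf{A}}=\{+,\cdot,\mathsf{S},<,0\}$ is the language of arithmetic; the logical primitives are $\neg,\vee,\exists$ only ($\wedge,\to,\forall$ are abbreviations). $\mathcal{L}_{\mathsf{A+T}}=\mathcal{L}_{\mathsf{A}}\cup\{\mathsf{T}(x)\}$ with $\mathsf{T}$ a unary predicate. $\mathsf{I}\Delta_0+\mathsf{Exp}$ is Robinson's arithmetic $\mathsf{Q}$ plus induction for $\Delta_0$ (bounded) $\mathcal{L}_{\mathsf{A}}$-formulae plus the axiom that $x\mapsto 2^x$ is total. $\mathsf{PA}$ is Peano arithmetic (induction for all $\mathcal{L}_{\mathsf{A}}$-formulae). For a base theory $\mathsf{B}\supseteq \mathsf{I}\Delta_0+\mathsf{Exp}$ in $\mathcal{L}_{\mathsf{A}}$, $\mathsf{CT}^-[\mathsf{B}]$ is $\mathsf{B}$ (induction only for $\mathcal{L}_{\mathsf{A}}$-formulae) plus the following axioms, where $\tau_1,\tau_2$ range over (Gödel numbers of) closed $\mathcal{L}_{\mathsf{A}}$-terms with $\tau^\circ$ the value of $\tau$, $\varphi,\psi$ over (codes of) $\mathcal{L}_{\mathsf{A}}$-sentences, $\gamma(v)$ over $\mathcal{L}_{\mathsf{A}}$-formulae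 with exactly one free variable $v$, and $\underline{x}$ is the numeral of $x$: (0) $\forall x(\mathsf{T}(x)\to \mathsf{Sent}_{\mathsf{A}}(x))$; (1) $\mathsf{T}(\tau_1=\tau_2)\leftrightarrow \tau_1^\circ=\tau_2^\circ$; (2) $\mathsf{T}(\neg\varphi)\leftrightarrow\neg\mathsf{T}(\varphi)$; (3) $\mathsf{T}(\varphi\vee\psi)\leftrightarrow(\mathsf{T}(\varphi)\vee\mathsf{T}(\psi))$; (4) $\mathsf{T}(\exists v\,\gamma(v))\leftrightarrow\exists x\,\mathsf{T}(\gamma(\underline{x}))$. $\mathsf{CT}_0[\mathsf{B}]$ is $\mathsf{CT}^-[\mathsf{B}]$ plus the induction scheme for all $\Delta_0(\mathcal{L}_{\mathsf{A+T}})$-formulae (formulae of $\mathcal{L}_{\mathsf{A+T}}$ all of whose quantifiers are bounded by terms). $\mathsf{DC}$ (disjunctive correctness) is the $\mathcal{L}_{\mathsf{A+T}}$-sentence: for every $s$ and every sequence $\langle\varphi_i:i<s\rangle$ of codes of $\mathcal{L}_{\mathsf{A}}$-sentences, $\mathsf{T}(\bigvee_{i<s}\varphi_i)\leftrightarrow\exists i<s\,\mathsf{T}(\varphi_i)$, where $\bigvee_{i<0}\varphi_i:=\varphi_0$ and $\bigvee_{i<t+1}\varphi_i:=(\bigvee_{i<t}\varphi_i)\vee\varphi_t$.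
   Formalization: Disjunctive correctness is stated only for nonempty sequences (s > 0): for s = 0 the English sets the empty disjunction to be φ_0, which does not exist, and with an arbitrary φ_0 such as 0=0 the axiom would be inconsistent. *)

theory Defs
  imports Main
begin

section \<open>First-order logic over the language of arithmetic with a truth predicate\<close>

datatype tm = Zero | Var nat | Succ tm | Plus tm tm (infixl "\<^bold>+" 65) | Times tm tm (infixl "\<^bold>*" 70)

datatype fm =
    Eq tm tm (infix "\<^bold>=" 50)
  | Less tm tm (infix "\<^bold><" 50)
  | Tr tm
  | Neg fm ("\<^bold>\<not> _" [40] 40)
  | Or fm fm (infixr "\<^bold>\<or>" 30)
  | Ex nat fm ("\<^bold>\<exists>_./ _" [0, 10] 10)

abbreviation And :: "fm \<Rightarrow> fm \<Rightarrow> fm" (infixr "\<^bold>\<and>" 35) where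
  "A \<^bold>\<and> B \<equiv> \<^bold>\<not> (\<^bold>\<not> A \<^bold>\<or> \<^bold>\<not> B)"

abbreviation Imp :: "fm \<Rightarrow> fm \<Rightarrow> fm" (infixr "\<^bold>\<longrightarrow>" 25) where
  "A \<^bold>\<longrightarrow> B \<equiv> \<^bold>\<not> A \<^bold>\<or> B"

abbreviation Iff :: "fm \<Rightarrow> fm \<Rightarrow> fm" (infixr "\<^bold>\<longleftrightarrow>" 25) where
  "A \<^bold>\<longleftrightarrow> B \<equiv> (A \<^bold>\<longrightarrow> B) \<^bold>\<and> (B \<^bold>\<longrightarrow> A)"

abbreviation All :: "nat \<Rightarrow> fm \<Rightarrow> fm" ("\<^bold>\<forall>_./ _" [0, 10] 10) where
  "\<^bold>\<forall>x. A \<equiv> \<^bold>\<not> (\<^bold>\<exists>x. \<^bold>\<not> A)"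

primrec tvars :: "tm \<Rightarrow> nat set" where
  "tvars Zero = {}"
| "tvars (Var x) = {x}"
| "tvars (Succ t) = tvars t"
| "tvars (s \<^bold>+ t) = tvars s \<union> tvars t"
| "tvars (s \<^bold>* t) = tvars s \<union> tvars t"

primrec fvars :: "fm \<Rightarrow> nat set" where
  "fvars (s \<^bold>= t) = tvars s \<union> tvars t"
| "fvars (s \<^bold>< t) = tvars s \<union> tvars t"
| "fvars (Tr t) = tvars t"
| "fvars (\<^bold>\<not> A) = fvars A"
| "fvars (A \<^bold>\<or> B) = fvars A \<union> fvars B"
| "fvars (\<^bold>\<exists>x. A) = fvars A - {x}"

primrec tsubst :: "nat \<Rightarrow> tm \<Rightarrow> tm \<Rightarrow> tm" where
  "tsubst x r Zero = Zero"
| "tsubst x r (Var y) = (if y = x then r else Var y)"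
| "tsubst x r (Succ t) = Succ (tsubst x r t)"
| "tsubst x r (s \<^bold>+ t) = tsubst x r s \<^bold>+ tsubst x r t"
| "tsubst x r (s \<^bold>* t) = tsubst x r s \<^bold>* tsubst x r t"

text \<open>Replacement of the free occurrences of a variable; bound variables are not renamed.\<close>

primrec fsubst :: "nat \<Rightarrow> tm \<Rightarrow> fm \<Rightarrow> fm" where
  "fsubst x r (s \<^bold>= t) = (tsubst x r s \<^bold>= tsubst x r t)"
| "fsubst x r (s \<^bold>< t) = (tsubst x r s \<^bold>< tsubst x r t)"
| "fsubst x r (Tr t) = Tr (tsubst x r t)"
| "fsubst x r (\<^bold>\<not> A) = (\<^bold>\<not> fsubst x r A)"
| "fsubst x r (A \<^bold>\<or> B) = (fsubst x r A \<^bold>\<or> fsubst x r B)"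
| "fsubst x r (\<^bold>\<exists>y. A) = (if y = x then \<^bold>\<exists>y. A else \<^bold>\<exists>y. fsubst x r A)"

primrec free_for :: "tm \<Rightarrow> nat \<Rightarrow> fm \<Rightarrow> bool" where
  "free_for r x (s \<^bold>= t) \<longleftrightarrow> True"
| "free_for r x (s \<^bold>< t) \<longleftrightarrow> True"
| "free_for r x (Tr t) \<longleftrightarrow> True"
| "free_for r x (\<^bold>\<not> A) \<longleftrightarrow> free_for r x A"
| "free_for r x (A \<^bold>\<or> B) \<longleftrightarrow> free_for r x A \<and> free_for r x B"
| "free_for r x (\<^bold>\<exists>y. A) \<longleftrightarrow> y = x \<or> x \<notin> fvars A \<or> (y \<notin> tvars r \<and> free_for r x A)"

text \<open>
  Shoenfield's Hilbert-style calculus for classical first-order logic with equality over the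
  primitives \<open>\<not>\<close>, \<open>\<or>\<close>, \<open>\<exists>\<close>, with the equality axioms stated for terms instead of variables.
\<close>

inductive proves :: "fm set \<Rightarrow> fm \<Rightarrow> bool" (infix "\<turnstile>" 5) for \<Gamma> :: "fm set" where
  axiom: "A \<in> \<Gamma> \<Longrightarrow> \<Gamma> \<turnstile> A"
| excluded_middle: "\<Gamma> \<turnstile> \<^bold>\<not> A \<^bold>\<or> A"
| substitution: "free_for t x A \<Longrightarrow> \<Gamma> \<turnstile> fsubst x t A \<^bold>\<longrightarrow> (\<^bold>\<exists>x. A)"
| identity: "\<Gamma> \<turnstile> t \<^bold>= t"
| eq_Succ: "\<Gamma> \<turnstile> s \<^bold>= s' \<^bold>\<longrightarrow> Succ s \<^bold>= Succ s'"
| eq_Plus: "\<Gamma> \<turnstile> s \<^bold>= s' \<^bold>\<longrightarrow> t \<^bold>= t' \<^bold>\<longrightarrow> s \<^bold>+ t \<^bold>= s' \<^bold>+ t'"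
| eq_Times: "\<Gamma> \<turnstile> s \<^bold>= s' \<^bold>\<longrightarrow> t \<^bold>= t' \<^bold>\<longrightarrow> s \<^bold>* t \<^bold>= s' \<^bold>* t'"
| eq_Eq: "\<Gamma> \<turnstile> s \<^bold>= s' \<^bold>\<longrightarrow> t \<^bold>= t' \<^bold>\<longrightarrow> s \<^bold>= t \<^bold>\<longrightarrow> s' \<^bold>= t'"
| eq_Less: "\<Gamma> \<turnstile> s \<^bold>= s' \<^bold>\<longrightarrow> t \<^bold>= t' \<^bold>\<longrightarrow> s \<^bold>< t \<^bold>\<longrightarrow> s' \<^bold>< t'"
| eq_Tr: "\<Gamma> \<turnstile> s \<^bold>= s' \<^bold>\<longrightarrow> Tr s \<^bold>\<longrightarrow> Tr s'"
| expansion: "\<Gamma> \<turnstile> A \<Longrightarrow> \<Gamma> \<turnstile> B \<^bold>\<or> A"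
| contraction: "\<Gamma> \<turnstile> A \<^bold>\<or> A \<Longrightarrow> \<Gamma> \<turnstile> A"
| associativity: "\<Gamma> \<turnstile> A \<^bold>\<or> (B \<^bold>\<or> C) \<Longrightarrow> \<Gamma> \<turnstile> (A \<^bold>\<or> B) \<^bold>\<or> C"
| cut: "\<Gamma> \<turnstile> A \<^bold>\<or> B \<Longrightarrow> \<Gamma> \<turnstile> \<^bold>\<not> A \<^bold>\<or> C \<Longrightarrow> \<Gamma> \<turnstile> B \<^bold>\<or> C"
| ex_intro: "\<Gamma> \<turnstile> A \<^bold>\<longrightarrow> B \<Longrightarrow> x \<notin> fvars B \<Longrightarrow> \<Gamma> \<turnstile> (\<^bold>\<exists>x. A) \<^bold>\<longrightarrow> B"

definition theorems :: "fm set \<Rightarrow> fm set" where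
  "theorems \<Gamma> = {A. \<Gamma> \<turnstile> A}"


section \<open>Base theories\<close>

primrec arithmetical :: "fm \<Rightarrow> bool" where
  "arithmetical (s \<^bold>= t) \<longleftrightarrow> True"
| "arithmetical (s \<^bold>< t) \<longleftrightarrow> True"
| "arithmetical (Tr t) \<longleftrightarrow> False"
| "arithmetical (\<^bold>\<not> A) \<longleftrightarrow> arithmetical A"
| "arithmetical (A \<^bold>\<or> B) \<longleftrightarrow> arithmetical A \<and> arithmetical B"
| "arithmetical (\<^bold>\<exists>x. A) \<longleftrightarrow> arithmetical A"

text \<open>Formulae, possibly containing \<^const>\<open>Tr\<close>, all of whose quantifiers are bounded by terms.\<close>

inductive delta0 :: "fm \<Rightarrow> bool" where
  "delta0 (s \<^bold>= t)"
| "delta0 (s \<^bold>< t)"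
| "delta0 (Tr t)"
| "delta0 A \<Longrightarrow> delta0 (\<^bold>\<not> A)"
| "delta0 A \<Longrightarrow> delta0 B \<Longrightarrow> delta0 (A \<^bold>\<or> B)"
| "delta0 A \<Longrightarrow> x \<notin> tvars t \<Longrightarrow> delta0 (\<^bold>\<exists>x. Var x \<^bold>< t \<^bold>\<and> A)"
| "delta0 A \<Longrightarrow> x \<notin> tvars t \<Longrightarrow> delta0 (\<^bold>\<forall>x. Var x \<^bold>< t \<^bold>\<longrightarrow> A)"

definition alls :: "nat list \<Rightarrow> fm \<Rightarrow> fm" where
  "alls xs A = foldr All xs A"

definition exs :: "nat list \<Rightarrow> fm \<Rightarrow> fm" where
  "exs xs A = foldr Ex xs A"

definition univ_closure :: "fm \<Rightarrow> fm" where
  "univ_closure A = alls (sorted_list_of_set (fvars A)) A"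

definition ind_axiom :: "nat \<Rightarrow> fm \<Rightarrow> fm" where
  "ind_axiom x A = univ_closure
    (fsubst x Zero A \<^bold>\<and> (\<^bold>\<forall>x. A \<^bold>\<longrightarrow> fsubst x (Succ (Var x)) A) \<^bold>\<longrightarrow> (\<^bold>\<forall>x. A))"

definition Robinson_Q :: "fm set" where
  "Robinson_Q = {\<^bold>\<forall>0. \<^bold>\<not> Succ (Var 0) \<^bold>= Zero,
        \<^bold>\<forall>0. \<^bold>\<forall>1. Succ (Var 0) \<^bold>= Succ (Var 1) \<^bold>\<longrightarrow> Var 0 \<^bold>= Var 1,
        \<^bold>\<forall>0. \<^bold>\<not> Var 0 \<^bold>= Zero \<^bold>\<longrightarrow> (\<^bold>\<exists>1. Var 0 \<^bold>= Succ (Var 1)),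
        \<^bold>\<forall>0. Var 0 \<^bold>+ Zero \<^bold>= Var 0,
        \<^bold>\<forall>0. \<^bold>\<forall>1. Var 0 \<^bold>+ Succ (Var 1) \<^bold>= Succ (Var 0 \<^bold>+ Var 1),
        \<^bold>\<forall>0. Var 0 \<^bold>* Zero \<^bold>= Zero,
        \<^bold>\<forall>0. \<^bold>\<forall>1. Var 0 \<^bold>* Succ (Var 1) \<^bold>= Var 0 \<^bold>* Var 1 \<^bold>+ Var 0,
        \<^bold>\<forall>0. \<^bold>\<forall>1. Var 0 \<^bold>< Var 1 \<^bold>\<longleftrightarrow> (\<^bold>\<exists>2. Succ (Var 2) \<^bold>+ Var 0 \<^bold>= Var 1)}"

definition PA :: "fm set" where
  "PA = Robinson_Q \<union> {ind_axiom x A | x A. arithmetical A}"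


section \<open>Inductive definitions inside arithmetic\<close>

text \<open>
  Convention for all formula-building functions below that take a first argument \<open>n\<close>: the terms
  passed to them contain only variables below \<open>n\<close>, and the variables bound by the resulting
  formula are all at least \<open>n\<close>, so no variable is ever captured.
\<close>

fun ors :: "fm list \<Rightarrow> fm" where
  "ors [] = (\<^bold>\<not> Zero \<^bold>= Zero)"
| "ors [A] = A"
| "ors (A # As) = (A \<^bold>\<or> ors As)"

primrec num_tm :: "nat \<Rightarrow> tm" where
  "num_tm 0 = Zero"
| "num_tm (Suc k) = Succ (num_tm k)"

text \<open>\<open>p\<close> is the Cantor pair of \<open>x\<close> and \<open>y\<close>, i.e. \<open>2 p = (x + y) (x + y + 1) + 2 x\<close>.\<close>

definition PairF :: "tm \<Rightarrow> tm \<Rightarrow> tm \<Rightarrow> fm" where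
  "PairF x y p = (p \<^bold>+ p \<^bold>= (x \<^bold>+ y) \<^bold>* Succ (x \<^bold>+ y) \<^bold>+ (x \<^bold>+ x))"

text \<open>Goedel's beta function: \<open>y\<close> is the remainder of \<open>a\<close> modulo \<open>(i + 1) b + 1\<close>.\<close>

definition BetaF :: "nat \<Rightarrow> tm \<Rightarrow> tm \<Rightarrow> tm \<Rightarrow> tm \<Rightarrow> fm" where
  "BetaF n a b i y =
    (y \<^bold>< Succ (Succ i \<^bold>* b) \<^bold>\<and> (\<^bold>\<exists>n. a \<^bold>= Var n \<^bold>* Succ (Succ i \<^bold>* b) \<^bold>+ y))"

text \<open>
  \<open>IndF n R x\<close> says that \<open>x\<close> belongs to the least class closed under the rules \<open>R\<close>: there is a
  sequence \<open>z\<^sub>0, \<dots>, z\<^sub>l = x\<close> (the beta function applied to some \<open>a\<close> and \<open>b\<close>) each entry of which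
  is obtained by \<open>R\<close> from earlier entries. In \<open>R m E y\<close>, the term \<open>y\<close> is the new element, \<open>E k z\<close>
  says that \<open>z\<close> occurs earlier in the sequence, and \<open>m\<close>, \<open>k\<close> are the lower bounds for the bound
  variables.
\<close>

type_synonym rules = "nat \<Rightarrow> (nat \<Rightarrow> tm \<Rightarrow> fm) \<Rightarrow> tm \<Rightarrow> fm"

definition IndF :: "nat \<Rightarrow> rules \<Rightarrow> tm \<Rightarrow> fm" where
  "IndF n R x =
    (let a = Var n; b = Var (n+1); l = Var (n+2); i = Var (n+3); y = Var (n+4) in
     exs [n, n+1, n+2]
       (BetaF (n+3) a b l x \<^bold>\<and>
        alls [n+3, n+4]
          (i \<^bold>< Succ l \<^bold>\<and> BetaF (n+5) a b i y \<^bold>\<longrightarrow>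
           R (n+5) (\<lambda>k z. \<^bold>\<exists>k. Var k \<^bold>< i \<^bold>\<and> BetaF (k+1) a b (Var k) z) y)))"

text \<open>Relations are classes of pairs: \<open>E\<close> holds of the pair of \<open>x\<close> and \<open>y\<close>.\<close>

definition Rel :: "(nat \<Rightarrow> tm \<Rightarrow> fm) \<Rightarrow> nat \<Rightarrow> tm \<Rightarrow> tm \<Rightarrow> fm" where
  "Rel E k x y = (\<^bold>\<exists>k. PairF x y (Var k) \<^bold>\<and> E (k+1) (Var k))"

text \<open>\<open>p\<close> is \<open>2\<^sup>x\<close>: the least relation containing \<open>(0, 1)\<close> and closed under \<open>(x, p) \<mapsto> (x + 1, p + p)\<close>.\<close>

definition Pow2R :: rules where
  "Pow2R m E y =
    (let x = Var m; p = Var (m+1); x' = Var (m+2); p' = Var (m+3) in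
     ors [PairF Zero (num_tm 1) y,
          exs [m, m+1, m+2, m+3]
            (PairF x p y \<^bold>\<and> x \<^bold>= Succ x' \<^bold>\<and> p \<^bold>= p' \<^bold>+ p' \<^bold>\<and> Rel E (m+4) x' p')])"

definition Pow2F :: "nat \<Rightarrow> tm \<Rightarrow> tm \<Rightarrow> fm" where
  "Pow2F n x p = Rel (\<lambda>k. IndF k Pow2R) n x p"

definition Exp_total :: fm where
  "Exp_total = (\<^bold>\<forall>0. \<^bold>\<exists>1. Pow2F 2 (Var 0) (Var 1))"

definition IDelta0_Exp :: "fm set" where
  "IDelta0_Exp = Robinson_Q \<union> {ind_axiom x A | x A. arithmetical A \<and> delta0 A} \<union> {Exp_total}"


section \<open>Arithmetized syntax\<close>

text \<open>
  Goedel numbers of terms and of arithmetical formulae, with \<open>\<langle>x, y\<rangle>\<close> the Cantor pair: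
  \<^item> \<open>\<lceil>0\<rceil> = \<langle>0, 0\<rangle>\<close>, \<open>\<lceil>v\<^sub>i\<rceil> = \<langle>1, i\<rangle>\<close>, \<open>\<lceil>S t\<rceil> = \<langle>2, \<lceil>t\<rceil>\<rangle>\<close>,
    \<open>\<lceil>s + t\<rceil> = \<langle>3, \<langle>\<lceil>s\<rceil>, \<lceil>t\<rceil>\<rangle>\<rangle>\<close>, \<open>\<lceil>s \<cdot> t\<rceil> = \<langle>4, \<langle>\<lceil>s\<rceil>, \<lceil>t\<rceil>\<rangle>\<rangle>\<close>;
  \<^item> \<open>\<lceil>s = t\<rceil> = \<langle>5, \<langle>\<lceil>s\<rceil>, \<lceil>t\<rceil>\<rangle>\<rangle>\<close>, \<open>\<lceil>s < t\<rceil> = \<langle>6, \<langle>\<lceil>s\<rceil>, \<lceil>t\<rceil>\<rangle>\<rangle>\<close>, \<open>\<lceil>\<not> A\<rceil> = \<langle>7, \<lceil>A\<rceil>\<rangle>\<close>,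
    \<open>\<lceil>A \<or> B\<rceil> = \<langle>8, \<langle>\<lceil>A\<rceil>, \<lceil>B\<rceil>\<rangle>\<rangle>\<close>, \<open>\<lceil>\<exists>v\<^sub>i A\<rceil> = \<langle>9, \<langle>i, \<lceil>A\<rceil>\<rangle>\<rangle>\<close>.

  \<open>Node1 c s p\<close> says \<open>p = \<langle>c, s\<rangle>\<close>, and \<open>Node2 n c s t p\<close> says \<open>p = \<langle>c, \<langle>s, t\<rangle>\<rangle>\<close>.
\<close>

definition Node1 :: "nat \<Rightarrow> tm \<Rightarrow> tm \<Rightarrow> fm" where
  "Node1 c s p = PairF (num_tm c) s p"

definition Node2 :: "nat \<Rightarrow> nat \<Rightarrow> tm \<Rightarrow> tm \<Rightarrow> tm \<Rightarrow> fm" where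
  "Node2 n c s t p = (\<^bold>\<exists>n. PairF s t (Var n) \<^bold>\<and> Node1 c (Var n) p)"

definition TermR :: rules where
  "TermR m E y =
    (let s = Var m; t = Var (m+1) in
     ors [Node1 0 Zero y,
          exs [m] (Node1 1 s y),
          exs [m] (Node1 2 s y \<^bold>\<and> E (m+1) s),
          exs [m, m+1] (ors [Node2 (m+2) c s t y. c \<leftarrow> [3, 4]] \<^bold>\<and> E (m+2) s \<^bold>\<and> E (m+2) t)])"

definition TermF :: "nat \<Rightarrow> tm \<Rightarrow> fm" where
  "TermF n x = IndF n TermR x"

definition FormR :: rules where
  "FormR m E y =
    (let s = Var m; t = Var (m+1) in
     ors [exs [m, m+1]
            (ors [Node2 (m+2) c s t y. c \<leftarrow> [5, 6]] \<^bold>\<and> TermF (m+2) s \<^bold>\<and> TermF (m+2) t),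
          exs [m] (Node1 7 s y \<^bold>\<and> E (m+1) s),
          exs [m, m+1] (Node2 (m+2) 8 s t y \<^bold>\<and> E (m+2) s \<^bold>\<and> E (m+2) t),
          exs [m, m+1] (Node2 (m+2) 9 s t y \<^bold>\<and> E (m+2) t)])"

definition FormF :: "nat \<Rightarrow> tm \<Rightarrow> fm" where
  "FormF n x = IndF n FormR x"

text \<open>The class of (codes of) terms and formulae in which the variable with index \<open>v\<close> occurs free.\<close>

definition FreeR :: "tm \<Rightarrow> rules" where
  "FreeR v m E y =
    (let s = Var m; t = Var (m+1) in
     ors [Node1 1 v y,
          exs [m] (ors [Node1 c s y. c \<leftarrow> [2, 7]] \<^bold>\<and> E (m+1) s),
          exs [m, m+1]
            (ors [Node2 (m+2) c s t y. c \<leftarrow> [3, 4, 5, 6, 8]] \<^bold>\<and> (E (m+2) s \<^bold>\<or> E (m+2) t)),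
          exs [m, m+1] (Node2 (m+2) 9 s t y \<^bold>\<and> \<^bold>\<not> s \<^bold>= v \<^bold>\<and> E (m+2) t)])"

definition FreeF :: "nat \<Rightarrow> tm \<Rightarrow> tm \<Rightarrow> fm" where
  "FreeF n v x = IndF n (FreeR v) x"

definition ClosedTermF :: "nat \<Rightarrow> tm \<Rightarrow> fm" where
  "ClosedTermF n x = (TermF n x \<^bold>\<and> (\<^bold>\<forall>n. \<^bold>\<not> FreeF (n+1) (Var n) x))"

definition SentF :: "nat \<Rightarrow> tm \<Rightarrow> fm" where
  "SentF n x = (FormF n x \<^bold>\<and> (\<^bold>\<forall>n. \<^bold>\<not> FreeF (n+1) (Var n) x))"

text \<open>The value of the closed term \<open>t\<close> is \<open>w\<close>.\<close>

definition ValR :: rules where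
  "ValR m E y =
    (let t = Var m; w = Var (m+1); t1 = Var (m+2); w1 = Var (m+3); t2 = Var (m+4); w2 = Var (m+5) in
     exs [m, m+1]
       (PairF t w y \<^bold>\<and>
        ors [Node1 0 Zero t \<^bold>\<and> w \<^bold>= Zero,
             exs [m+2, m+3] (Node1 2 t1 t \<^bold>\<and> w \<^bold>= Succ w1 \<^bold>\<and> Rel E (m+4) t1 w1),
             exs [m+2, m+3, m+4, m+5]
               (ors [Node2 (m+6) 3 t1 t2 t \<^bold>\<and> w \<^bold>= w1 \<^bold>+ w2,
                     Node2 (m+6) 4 t1 t2 t \<^bold>\<and> w \<^bold>= w1 \<^bold>* w2] \<^bold>\<and>
                Rel E (m+6) t1 w1 \<^bold>\<and> Rel E (m+6) t2 w2)]))"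

definition ValF :: "nat \<Rightarrow> tm \<Rightarrow> tm \<Rightarrow> fm" where
  "ValF n t w = Rel (\<lambda>k. IndF k ValR) n t w"

text \<open>The code of the numeral of \<open>x\<close> is \<open>c\<close>.\<close>

definition NumeralR :: rules where
  "NumeralR m E y =
    (let x = Var m; c = Var (m+1); x' = Var (m+2); c' = Var (m+3) in
     exs [m, m+1]
       (PairF x c y \<^bold>\<and>
        ors [x \<^bold>= Zero \<^bold>\<and> Node1 0 Zero c,
             exs [m+2, m+3] (x \<^bold>= Succ x' \<^bold>\<and> Node1 2 c' c \<^bold>\<and> Rel E (m+4) x' c')]))"

definition NumeralF :: "nat \<Rightarrow> tm \<Rightarrow> tm \<Rightarrow> fm" where
  "NumeralF n x c = Rel (\<lambda>k. IndF k NumeralR) n x c"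

text \<open>
  Replacing the free occurrences of the variable with index \<open>v\<close> in the term or formula \<open>x\<close> by the
  term \<open>c\<close> yields \<open>z\<close>.
\<close>

definition SubstR :: "tm \<Rightarrow> tm \<Rightarrow> rules" where
  "SubstR v c m E y =
    (let x = Var m; z = Var (m+1); s = Var (m+2); s' = Var (m+3); t = Var (m+4); t' = Var (m+5) in
     exs [m, m+1]
       (PairF x z y \<^bold>\<and>
        ors [Node1 0 Zero x \<^bold>\<and> z \<^bold>= x,
             Node1 1 v x \<^bold>\<and> z \<^bold>= c,
             exs [m+2] (Node1 1 s x \<^bold>\<and> \<^bold>\<not> s \<^bold>= v \<^bold>\<and> z \<^bold>= x),
             exs [m+2, m+3]
               (ors [Node1 k s x \<^bold>\<and> Node1 k s' z. k \<leftarrow> [2, 7]] \<^bold>\<and> Rel E (m+4) s s'),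
             exs [m+2, m+3, m+4, m+5]
               (ors [Node2 (m+6) k s t x \<^bold>\<and> Node2 (m+6) k s' t' z. k \<leftarrow> [3, 4, 5, 6, 8]] \<^bold>\<and>
                Rel E (m+6) s s' \<^bold>\<and> Rel E (m+6) t t'),
             exs [m+2] (Node2 (m+3) 9 v s x \<^bold>\<and> z \<^bold>= x),
             exs [m+2, m+3, m+4]
               (Node2 (m+5) 9 t s x \<^bold>\<and> \<^bold>\<not> t \<^bold>= v \<^bold>\<and> Node2 (m+5) 9 t s' z \<^bold>\<and> Rel E (m+5) s s')]))"

definition SubstF :: "nat \<Rightarrow> tm \<Rightarrow> tm \<Rightarrow> tm \<Rightarrow> tm \<Rightarrow> fm" where
  "SubstF n v c x z = Rel (\<lambda>k. IndF k (SubstR v c)) n x z"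


section \<open>Truth theories\<close>

text \<open>
  The compositional clauses say nothing about atomic sentences \<open>s < t\<close> (the relation \<open><\<close> is
  definable from \<open>+\<close>) nor about vacuous quantifications: in \<open>T_ex\<close>, the variable with index \<open>v\<close> is
  the unique free variable of the formula \<open>g\<close>.
\<close>

definition T_sent :: fm where
  "T_sent = (\<^bold>\<forall>0. Tr (Var 0) \<^bold>\<longrightarrow> SentF 1 (Var 0))"

definition T_eq :: fm where
  "T_eq =
    (let t1 = Var 0; t2 = Var 1; e = Var 2; w = Var 3 in
     alls [0, 1, 2]
       (ClosedTermF 3 t1 \<^bold>\<and> ClosedTermF 3 t2 \<^bold>\<and> Node2 3 5 t1 t2 e \<^bold>\<longrightarrow>
        (Tr e \<^bold>\<longleftrightarrow> (\<^bold>\<exists>3. ValF 4 t1 w \<^bold>\<and> ValF 4 t2 w))))"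

definition T_neg :: fm where
  "T_neg =
    (let p = Var 0; e = Var 1 in
     alls [0, 1] (SentF 2 p \<^bold>\<and> Node1 7 p e \<^bold>\<longrightarrow> (Tr e \<^bold>\<longleftrightarrow> \<^bold>\<not> Tr p)))"

definition T_or :: fm where
  "T_or =
    (let p = Var 0; q = Var 1; e = Var 2 in
     alls [0, 1, 2]
       (SentF 3 p \<^bold>\<and> SentF 3 q \<^bold>\<and> Node2 3 8 p q e \<^bold>\<longrightarrow> (Tr e \<^bold>\<longleftrightarrow> (Tr p \<^bold>\<or> Tr q))))"

definition T_ex :: fm where
  "T_ex =
    (let v = Var 0; g = Var 1; e = Var 2; u = Var 3; x = Var 3; c = Var 4; h = Var 5 in
     alls [0, 1, 2]
       (FormF 3 g \<^bold>\<and> (\<^bold>\<forall>3. FreeF 4 u g \<^bold>\<longleftrightarrow> u \<^bold>= v) \<^bold>\<and> Node2 3 9 v g e \<^bold>\<longrightarrow>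
        (Tr e \<^bold>\<longleftrightarrow> exs [3, 4, 5] (NumeralF 6 x c \<^bold>\<and> SubstF 6 v c g h \<^bold>\<and> Tr h))))"

definition CT_minus :: "fm set \<Rightarrow> fm set" where
  "CT_minus B = B \<union> {T_sent, T_eq, T_neg, T_or, T_ex}"

definition CT0 :: "fm set \<Rightarrow> fm set" where
  "CT0 B = CT_minus B \<union> {ind_axiom x A | x A. delta0 A}"

text \<open>
  The sequence \<open>\<phi>\<^sub>i\<close> is the beta function applied to \<open>a\<close>, \<open>b\<close> and \<open>i\<close>. The relation below relates
  \<open>0\<close> to \<open>\<phi>\<^sub>0\<close>, and \<open>t + 1\<close> to \<open>d \<or> \<phi>\<^sub>t\<close> whenever it relates \<open>t\<close> to \<open>d\<close>.
\<close>

definition DisjR :: "tm \<Rightarrow> tm \<Rightarrow> rules" where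
  "DisjR a b m E y =
    (let s = Var m; d = Var (m+1); t = Var (m+2); d' = Var (m+3); f = Var (m+4) in
     exs [m, m+1]
       (PairF s d y \<^bold>\<and>
        ors [s \<^bold>= Zero \<^bold>\<and> BetaF (m+2) a b Zero d,
             exs [m+2, m+3, m+4]
               (s \<^bold>= Succ t \<^bold>\<and> BetaF (m+5) a b t f \<^bold>\<and> Node2 (m+5) 8 d' f d \<^bold>\<and> Rel E (m+5) t d')]))"

definition DisjF :: "nat \<Rightarrow> tm \<Rightarrow> tm \<Rightarrow> tm \<Rightarrow> tm \<Rightarrow> fm" where
  "DisjF n a b s d = Rel (\<lambda>k. IndF k (DisjR a b)) n s d"

text \<open>
  Every finite sequence is an initial segment of a sequence given by the beta function. The length
  \<open>s\<close> is positive: the empty sequence has no entry \<open>\<phi>\<^sub>0\<close>, so its disjunction is undefined.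
\<close>

definition DC :: fm where
  "DC =
    (let a = Var 0; b = Var 1; s = Var 2; d = Var 3; i = Var 4; f = Var 5 in
     alls [0, 1, 2, 3]
       (Zero \<^bold>< s \<^bold>\<and>
        alls [4, 5] (i \<^bold>< s \<^bold>\<and> BetaF 6 a b i f \<^bold>\<longrightarrow> SentF 6 f) \<^bold>\<and>
        DisjF 4 a b s d \<^bold>\<longrightarrow>
        (Tr d \<^bold>\<longleftrightarrow> exs [4, 5] (i \<^bold>< s \<^bold>\<and> BetaF 6 a b i f \<^bold>\<and> Tr f))))"

end

theory Submission
  imports Defs "HOL-Library.Countable_Set"
begin

text \<open>
  By the completeness theorem it suffices that the two theories have the same models on a countably
  infinite set.

  Suppose that disjunctions are correct. Let \<open>\<psi>\<^sub>i\<close> be sentences given by a definable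
  function, and let \<open>\<theta>\<^sub>i\<close> be the sentence \<open>\<not> (\<psi>\<^sub>i \<or> \<Or>\<^sub>j\<^sub><\<^sub>i \<theta>\<^sub>j)\<close>. By disjunctive correctness at
  most one of the \<open>\<theta>\<^sub>i\<close> is true, and if some \<open>\<psi>\<^sub>i\<close> is false, then some \<open>\<theta>\<^sub>i\<close> is true; such an \<open>i\<close>
  is least with \<open>\<psi>\<^sub>i\<close> false. Applied to the numerical instances of a standard formula, this least
  number principle gives \<open>PA\<close>. Applied to the disjunctions of the coded sets of sentences below \<open>c\<close>,
  it gives a code of the set of true sentences below \<open>c\<close>. As truth below \<open>c\<close> is thus
  arithmetical, \<open>\<Delta>\<^sub>0\<close> induction for formulae with truth reduces to \<open>PA\<close>.

  Conversely, disjunctive correctness is proved by \<open>\<Delta>\<^sub>0\<close> induction along the derivation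
  which witnesses that a number codes the disjunction of a sequence.
\<close>

section \<open>Structures, soundness and completeness\<close>

text \<open>The base theory has bounded induction and exponentiation but no collection, and this
  shapes everything up to the point where \<open>PA\<close> is reached. Derivations, numerals and
  powers of two exist, yet neither the existence of a derivation nor a function that outgrows all
  terms may enter an induction. Such objects are therefore built up to a fixed bound and stored in
  one code, a parameter, and the induction is about this code.

  The least number principle for false sentences is used at two strengths. At first the sentences
  have to be given by a function with a bounded definition, which yields arithmetical induction.
  Only then may they be given by a function with unbounded quantifiers, as are the disjunctions that
  test whether a number codes truth. A number codes the set of those \<open>i\<close> whose modulus
  divides it; dividing by a modulus costs at most one element, so the least positive code containing
  all truths below \<open>c\<close> contains no other number below \<open>c\<close>.

  Truth itself is kept out of every induction on the way there; what is known of long disjunctions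
  comes from \<open>DC\<close> alone.\<close>

record 'a str =
  Zr :: 'a
  Sc :: "'a \<Rightarrow> 'a"
  Pl :: "'a \<Rightarrow> 'a \<Rightarrow> 'a"
  Ti :: "'a \<Rightarrow> 'a \<Rightarrow> 'a"
  Ls :: "'a \<Rightarrow> 'a \<Rightarrow> bool"
  Tp :: "'a \<Rightarrow> bool"

primrec tval :: "'a str \<Rightarrow> (nat \<Rightarrow> 'a) \<Rightarrow> tm \<Rightarrow> 'a" where
  "tval M \<sigma> Zero = Zr M"
| "tval M \<sigma> (Var x) = \<sigma> x"
| "tval M \<sigma> (Succ t) = Sc M (tval M \<sigma> t)"
| "tval M \<sigma> (s \<^bold>+ t) = Pl M (tval M \<sigma> s) (tval M \<sigma> t)"
| "tval M \<sigma> (s \<^bold>* t) = Ti M (tval M \<sigma> s) (tval M \<sigma> t)"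

primrec sat :: "'a str \<Rightarrow> (nat \<Rightarrow> 'a) \<Rightarrow> fm \<Rightarrow> bool" where
  "sat M \<sigma> (s \<^bold>= t) \<longleftrightarrow> tval M \<sigma> s = tval M \<sigma> t"
| "sat M \<sigma> (s \<^bold>< t) \<longleftrightarrow> Ls M (tval M \<sigma> s) (tval M \<sigma> t)"
| "sat M \<sigma> (Tr t) \<longleftrightarrow> Tp M (tval M \<sigma> t)"
| "sat M \<sigma> (\<^bold>\<not> A) \<longleftrightarrow> \<not> sat M \<sigma> A"
| "sat M \<sigma> (A \<^bold>\<or> B) \<longleftrightarrow> sat M \<sigma> A \<or> sat M \<sigma> B"
| "sat M \<sigma> (\<^bold>\<exists>x. A) \<longleftrightarrow> (\<exists>a. sat M (\<sigma>(x := a)) A)"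

definition models :: "'a str \<Rightarrow> fm set \<Rightarrow> bool" where
  "models M \<Gamma> \<longleftrightarrow> (\<forall>A\<in>\<Gamma>. \<forall>\<sigma>. sat M \<sigma> A)"

lemma tval_cong: "(\<And>x. x \<in> tvars t \<Longrightarrow> \<sigma> x = \<tau> x) \<Longrightarrow> tval M \<sigma> t = tval M \<tau> t"
  by (induction t) auto

lemma sat_cong: "(\<And>x. x \<in> fvars A \<Longrightarrow> \<sigma> x = \<tau> x) \<Longrightarrow> sat M \<sigma> A = sat M \<tau> A"
proof (induction A arbitrary: \<sigma> \<tau>)
  case (Eq s t)
  then have "tval M \<sigma> s = tval M \<tau> s" "tval M \<sigma> t = tval M \<tau> t" by (auto intro!: tval_cong)
  then show ?case by simp
next
  case (Less s t)
  then have "tval M \<sigma> s = tval M \<tau> s" "tval M \<sigma> t = tval M \<tau> t" by (auto intro!: tval_cong)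
  then show ?case by simp
next
  case (Tr t)
  then have "tval M \<sigma> t = tval M \<tau> t" by (auto intro!: tval_cong)
  then show ?case by simp
next
  case (Neg A)
  then show ?case by (metis fvars.simps(4) sat.simps(4))
next
  case (Or A B)
  then show ?case by (metis UnCI fvars.simps(5) sat.simps(5))
next
  case (Ex x A)
  have "sat M (\<sigma>(x := a)) A = sat M (\<tau>(x := a)) A" for a
    using Ex.prems by (intro Ex.IH) auto
  then show ?case by simp
qed

lemma tval_tsubst: "tval M \<sigma> (tsubst x r t) = tval M (\<sigma>(x := tval M \<sigma> r)) t"
  by (induction t) auto

lemma sat_fsubst:
  "free_for r x A \<Longrightarrow> sat M \<sigma> (fsubst x r A) = sat M (\<sigma>(x := tval M \<sigma> r)) A"
proof (induction A arbitrary: \<sigma>)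
  case (Ex y A)
  show ?case
  proof (cases "y = x \<or> x \<notin> fvars A")
    case True
    have "fsubst x r A = A" if "x \<notin> fvars A"
    proof -
      have "tsubst x r t = t" if "x \<notin> tvars t" for t using that by (induction t) auto
      then show ?thesis using that by (induction A) auto
    qed
    then have 1: "fsubst x r (\<^bold>\<exists>y. A) = (\<^bold>\<exists>y. A)" using True by auto
    show ?thesis unfolding 1 by (rule sat_cong) (use True in auto)
  next
    case False
    then have y: "y \<notin> tvars r" "free_for r x A" using Ex.prems by auto
    have "sat M (\<sigma>(y := a)) (fsubst x r A) = sat M ((\<sigma>(x := tval M \<sigma> r))(y := a)) A" for a
    proof -
      have "tval M (\<sigma>(y := a)) r = tval M \<sigma> r" using y by (intro tval_cong) auto
      then show ?thesis using Ex.IH[OF y(2), of "\<sigma>(y := a)"] False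
        by (simp del: fun_upd_apply add: fun_upd_twist[of y x])
    qed
    then show ?thesis using False by (simp del: fun_upd_apply)
  qed
qed (auto simp: tval_tsubst)

lemma soundness:
  assumes "\<Gamma> \<turnstile> A" "models M \<Gamma>"
  shows "sat M \<sigma> A"
  using assms(1)
proof (induction arbitrary: \<sigma>)
  case (axiom A)
  then show ?case using assms(2) by (simp add: models_def)
next
  case (substitution t x A)
  then show ?case by (auto simp: sat_fsubst)
next
  case (ex_intro A B x)
  have "sat M (\<sigma>(x := a)) B = sat M \<sigma> B" for a
    using ex_intro by (intro sat_cong) auto
  then show ?case using ex_intro.IH by auto
next
  case (cut A B C) then show ?case by (meson sat.simps(4) sat.simps(5))
qed auto

subsection \<open>Propositional reasoning in the calculus\<close>

text \<open>A cut against the excluded middle for \<open>A\<close>, which leaves \<open>A\<close> as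
  the second disjunct.\<close>

lemma or_comm: "\<Gamma> \<turnstile> A \<^bold>\<or> B \<Longrightarrow> \<Gamma> \<turnstile> B \<^bold>\<or> A"
  using cut excluded_middle by blast

lemma mp: "\<Gamma> \<turnstile> A \<Longrightarrow> \<Gamma> \<turnstile> A \<^bold>\<longrightarrow> B \<Longrightarrow> \<Gamma> \<turnstile> B"
  using contraction cut expansion or_comm by metis

text \<open>The last disjunct \<open>C\<close> is separate, since there is no empty disjunction.\<close>

definition dis :: "fm list \<Rightarrow> fm \<Rightarrow> fm" where
  "dis As C = foldr Or As C"

lemma dis_simps [simp]: "dis [] C = C" "dis (A # As) C = (A \<^bold>\<or> dis As C)"
  by (simp_all add: dis_def)

lemma or_assoc': "\<Gamma> \<turnstile> (A \<^bold>\<or> B) \<^bold>\<or> C \<Longrightarrow> \<Gamma> \<turnstile> A \<^bold>\<or> (B \<^bold>\<or> C)"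
  by (rule or_comm, rule associativity, rule or_comm, rule associativity, rule or_comm)

lemma or_mono2: "\<Gamma> \<turnstile> B \<^bold>\<longrightarrow> B' \<Longrightarrow> \<Gamma> \<turnstile> A \<^bold>\<or> B \<Longrightarrow> \<Gamma> \<turnstile> A \<^bold>\<or> B'"
  by (meson cut or_comm)

lemma imp_refl: "\<Gamma> \<turnstile> A \<^bold>\<longrightarrow> A" by (rule excluded_middle)

lemma imp_trans: "\<Gamma> \<turnstile> A \<^bold>\<longrightarrow> B \<Longrightarrow> \<Gamma> \<turnstile> B \<^bold>\<longrightarrow> C \<Longrightarrow> \<Gamma> \<turnstile> A \<^bold>\<longrightarrow> C"
  by (rule or_mono2)

lemma imp_orI1: "\<Gamma> \<turnstile> A \<^bold>\<longrightarrow> A \<^bold>\<or> B"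
  by (rule or_assoc', rule or_comm, rule expansion, rule excluded_middle)

lemma imp_orI2: "\<Gamma> \<turnstile> B \<^bold>\<longrightarrow> A \<^bold>\<or> B"
  by (rule or_comm, rule associativity, rule expansion, rule or_comm, rule excluded_middle)

text \<open>Without a deduction theorem, the two disjuncts are cut one after the other out of the
  excluded middle for \<open>A \<or> B\<close>; the two copies of \<open>C\<close> so produced are
  contracted at the end.\<close>

lemma imp_orE: "\<Gamma> \<turnstile> A \<^bold>\<longrightarrow> C \<Longrightarrow> \<Gamma> \<turnstile> B \<^bold>\<longrightarrow> C \<Longrightarrow> \<Gamma> \<turnstile> (A \<^bold>\<or> B) \<^bold>\<longrightarrow> C"
proof -
  assume a: "\<Gamma> \<turnstile> A \<^bold>\<longrightarrow> C" and b: "\<Gamma> \<turnstile> B \<^bold>\<longrightarrow> C"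
  have "\<Gamma> \<turnstile> \<^bold>\<not> (A \<^bold>\<or> B) \<^bold>\<or> (A \<^bold>\<or> B)" by (rule excluded_middle)
  then have "\<Gamma> \<turnstile> A \<^bold>\<or> (B \<^bold>\<or> \<^bold>\<not> (A \<^bold>\<or> B))" using or_comm or_assoc' by blast
  then have "\<Gamma> \<turnstile> (B \<^bold>\<or> \<^bold>\<not> (A \<^bold>\<or> B)) \<^bold>\<or> C" using a cut by blast
  then have "\<Gamma> \<turnstile> B \<^bold>\<or> (\<^bold>\<not> (A \<^bold>\<or> B) \<^bold>\<or> C)" by (rule or_assoc')
  then have "\<Gamma> \<turnstile> (\<^bold>\<not> (A \<^bold>\<or> B) \<^bold>\<or> C) \<^bold>\<or> C" using b cut by blast
  then have "\<Gamma> \<turnstile> \<^bold>\<not> (A \<^bold>\<or> B) \<^bold>\<or> (C \<^bold>\<or> C)" by (rule or_assoc')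
  moreover have "\<Gamma> \<turnstile> C \<^bold>\<or> C \<^bold>\<longrightarrow> C"
  proof -
    have "\<Gamma> \<turnstile> \<^bold>\<not> (C \<^bold>\<or> C) \<^bold>\<or> (C \<^bold>\<or> C)" by (rule excluded_middle)
    then have "\<Gamma> \<turnstile> (\<^bold>\<not> (C \<^bold>\<or> C) \<^bold>\<or> C) \<^bold>\<or> C" by (rule associativity)
    then have "\<Gamma> \<turnstile> C \<^bold>\<or> (\<^bold>\<not> (C \<^bold>\<or> C) \<^bold>\<or> C)" by (rule or_comm)
    then have "\<Gamma> \<turnstile> (\<^bold>\<not> (C \<^bold>\<or> C) \<^bold>\<or> C) \<^bold>\<or> (\<^bold>\<not> (C \<^bold>\<or> C) \<^bold>\<or> C)"
      using imp_orI2 by (rule cut)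
    then show ?thesis by (rule contraction)
  qed
  ultimately show ?thesis by (rule imp_trans)
qed

lemma dis_mem: "A \<in> set As \<Longrightarrow> \<Gamma> \<turnstile> A \<^bold>\<longrightarrow> dis As C"
proof (induction As)
  case (Cons B As)
  then show ?case using imp_orI1 imp_orI2 imp_trans by (cases "A = B") auto
qed simp

lemma dis_last: "\<Gamma> \<turnstile> C \<^bold>\<longrightarrow> dis As C"
proof (induction As)
  case Nil then show ?case by (simp add: imp_refl)
next
  case (Cons B As) then show ?case using imp_orI2 imp_trans by (auto; blast)
qed

lemma dis_elim: "(\<And>A. A \<in> set As \<Longrightarrow> \<Gamma> \<turnstile> A \<^bold>\<longrightarrow> D) \<Longrightarrow> \<Gamma> \<turnstile> C \<^bold>\<longrightarrow> D \<Longrightarrow> \<Gamma> \<turnstile> dis As C \<^bold>\<longrightarrow> D"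
  by (induction As) (auto intro: imp_orE)

text \<open>Exchange, weakening and contraction of disjuncts in one rule; from here on the order and
  multiplicity of the list are immaterial.\<close>

lemma dis_subset: "set As \<subseteq> set Bs \<Longrightarrow> \<Gamma> \<turnstile> dis As C \<Longrightarrow> \<Gamma> \<turnstile> dis Bs C"
  by (erule mp, rule dis_elim) (auto intro: dis_mem dis_last)


abbreviation fls :: fm where "fls \<equiv> \<^bold>\<not> Zero \<^bold>= Zero"

lemma dni: "\<Gamma> \<turnstile> A \<^bold>\<longrightarrow> \<^bold>\<not> \<^bold>\<not> A"
  by (rule or_comm, rule excluded_middle)

lemma fls_imp: "\<Gamma> \<turnstile> fls \<^bold>\<longrightarrow> D"
  by (meson dni expansion identity mp or_comm)

text \<open>\<open>All\<close> abbreviates a negated existential, so the rule is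
  \<open>ex_intro\<close> for the implication from the negation of \<open>A\<close> to
  \<open>fls\<close>.\<close>

lemma generalization: "\<Gamma> \<turnstile> A \<Longrightarrow> \<Gamma> \<turnstile> (\<^bold>\<forall>x. A)"
proof -
  assume "\<Gamma> \<turnstile> A"
  then have "\<Gamma> \<turnstile> \<^bold>\<not> A \<^bold>\<longrightarrow> fls" by (meson dni expansion mp or_comm)
  then have "\<Gamma> \<turnstile> (\<^bold>\<exists>x. \<^bold>\<not> A) \<^bold>\<longrightarrow> fls" by (rule ex_intro) simp
  then show ?thesis by (meson contraction cut fls_imp or_comm)
qed

lemma alls_generalization: "\<Gamma> \<turnstile> A \<Longrightarrow> \<Gamma> \<turnstile> alls xs A"
  unfolding alls_def by (induction xs) (auto intro: generalization)

lemma sat_alls: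
  "sat M \<sigma> (alls xs A) \<longleftrightarrow> (\<forall>\<tau>. (\<forall>x. x \<notin> set xs \<longrightarrow> \<tau> x = \<sigma> x) \<longrightarrow> sat M \<tau> A)"
proof (induction xs arbitrary: \<sigma>)
  case Nil
  have "\<tau> = \<sigma>" if "\<forall>x. \<tau> x = \<sigma> x" for \<tau> using that by auto
  then show ?case by (auto simp: alls_def)
next
  case (Cons y xs)
  have "(\<exists>a. \<forall>x. x \<notin> set xs \<longrightarrow> \<tau> x = (\<sigma>(y := a)) x) \<longleftrightarrow> (\<forall>x. x \<notin> set (y # xs) \<longrightarrow> \<tau> x = \<sigma> x)" for \<tau>
    by (auto intro: exI[of _ "\<tau> y"])
  moreover have "sat M \<sigma> (alls (y # xs) A) \<longleftrightarrow> (\<forall>a. sat M (\<sigma>(y := a)) (alls xs A))"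
    by (simp add: alls_def)
  ultimately show ?case using Cons by metis
qed

lemma finite_tvars [simp]: "finite (tvars t)"
  by (induction t) auto

lemma finite_fvars [simp]: "finite (fvars A)"
  by (induction A) auto

lemma sat_univ_closure: "sat M \<sigma> (univ_closure A) \<longleftrightarrow> (\<forall>\<tau>. sat M \<tau> A)"
proof
  assume c: "sat M \<sigma> (univ_closure A)"
  show "\<forall>\<tau>. sat M \<tau> A"
  proof
    fix \<tau>
    let ?\<tau> = "\<lambda>x. if x \<in> fvars A then \<tau> x else \<sigma> x"
    have "sat M ?\<tau> A" using c unfolding univ_closure_def sat_alls by simp
    then show "sat M \<tau> A" using sat_cong[of A ?\<tau> \<tau> M] by simp
  qed
qed (auto simp: univ_closure_def sat_alls)

subsection \<open>Henkin sets\<close>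

instance tm :: countable by countable_datatype
instance fm :: countable by countable_datatype

text \<open>Bound variables are counted as well: a variable outside this set can replace a free one
  without being captured.\<close>

primrec avars :: "fm \<Rightarrow> nat set" where
  "avars (s \<^bold>= t) = tvars s \<union> tvars t"
| "avars (s \<^bold>< t) = tvars s \<union> tvars t"
| "avars (Tr t) = tvars t"
| "avars (\<^bold>\<not> A) = avars A"
| "avars (A \<^bold>\<or> B) = avars A \<union> avars B"
| "avars (\<^bold>\<exists>x. A) = insert x (avars A)"

lemma finite_avars [simp]: "finite (avars A)"
  by (induction A) auto

lemma fvars_avars: "fvars A \<subseteq> avars A"
  by (induction A) auto

definition fresh :: "fm set \<Rightarrow> nat" where
  "fresh \<Delta> = Suc (Max (insert 0 (\<Union> (avars ` \<Delta>))))"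

lemma fresh: "finite \<Delta> \<Longrightarrow> A \<in> \<Delta> \<Longrightarrow> z \<in> avars A \<Longrightarrow> z < fresh \<Delta>"
  unfolding fresh_def less_Suc_eq_le by (rule Max_ge) auto

text \<open>The elements of \<open>\<Delta>\<close> are not added to the axioms, because free
  variables of axioms may be generalized while those of \<open>\<Delta>\<close> are to act as
  constants. The final disjunct \<open>fls\<close> covers the empty list.\<close>

definition cons :: "fm set \<Rightarrow> fm set \<Rightarrow> bool" where
  "cons \<Gamma> \<Delta> \<longleftrightarrow> (\<forall>As. set As \<subseteq> \<Delta> \<longrightarrow> \<not> (\<Gamma> \<turnstile> dis (map Neg As) fls))"

lemma not_cons_insert:
  assumes "\<not> cons \<Gamma> (insert A \<Delta>)"
  obtains Cs where "set Cs \<subseteq> \<Delta>" "\<Gamma> \<turnstile> A \<^bold>\<longrightarrow> dis (map Neg Cs) fls"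
proof -
  obtain As where As: "set As \<subseteq> insert A \<Delta>" "\<Gamma> \<turnstile> dis (map Neg As) fls"
    using assms by (auto simp: cons_def)
  define Cs where "Cs = filter (\<lambda>B. B \<noteq> A) As"
  have "\<Gamma> \<turnstile> dis (map Neg (A # Cs)) fls"
    using dis_subset[OF _ As(2), of "map Neg (A # Cs)"] by (force simp: Cs_def)
  then show ?thesis using As(1) that[of Cs] by (auto simp: Cs_def)
qed

text \<open>Refutations of \<open>A\<close> and of its negation combine by one cut on
  \<open>A\<close>.\<close>

lemma cons_cases:
  assumes "cons \<Gamma> \<Delta>" "\<not> cons \<Gamma> (insert A \<Delta>)"
  shows "cons \<Gamma> (insert (\<^bold>\<not> A) \<Delta>)"
proof (rule ccontr)
  assume n: "\<not> cons \<Gamma> (insert (\<^bold>\<not> A) \<Delta>)"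
  obtain Cs where C: "set Cs \<subseteq> \<Delta>" "\<Gamma> \<turnstile> \<^bold>\<not> A \<^bold>\<or> dis (map Neg Cs) fls"
    using not_cons_insert[OF assms(2)] by blast
  obtain Ds where D: "set Ds \<subseteq> \<Delta>" "\<Gamma> \<turnstile> \<^bold>\<not> \<^bold>\<not> A \<^bold>\<or> dis (map Neg Ds) fls"
    using not_cons_insert[OF n] by blast
  have "\<Gamma> \<turnstile> dis (map Neg Cs) fls \<^bold>\<or> dis (map Neg Ds) fls"
    using C(2) D(2) by (rule cut)
  moreover have "\<Gamma> \<turnstile> dis (map Neg Cs) fls \<^bold>\<longrightarrow> dis (map Neg (Cs @ Ds)) fls"
    "\<Gamma> \<turnstile> dis (map Neg Ds) fls \<^bold>\<longrightarrow> dis (map Neg (Cs @ Ds)) fls"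
    by (rule dis_elim; force intro: dis_mem dis_last)+
  ultimately have "\<Gamma> \<turnstile> dis (map Neg (Cs @ Ds)) fls"
    by (meson imp_orE mp)
  then show False using assms(1) C D unfolding cons_def by (metis Un_subset_iff set_append)
qed

lemma tsubst_fresh: "y \<notin> tvars t \<Longrightarrow> tsubst y r (tsubst x (Var y) t) = tsubst x r t"
  by (induction t) auto

lemma tsubst_id: "tsubst x (Var x) t = t"
  by (induction t) auto

lemma fsubst_fresh: "y \<notin> avars A \<Longrightarrow> fsubst y (Var x) (fsubst x (Var y) A) = A"
proof (induction A)
  case (Ex z A)
  have "tsubst y r t = t" if "y \<notin> tvars t" for r t using that by (induction t) auto
  then have "fsubst y r B = B" if "y \<notin> avars B" for r B using that by (induction B) auto
  then show ?case using Ex by auto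
qed (auto simp: tsubst_fresh tsubst_id)

lemma free_for_fresh: "y \<notin> avars A \<Longrightarrow> free_for (Var x) y (fsubst x (Var y) A)"
proof (induction A)
  case (Ex z A) then show ?case using fvars_avars[of A] by auto
qed auto

lemma free_for_fresh': "y \<notin> avars A \<Longrightarrow> free_for (Var y) x A"
  by (induction A) auto

text \<open>As \<open>y\<close> occurs nowhere else, \<open>ex_intro\<close> turns a refutation
  using the instance at \<open>y\<close> into one using its existential closure over
  \<open>y\<close>. Renaming \<open>y\<close> back to \<open>x\<close> makes this a refutation from
  \<open>\<exists>x. B\<close>, which \<open>\<Delta>\<close> already contains.\<close>

lemma cons_witness:
  assumes "cons \<Gamma> \<Delta>" "(\<^bold>\<exists>x. B) \<in> \<Delta>" and y: "\<And>A. A \<in> \<Delta> \<Longrightarrow> y \<notin> avars A"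
  shows "cons \<Gamma> (insert (fsubst x (Var y) B) \<Delta>)"
proof (rule ccontr)
  assume n: "\<not> cons \<Gamma> (insert (fsubst x (Var y) B) \<Delta>)"
  have yB: "y \<notin> avars B" "y \<noteq> x" using y assms(2) by force+
  let ?By = "fsubst x (Var y) B"
  obtain Cs where C: "set Cs \<subseteq> \<Delta>" "\<Gamma> \<turnstile> ?By \<^bold>\<longrightarrow> dis (map Neg Cs) fls"
    using not_cons_insert[OF n] by blast
  have "y \<notin> fvars (dis (map Neg Cs) fls)"
    using C(1) y fvars_avars by (induction Cs) auto
  then have 1: "\<Gamma> \<turnstile> (\<^bold>\<exists>y. ?By) \<^bold>\<longrightarrow> dis (map Neg Cs) fls"
    using C(2) ex_intro by blast
  have "\<Gamma> \<turnstile> B \<^bold>\<longrightarrow> (\<^bold>\<exists>y. ?By)"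
    using substitution[OF free_for_fresh[OF yB(1)], of \<Gamma> x] by (simp add: fsubst_fresh yB)
  moreover have "x \<notin> fvars (\<^bold>\<exists>y. ?By)"
  proof -
    have "x \<notin> tvars (tsubst x (Var y) t)" for t using yB by (induction t) auto
    then have "x \<notin> fvars ?By" by (induction B) auto
    then show ?thesis by simp
  qed
  ultimately have "\<Gamma> \<turnstile> (\<^bold>\<exists>x. B) \<^bold>\<longrightarrow> (\<^bold>\<exists>y. ?By)" by (rule ex_intro)
  then have "\<Gamma> \<turnstile> (\<^bold>\<exists>x. B) \<^bold>\<longrightarrow> dis (map Neg Cs) fls" using 1 by (rule imp_trans)
  then have "\<Gamma> \<turnstile> dis (map Neg ((\<^bold>\<exists>x. B) # Cs)) fls" by simp
  then show False using assms(1,2) C(1) unfolding cons_def by (metis insert_subset list.simps(15))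
qed

text \<open>Each stage stays finite, which guarantees a fresh variable as the next witness.\<close>

definition henkin_step :: "fm set \<Rightarrow> fm \<Rightarrow> fm set \<Rightarrow> fm set" where
  "henkin_step \<Gamma> A \<Delta> =
    (if cons \<Gamma> (insert A \<Delta>)
     then insert A \<Delta> \<union> (case A of \<^bold>\<exists>x. B \<Rightarrow> {fsubst x (Var (fresh (insert A \<Delta>))) B} | _ \<Rightarrow> {})
     else insert (\<^bold>\<not> A) \<Delta>)"

primrec henkin :: "fm set \<Rightarrow> fm \<Rightarrow> nat \<Rightarrow> fm set" where
  "henkin \<Gamma> C 0 = {\<^bold>\<not> C}"
| "henkin \<Gamma> C (Suc n) = henkin_step \<Gamma> (from_nat n) (henkin \<Gamma> C n)"

lemma finite_henkin: "finite (henkin \<Gamma> C n)"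
  by (induction n) (auto simp: henkin_step_def split: fm.split)

lemma cons_henkin:
  assumes "\<not> (\<Gamma> \<turnstile> C)"
  shows "cons \<Gamma> (henkin \<Gamma> C n)"
proof (induction n)
  case 0
  have "\<not> (\<Gamma> \<turnstile> dis (map Neg As) fls)" if "set As \<subseteq> {\<^bold>\<not> C}" for As
  proof
    assume "\<Gamma> \<turnstile> dis (map Neg As) fls"
    moreover have "set (map Neg As) \<subseteq> set (map Neg [\<^bold>\<not> C])" using that by auto
    ultimately have "\<Gamma> \<turnstile> dis (map Neg [\<^bold>\<not> C]) fls" using dis_subset by blast
    then have "\<Gamma> \<turnstile> \<^bold>\<not> C \<^bold>\<longrightarrow> C" by (auto intro: or_mono2[OF fls_imp])
    then show False using assms contraction cut excluded_middle or_comm by metis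
  qed
  then show ?case by (auto simp: cons_def)
next
  case (Suc n)
  let ?A = "from_nat n :: fm" let ?D = "henkin \<Gamma> C n"
  show ?case
  proof (cases "cons \<Gamma> (insert ?A ?D)")
    case True
    show ?thesis
    proof (cases "\<exists>x B. ?A = (\<^bold>\<exists>x. B)")
      case ex: True
      then obtain x B where A: "?A = (\<^bold>\<exists>x. B)" by blast
      have "cons \<Gamma> (insert (fsubst x (Var (fresh (insert ?A ?D))) B) (insert ?A ?D))"
      proof (rule cons_witness)
        show "fresh (insert ?A ?D) \<notin> avars B" if "B \<in> insert ?A ?D" for B
          using fresh[OF _ that] finite_henkin by blast
      qed (use True A in auto)
      then show ?thesis using True A by (simp add: henkin_step_def)
    next
      case False
      then show ?thesis using True by (auto simp: henkin_step_def split: fm.split)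
    qed
  next
    case False
    then show ?thesis using Suc cons_cases by (simp add: henkin_step_def)
  qed
qed

definition henkin_set :: "fm set \<Rightarrow> fm \<Rightarrow> fm set" where
  "henkin_set \<Gamma> C = (\<Union>n. henkin \<Gamma> C n)"

lemma henkin_mono: "m \<le> n \<Longrightarrow> henkin \<Gamma> C m \<subseteq> henkin \<Gamma> C n"
  by (rule lift_Suc_mono_le[where f = "henkin \<Gamma> C"]) (auto simp: henkin_step_def)

text \<open>A refutation mentions finitely many formulae, which all occur at one stage.\<close>

lemma cons_henkin_set: "\<not> (\<Gamma> \<turnstile> C) \<Longrightarrow> cons \<Gamma> (henkin_set \<Gamma> C)"
proof -
  assume C: "\<not> (\<Gamma> \<turnstile> C)"
  have "\<exists>n. set As \<subseteq> henkin \<Gamma> C n" if "set As \<subseteq> henkin_set \<Gamma> C" for As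
    using that
  proof (induction As)
    case (Cons A As)
    then obtain m n where "set As \<subseteq> henkin \<Gamma> C n" "A \<in> henkin \<Gamma> C m"
      by (auto simp: henkin_set_def)
    then have "set (A # As) \<subseteq> henkin \<Gamma> C (max m n)"
      using henkin_mono[of m "max m n"] henkin_mono[of n "max m n"] by force
    then show ?case by blast
  qed simp
  then show ?thesis using cons_henkin[OF C] unfolding cons_def by blast
qed

section \<open>Complete Henkin sets and their term models\<close>

locale henkin_theory =
  fixes \<Gamma> :: "fm set" and C :: fm and H :: "fm set"
  assumes not_proves: "\<not> (\<Gamma> \<turnstile> C)"
  defines "H \<equiv> henkin_set \<Gamma> C"
begin

lemma cons_H: "cons \<Gamma> H"
  using cons_henkin_set not_proves by (simp add: H_def)

lemma neg_C: "(\<^bold>\<not> C) \<in> H"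
  unfolding H_def henkin_set_def using henkin.simps(1) by blast

lemma complete: "A \<in> H \<or> (\<^bold>\<not> A) \<in> H"
proof -
  have "A \<in> henkin \<Gamma> C (Suc (to_nat A)) \<or> (\<^bold>\<not> A) \<in> henkin \<Gamma> C (Suc (to_nat A))"
    by (simp add: henkin_step_def)
  then show ?thesis by (auto simp: H_def henkin_set_def simp del: henkin.simps)
qed

text \<open>Otherwise the negation of \<open>B\<close> would be in \<open>H\<close> by completeness,
  and together with \<open>As\<close> it would be refuted.\<close>

lemma deriv: "set As \<subseteq> H \<Longrightarrow> \<Gamma> \<turnstile> dis (map Neg As) B \<Longrightarrow> B \<in> H"
proof (rule ccontr)
  assume a: "set As \<subseteq> H" "\<Gamma> \<turnstile> dis (map Neg As) B" "B \<notin> H"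
  then have n: "(\<^bold>\<not> B) \<in> H" using complete by blast
  have "\<Gamma> \<turnstile> dis (map Neg As) B \<^bold>\<longrightarrow> dis (map Neg ((\<^bold>\<not> B) # As)) fls"
  proof (rule dis_elim)
    show "\<Gamma> \<turnstile> B \<^bold>\<longrightarrow> dis (map Neg ((\<^bold>\<not> B) # As)) fls"
      by (rule imp_trans[OF dni dis_mem]) simp
  qed (rule dis_mem, auto)
  then have "\<Gamma> \<turnstile> dis (map Neg ((\<^bold>\<not> B) # As)) fls" using a mp by blast
  moreover have "set ((\<^bold>\<not> B) # As) \<subseteq> H" using a n by simp
  ultimately show False using cons_H unfolding cons_def by blast
qed

lemma theorem_in: "\<Gamma> \<turnstile> A \<Longrightarrow> A \<in> H"
  using deriv[of "[]"] by simp

lemma neg_iff [simp]: "(\<^bold>\<not> A) \<in> H \<longleftrightarrow> A \<notin> H"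
proof
  assume n: "(\<^bold>\<not> A) \<in> H"
  show "A \<notin> H"
  proof
    assume "A \<in> H"
    then have "fls \<in> H"
      using n deriv[of "[\<^bold>\<not> A, A]" fls] imp_trans[OF imp_refl imp_orI1, of \<Gamma> "\<^bold>\<not> A" fls] by simp
    then have "set [fls] \<subseteq> H" by simp
    moreover have "\<Gamma> \<turnstile> dis (map Neg [fls]) fls" by (simp add: excluded_middle)
    ultimately show False using cons_H unfolding cons_def by blast
  qed
qed (use complete in blast)

lemma or_iff [simp]: "(A \<^bold>\<or> B) \<in> H \<longleftrightarrow> A \<in> H \<or> B \<in> H"
proof
  assume o: "(A \<^bold>\<or> B) \<in> H"
  show "A \<in> H \<or> B \<in> H"
  proof (rule ccontr)
    assume "\<not> (A \<in> H \<or> B \<in> H)"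
    then have "set [A \<^bold>\<or> B, \<^bold>\<not> A] \<subseteq> H" "B \<notin> H" using o by auto
    moreover have "\<Gamma> \<turnstile> dis (map Neg [A \<^bold>\<or> B, \<^bold>\<not> A]) B"
    proof -
      have "\<Gamma> \<turnstile> (A \<^bold>\<or> B) \<^bold>\<longrightarrow> (\<^bold>\<not> \<^bold>\<not> A \<^bold>\<or> B)"
        by (rule imp_orE, rule imp_trans[OF dni imp_orI1], rule imp_orI2)
      then show ?thesis by simp
    qed
    ultimately show False using deriv by blast
  qed
next
  assume "A \<in> H \<or> B \<in> H"
  then show "(A \<^bold>\<or> B) \<in> H"
    using deriv[of "[A]" "A \<^bold>\<or> B"] deriv[of "[B]" "A \<^bold>\<or> B"] by (auto simp: imp_orI1 imp_orI2)
qed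

lemma imp_in: "\<Gamma> \<turnstile> A \<^bold>\<longrightarrow> B \<Longrightarrow> A \<in> H \<Longrightarrow> B \<in> H"
  using theorem_in[of "A \<^bold>\<longrightarrow> B"] by simp

lemma all_in: "(\<^bold>\<forall>x. A) \<in> H \<Longrightarrow> free_for t x A \<Longrightarrow> fsubst x t A \<in> H"
  using imp_in[OF substitution[of t x "\<^bold>\<not> A"]] by auto

lemma ex_in:
  assumes "(\<^bold>\<exists>x. B) \<in> H"
  obtains y where "x < y" "\<And>z. z \<in> avars B \<Longrightarrow> z < y" "fsubst x (Var y) B \<in> H"
proof -
  let ?A = "\<^bold>\<exists>x. B"
  let ?D = "henkin \<Gamma> C (to_nat ?A)"
  have "cons \<Gamma> (insert ?A ?D)"
  proof (rule ccontr)
    assume "\<not> ?thesis"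
    then have "(\<^bold>\<not> ?A) \<in> henkin \<Gamma> C (Suc (to_nat ?A))" by (simp add: henkin_step_def)
    then have "(\<^bold>\<not> ?A) \<in> H" unfolding H_def henkin_set_def by blast
    then show False using assms by simp
  qed
  then have "fsubst x (Var (fresh (insert ?A ?D))) B \<in> henkin \<Gamma> C (Suc (to_nat ?A))"
    by (simp add: henkin_step_def)
  then have "fsubst x (Var (fresh (insert ?A ?D))) B \<in> H"
    unfolding H_def henkin_set_def by blast
  then show ?thesis
    using that[of "fresh (insert ?A ?D)"] fresh[of "insert ?A ?D" ?A] finite_henkin by auto
qed

definition eqv :: "tm \<Rightarrow> tm \<Rightarrow> bool" where "eqv s t \<longleftrightarrow> (s \<^bold>= t) \<in> H"

lemma eqv_refl [simp]: "eqv t t"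
  unfolding eqv_def by (rule theorem_in[OF identity])

lemma eqv_Eq: "eqv s s' \<Longrightarrow> eqv t t' \<Longrightarrow> eqv s t \<Longrightarrow> eqv s' t'"
  using theorem_in[OF eq_Eq[of \<Gamma> s s' t t']] by (simp add: eqv_def)

lemma eqv_sym: "eqv s t \<Longrightarrow> eqv t s"
  using eqv_Eq eqv_refl by blast

lemma eqv_trans: "eqv s t \<Longrightarrow> eqv t u \<Longrightarrow> eqv s u"
  using eqv_Eq eqv_refl by blast

lemma eqv_cong:
  "eqv s s' \<Longrightarrow> eqv (Succ s) (Succ s')"
  "eqv s s' \<Longrightarrow> eqv t t' \<Longrightarrow> eqv (s \<^bold>+ t) (s' \<^bold>+ t')"
  "eqv s s' \<Longrightarrow> eqv t t' \<Longrightarrow> eqv (s \<^bold>* t) (s' \<^bold>* t')"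
  "eqv s s' \<Longrightarrow> eqv t t' \<Longrightarrow> (s \<^bold>< t) \<in> H \<Longrightarrow> (s' \<^bold>< t') \<in> H"
  "eqv s s' \<Longrightarrow> Tr s \<in> H \<Longrightarrow> Tr s' \<in> H"
  using theorem_in[OF eq_Succ[of \<Gamma> s s']] theorem_in[OF eq_Plus[of \<Gamma> s s' t t']]
    theorem_in[OF eq_Times[of \<Gamma> s s' t t']] theorem_in[OF eq_Less[of \<Gamma> s s' t t']]
    theorem_in[OF eq_Tr[of \<Gamma> s s']]
  by (auto simp: eqv_def)

text \<open>Elements of the term model need names that are variables outside a given formula, since
  an arbitrary term might be captured on substitution. A Henkin witness for the existence of
  something equal to \<open>t\<close> is such a name.\<close>

lemma ex_var:
  assumes "finite F"
  obtains y where "y \<notin> F" "eqv (Var y) t"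
proof -
  define x where "x = Suc (Max (insert 0 (F \<union> tvars t)))"
  have x: "z < x" if "z \<in> F \<union> tvars t" for z
    unfolding x_def less_Suc_eq_le by (rule Max_ge) (use that assms in auto)
  then have "x \<notin> tvars t" by blast
  then have "tsubst x r t = t" for r by (induction t) auto
  then have "\<Gamma> \<turnstile> t \<^bold>= t \<^bold>\<longrightarrow> (\<^bold>\<exists>x. Var x \<^bold>= t)"
    using substitution[of t x "Var x \<^bold>= t" \<Gamma>] by simp
  then have "(\<^bold>\<exists>x. Var x \<^bold>= t) \<in> H" using imp_in theorem_in[OF identity] by blast
  then obtain y where "x < y" "fsubst x (Var y) (Var x \<^bold>= t) \<in> H" using ex_in by blast
  then show ?thesis
    using that[of y] x \<open>\<And>r. tsubst x r t = t\<close> by (fastforce simp: eqv_def)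
qed

text \<open>Measure for the truth lemma, where the hypothesis is applied to a substitution instance
  of a subformula rather than to the subformula.\<close>

primrec fdepth :: "fm \<Rightarrow> nat" where
  "fdepth (s \<^bold>= t) = 0"
| "fdepth (s \<^bold>< t) = 0"
| "fdepth (Tr t) = 0"
| "fdepth (\<^bold>\<not> A) = Suc (fdepth A)"
| "fdepth (A \<^bold>\<or> B) = Suc (max (fdepth A) (fdepth B))"
| "fdepth (\<^bold>\<exists>x. A) = Suc (fdepth A)"

lemma fdepth_fsubst [simp]: "fdepth (fsubst x r A) = fdepth A"
  by (induction A) auto

text \<open>The numerals are pairwise inequivalent, as zero is no successor and successor is
  injective.\<close>

lemma infinite_classes:
  assumes "Robinson_Q \<subseteq> \<Gamma>"
  shows "\<not> finite (range (\<lambda>t. {s. eqv t s}))"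
proof -
  have Q: "A \<in> H" if "A \<in> Robinson_Q" for A
    using that assms theorem_in axiom by blast
  have num [simp]: "tsubst x r (num_tm k) = num_tm k" for x r k
    by (induction k) auto
  have 1: "\<not> eqv (Succ (num_tm k)) Zero" for k
    using all_in[OF Q, of 0 "\<^bold>\<not> Succ (Var 0) \<^bold>= Zero" "num_tm k"]
    by (simp add: Robinson_Q_def eqv_def)
  have 2: "eqv (num_tm j) (num_tm k)" if "eqv (Succ (num_tm j)) (Succ (num_tm k))" for j k
  proof -
    have c: "tvars (num_tm k) = {}" for k by (induction k) auto
    have "(\<^bold>\<forall>1. Succ (num_tm j) \<^bold>= Succ (Var 1) \<^bold>\<longrightarrow> num_tm j \<^bold>= Var 1) \<in> H"
      using all_in[OF Q, of 0 "\<^bold>\<forall>1. Succ (Var 0) \<^bold>= Succ (Var 1) \<^bold>\<longrightarrow> Var 0 \<^bold>= Var 1" "num_tm j"]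
      by (simp add: Robinson_Q_def c del: neg_iff or_iff)
    then have "(Succ (num_tm j) \<^bold>= Succ (num_tm k) \<^bold>\<longrightarrow> num_tm j \<^bold>= num_tm k) \<in> H"
      using all_in[of 1 "Succ (num_tm j) \<^bold>= Succ (Var 1) \<^bold>\<longrightarrow> num_tm j \<^bold>= Var 1" "num_tm k"] by simp
    then show ?thesis using that by (simp add: eqv_def)
  qed
  have 3: "j = k" if "eqv (num_tm j) (num_tm k)" for j k
    using that
  proof (induction j arbitrary: k)
    case 0 then show ?case using 1 eqv_sym by (cases k) auto
  next
    case (Suc j) then show ?case using 1 2 by (cases k) auto
  qed
  have "inj (\<lambda>k. {s. eqv (num_tm k) s})"
  proof (rule injI)
    fix j k assume "{s. eqv (num_tm j) s} = {s. eqv (num_tm k) s}"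
    then show "j = k" using 3 eqv_refl by blast
  qed
  then have "infinite (range (\<lambda>k. {s. eqv (num_tm k) s}))" by (rule range_inj_infinite)
  then show ?thesis by (rule contrapos_nn) (erule finite_subset[rotated], blast)
qed

text \<open>Any surjection whose kernel is \<open>eqv\<close> may present the quotient of the terms,
  which lets the domain be a prescribed type.\<close>

lemma term_model:
  assumes f: "surj f" "\<And>s t. f s = f t \<longleftrightarrow> eqv s t"
  obtains M where "\<And>A. sat M (\<lambda>x. f (Var x)) A \<longleftrightarrow> A \<in> H"
proof -
  define g where "g = inv f"
  define M where "M = \<lparr>Zr = f Zero, Sc = \<lambda>a. f (Succ (g a)), Pl = \<lambda>a b. f (g a \<^bold>+ g b),
     Ti = \<lambda>a b. f (g a \<^bold>* g b), Ls = \<lambda>a b. (g a \<^bold>< g b) \<in> H, Tp = \<lambda>a. Tr (g a) \<in> H\<rparr>"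
  define \<sigma> where "\<sigma> = (\<lambda>x. f (Var x))"
  have fg: "f (g a) = a" for a using f(1) by (simp add: g_def surj_f_inv_f)
  have gf: "eqv (g (f t)) t" for t using f(2) fg by blast
  have gf': "eqv t (g (f t))" for t using gf eqv_sym by blast
  have tv: "tval M \<sigma> t = f t" for t
  proof (induction t)
    case (Succ t) then show ?case using f(2) gf by (auto simp: M_def intro!: eqv_cong)
  next
    case (Plus s t) then show ?case using f(2) gf by (auto simp: M_def intro!: eqv_cong)
  next
    case (Times s t) then show ?case using f(2) gf by (auto simp: M_def intro!: eqv_cong)
  qed (auto simp: M_def \<sigma>_def)
  have "sat M \<sigma> A \<longleftrightarrow> A \<in> H" for A
  proof (induction "fdepth A" arbitrary: A rule: less_induct)
    case less
    show ?case
    proof (cases A)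
      case (Eq s t) then show ?thesis by (simp add: tv f(2) eqv_def)
    next
      case (Less s t)
      moreover have "Ls M a b \<longleftrightarrow> (g a \<^bold>< g b) \<in> H" for a b by (simp add: M_def)
      ultimately have "sat M \<sigma> A \<longleftrightarrow> (g (f s) \<^bold>< g (f t)) \<in> H" by (simp add: tv)
      also have "\<dots> \<longleftrightarrow> (s \<^bold>< t) \<in> H"
        using eqv_cong(4)[OF gf gf, of s t] eqv_cong(4)[OF gf' gf', of s t] by blast
      finally show ?thesis using Less by simp
    next
      case (Tr t)
      moreover have "Tp M a \<longleftrightarrow> Tr (g a) \<in> H" for a by (simp add: M_def)
      ultimately have "sat M \<sigma> A \<longleftrightarrow> Tr (g (f t)) \<in> H" by (simp add: tv)
      also have "\<dots> \<longleftrightarrow> Tr t \<in> H"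
        using eqv_cong(5)[OF gf, of t] eqv_cong(5)[OF gf', of t] by blast
      finally show ?thesis using Tr by simp
    next
      case (Neg B) then show ?thesis using less[of B] by simp
    next
      case (Or B D) then show ?thesis using less[of B] less[of D] by simp
    next
      case (Ex x B)
      have IH: "sat M (\<sigma>(x := f (Var y))) B \<longleftrightarrow> fsubst x (Var y) B \<in> H" if "y \<notin> avars B" for y
        using less[of "fsubst x (Var y) B"] Ex sat_fsubst[OF free_for_fresh'[OF that, of x], of M \<sigma>]
        by (simp add: \<sigma>_def)
      show ?thesis
      proof
        assume "sat M \<sigma> A"
        then obtain a where a: "sat M (\<sigma>(x := a)) B" using Ex by auto
        obtain y where y: "y \<notin> avars B" "eqv (Var y) (g a)"
          using ex_var[of "avars B"] by auto
        then have "f (Var y) = a" using f(2) fg by metis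
        then have "fsubst x (Var y) B \<in> H" using a IH y by blast
        then show "A \<in> H" using imp_in[OF substitution[OF free_for_fresh'[OF y(1)]]] Ex by blast
      next
        assume "A \<in> H"
        then obtain y where "\<And>z. z \<in> avars B \<Longrightarrow> z < y" "fsubst x (Var y) B \<in> H"
          using Ex ex_in by blast
        then show "sat M \<sigma> A" using IH[of y] Ex by (metis nat_neq_iff sat.simps(6))
      qed
    qed
  qed
  then show ?thesis unfolding \<sigma>_def by (rule that)
qed

end

text \<open>
  Free variables of a formula serve as Henkin constants. The axioms of \<open>Robinson_Q\<close> make the
  term model infinite, so that it can be transported to any countably infinite type.
\<close>

theorem completeness:
  assumes Q: "Robinson_Q \<subseteq> \<Gamma>" and not: "\<not> (\<Gamma> \<turnstile> C)" and u: "\<exists>h :: 'a \<Rightarrow> nat. bij h"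
  obtains M :: "'a str" and \<sigma> where "models M \<Gamma>" "\<not> sat M \<sigma> C"
proof -
  interpret henkin_theory \<Gamma> C "henkin_set \<Gamma> C" by unfold_locales (rule not)
  let ?q = "\<lambda>t. {s. eqv t s}"
  have "countable (range ?q)" by simp
  then obtain e :: "nat \<Rightarrow> tm set" where e: "bij_betw e UNIV (range ?q)"
    using infinite_classes[OF Q] countable_infiniteE' by blast
  obtain h :: "'a \<Rightarrow> nat" where h: "bij h" using u by blast
  have eh: "bij_betw (e \<circ> h) UNIV (range ?q)" using h e by (rule bij_betw_trans)
  define f where "f = inv_into UNIV (e \<circ> h) \<circ> ?q"
  have bi: "bij_betw (inv_into UNIV (e \<circ> h)) (range ?q) UNIV"
    using eh by (rule bij_betw_inv_into)
  have "surj f"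
    using bij_betw_imp_surj_on[OF bi] unfolding f_def by (simp add: image_comp)
  moreover have "f s = f t \<longleftrightarrow> eqv s t" for s t
  proof -
    have "f s = f t \<longleftrightarrow> ?q s = ?q t"
      using bij_betw_imp_inj_on[OF bi] by (auto simp: f_def inj_on_def)
    also have "\<dots> \<longleftrightarrow> eqv s t" using eqv_sym eqv_trans eqv_refl by blast
    finally show ?thesis .
  qed
  ultimately obtain M where M: "\<And>A. sat M (\<lambda>x. f (Var x)) A \<longleftrightarrow> A \<in> henkin_set \<Gamma> C"
    using term_model by metis
  have "sat M \<sigma> A" if "A \<in> \<Gamma>" for A \<sigma>
  proof -
    \<comment> \<open>The model is controlled at one assignment only, so the axioms pass through
      their closures to reach all assignments.\<close>
    have "\<Gamma> \<turnstile> univ_closure A"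
      unfolding univ_closure_def by (rule alls_generalization[OF axiom[OF that]])
    then have "sat M (\<lambda>x. f (Var x)) (univ_closure A)" using M theorem_in by blast
    then show ?thesis by (simp add: sat_univ_closure)
  qed
  then have "models M \<Gamma>" by (simp add: models_def)
  moreover have "\<not> sat M (\<lambda>x. f (Var x)) C" using M neg_C by simp
  ultimately show ?thesis using that by blast
qed

theorem theorems_eqI:
  assumes "Robinson_Q \<subseteq> \<Gamma>" "Robinson_Q \<subseteq> \<Delta>" "\<exists>h :: 'a \<Rightarrow> nat. bij h"
    and eq: "\<And>M :: 'a str. models M \<Gamma> \<longleftrightarrow> models M \<Delta>"
  shows "theorems \<Gamma> = theorems \<Delta>"
proof -
  have "(\<Gamma> \<turnstile> A) \<longleftrightarrow> (\<Delta> \<turnstile> A)" for A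
    using completeness[OF assms(1) _ assms(3), of A] completeness[OF assms(2) _ assms(3), of A]
      soundness[of \<Gamma> A] soundness[of \<Delta> A] eq by metis
  then show ?thesis by (simp add: theorems_def)
qed

section \<open>A generic model as a type\<close>

lemma free_for_closed: "tvars r \<subseteq> {x} \<Longrightarrow> free_for r x A"
  by (induction A) auto

lemma sat_ind_axiom:
  "sat M \<sigma> (ind_axiom x A) \<longleftrightarrow>
    (\<forall>\<tau>. sat M (\<tau>(x := Zr M)) A \<longrightarrow>
       (\<forall>a. sat M (\<tau>(x := a)) A \<longrightarrow> sat M (\<tau>(x := Sc M a)) A) \<longrightarrow> (\<forall>a. sat M (\<tau>(x := a)) A))"
  unfolding ind_axiom_def sat_univ_closure
  by (auto simp: sat_fsubst free_for_closed)

text \<open>The arithmetical axioms shared by the two theories: \<open>Exp_total\<close> is an axiom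
  on one side and has to be derived on the other.\<close>

definition IDelta0 :: "fm set" where
  "IDelta0 = Robinson_Q \<union> {ind_axiom x A | x A. arithmetical A \<and> delta0 A}"

datatype el = El (un_El: nat)

definition separating :: "el str \<Rightarrow> bool" where
  "separating M \<longleftrightarrow>
    \<not> (models M (CT_minus IDelta0_Exp \<union> {DC}) \<longleftrightarrow> models M (CT0 PA))"

text \<open>
  \<open>M0\<close> distinguishes the two theories if any model of \<open>IDelta0\<close> with this universe does. Thus it
  suffices to argue about \<open>M0\<close>, and the type \<open>el\<close> can carry its operations as type class instances.
\<close>

definition M0 :: "el str" where
  "M0 = (SOME M. models M IDelta0 \<and>
    ((\<exists>N. models N IDelta0 \<and> separating N) \<longrightarrow> separating M))"

text \<open>The fallback in the choice of \<open>M0\<close> when no model separates the theories: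
  then any model of \<open>IDelta0\<close> will do.\<close>

lemma models_IDelta0_standard: "\<exists>M :: el str. models M IDelta0"
proof -
  define M where "M = \<lparr>Zr = El 0, Sc = \<lambda>a. El (Suc (un_El a)),
    Pl = \<lambda>a b. El (un_El a + un_El b), Ti = \<lambda>a b. El (un_El a * un_El b),
    Ls = \<lambda>a b. un_El a < un_El b, Tp = \<lambda>_. False\<rparr>"
  have all: "(\<forall>a. P a) \<longleftrightarrow> (\<forall>n. P (El n))" "(\<exists>a. P a) \<longleftrightarrow> (\<exists>n. P (El n))" for P
    by (metis el.exhaust)+
  have "models M Robinson_Q"
    by (auto simp: models_def Robinson_Q_def M_def all gr0_conv_Suc less_iff_Suc_add add.commute
        intro: Suc_pred[symmetric])
  moreover have "sat M \<sigma> (ind_axiom x A)" for \<sigma> x A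
  proof -
    have ind: "P a" if "P (Zr M)" "\<forall>a. P a \<longrightarrow> P (Sc M a)" for P a
    proof -
      have "P (El n)" for n
        by (induction n) (use that in \<open>auto simp: M_def all\<close>)
      then show ?thesis by (cases a) simp
    qed
    show ?thesis
      unfolding sat_ind_axiom
    proof (intro allI impI)
      fix \<tau> a
      assume "sat M (\<tau>(x := Zr M)) A" "\<forall>a. sat M (\<tau>(x := a)) A \<longrightarrow> sat M (\<tau>(x := Sc M a)) A"
      then show "sat M (\<tau>(x := a)) A" by (rule ind[where P = "\<lambda>a. sat M (\<tau>(x := a)) A"])
    qed
  qed
  ultimately have "models M IDelta0" by (auto simp: IDelta0_def models_def)
  then show ?thesis by (rule exI)
qed

lemma M0_properties:
  "models M0 IDelta0" "models N IDelta0 \<Longrightarrow> separating N \<Longrightarrow> separating M0"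
proof -
  let ?P = "\<lambda>M. models M IDelta0 \<and> ((\<exists>N. models N IDelta0 \<and> separating N) \<longrightarrow> separating M)"
  have "\<exists>M. ?P M"
    using models_IDelta0_standard by (cases "\<exists>N. models N IDelta0 \<and> separating N") auto
  then have "?P M0" unfolding M0_def by (rule someI_ex)
  then show "models M0 IDelta0" "models N IDelta0 \<Longrightarrow> separating N \<Longrightarrow> separating M0" by auto
qed

text \<open>The class of discrete ordered semidomains requires a subtraction; it is truncated at
  \<open>0\<close>.\<close>

instantiation el :: "{zero, one, plus, times, minus, ord}"
begin
definition zero_el_def: "0 = Zr M0"
definition one_el_def: "1 = Sc M0 (Zr M0)"
definition plus_el_def: "x + y = Pl M0 x y"
definition times_el_def: "x * y = Ti M0 x y"
definition less_el_def: "x < y \<longleftrightarrow> Ls M0 x y"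
definition less_eq_el_def: "x \<le> (y :: el) \<longleftrightarrow> x < y \<or> x = y"
definition minus_el_def: "x - y = (if y \<le> x then THE z :: el. y + z = x else 0)"
instance ..
end

abbreviation TT :: "el \<Rightarrow> bool" where "TT \<equiv> Tp M0"

lemma M0_Q:
  fixes x y :: el
  shows Sc_neq_0: "Sc M0 x \<noteq> 0" and Sc_inj: "Sc M0 x = Sc M0 y \<Longrightarrow> x = y"
    and Sc_cases: "x \<noteq> 0 \<Longrightarrow> \<exists>y. x = Sc M0 y"
    and add_0: "x + 0 = x" and add_Sc: "x + Sc M0 y = Sc M0 (x + y)"
    and mult_0: "x * 0 = 0" and mult_Sc: "x * Sc M0 y = x * y + x"
    and less_iff: "x < y \<longleftrightarrow> (\<exists>z. Sc M0 z + x = y)"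
proof -
  have Q: "sat M0 (\<lambda>_. x) A" if "A \<in> Robinson_Q" for A
    using M0_properties(1) that by (auto simp: models_def IDelta0_def)
  note defs = Robinson_Q_def zero_el_def plus_el_def times_el_def less_el_def
  show "Sc M0 x \<noteq> 0"
    using Q[of "\<^bold>\<forall>0. \<^bold>\<not> Succ (Var 0) \<^bold>= Zero"] by (simp add: defs)
  show "Sc M0 x = Sc M0 y \<Longrightarrow> x = y"
    using Q[of "\<^bold>\<forall>0. \<^bold>\<forall>1. Succ (Var 0) \<^bold>= Succ (Var 1) \<^bold>\<longrightarrow> Var 0 \<^bold>= Var 1"] by (simp add: defs)
  show "x \<noteq> 0 \<Longrightarrow> \<exists>y. x = Sc M0 y"
    using Q[of "\<^bold>\<forall>0. \<^bold>\<not> Var 0 \<^bold>= Zero \<^bold>\<longrightarrow> (\<^bold>\<exists>1. Var 0 \<^bold>= Succ (Var 1))"] by (auto simp: defs)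
  show "x + 0 = x"
    using Q[of "\<^bold>\<forall>0. Var 0 \<^bold>+ Zero \<^bold>= Var 0"] by (simp add: defs)
  show "x + Sc M0 y = Sc M0 (x + y)"
    using Q[of "\<^bold>\<forall>0. \<^bold>\<forall>1. Var 0 \<^bold>+ Succ (Var 1) \<^bold>= Succ (Var 0 \<^bold>+ Var 1)"] by (simp add: defs)
  show "x * 0 = 0"
    using Q[of "\<^bold>\<forall>0. Var 0 \<^bold>* Zero \<^bold>= Zero"] by (simp add: defs)
  show "x * Sc M0 y = x * y + x"
    using Q[of "\<^bold>\<forall>0. \<^bold>\<forall>1. Var 0 \<^bold>* Succ (Var 1) \<^bold>= Var 0 \<^bold>* Var 1 \<^bold>+ Var 0"]
    by (simp add: defs)
  have "sat M0 (\<lambda>_. x) (\<^bold>\<forall>0. \<^bold>\<forall>1. Var 0 \<^bold>< Var 1 \<^bold>\<longleftrightarrow> (\<^bold>\<exists>2. Succ (Var 2) \<^bold>+ Var 0 \<^bold>= Var 1))"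
    by (rule Q) (simp add: Robinson_Q_def)
  then have "\<forall>a b. Ls M0 a b \<longleftrightarrow> (\<exists>c. Pl M0 (Sc M0 c) a = b)" by auto
  then show "x < y \<longleftrightarrow> (\<exists>z. Sc M0 z + x = y)" by (simp add: less_el_def plus_el_def)
qed

lemma Sc_eq: "Sc M0 x = x + 1"
  unfolding one_el_def zero_el_def[symmetric] add_Sc add_0 ..

lemma tval_M0 [simp]:
  "tval M0 \<sigma> Zero = 0" "tval M0 \<sigma> (Succ t) = tval M0 \<sigma> t + 1"
  "tval M0 \<sigma> (s \<^bold>+ t) = tval M0 \<sigma> s + tval M0 \<sigma> t"
  "tval M0 \<sigma> (s \<^bold>* t) = tval M0 \<sigma> s * tval M0 \<sigma> t"
  by (simp_all add: zero_el_def plus_el_def[symmetric] times_el_def Sc_eq)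

declare tval.simps(1,3-5) [simp del]

lemma sat_M0_less [simp]: "sat M0 \<sigma> (s \<^bold>< t) \<longleftrightarrow> tval M0 \<sigma> s < tval M0 \<sigma> t"
  by (simp add: less_el_def)

declare sat.simps(2) [simp del]

subsection \<open>Definable predicates\<close>

text \<open>
  Predicates of an environment given by formulae with parameters. Environments are used in the
  style of de Bruijn: a quantifier pushes a new value in front of the environment. Unbounded
  quantifiers are allowed if \<open>u\<close>, the truth predicate is allowed if \<open>w\<close>.
\<close>

inductive trm :: "((nat \<Rightarrow> el) \<Rightarrow> el) \<Rightarrow> bool" where
  trm_var: "trm (\<lambda>e. e i)"
| trm_const: "trm (\<lambda>e. c)"
| trm_plus: "trm s \<Longrightarrow> trm t \<Longrightarrow> trm (\<lambda>e. s e + t e)"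
| trm_times: "trm s \<Longrightarrow> trm t \<Longrightarrow> trm (\<lambda>e. s e * t e)"

lemmas trm_intros = trm_var trm_const trm_plus trm_times

inductive dfn :: "bool \<Rightarrow> bool \<Rightarrow> ((nat \<Rightarrow> el) \<Rightarrow> bool) \<Rightarrow> bool" for u w :: bool where
  dfn_eq0: "trm s \<Longrightarrow> trm t \<Longrightarrow> dfn u w (\<lambda>e. s e = t e)"
| dfn_less0: "trm s \<Longrightarrow> trm t \<Longrightarrow> dfn u w (\<lambda>e. s e < t e)"
| dfn_TT0: "w \<Longrightarrow> trm t \<Longrightarrow> dfn u w (\<lambda>e. TT (t e))"
| dfn_not: "dfn u w P \<Longrightarrow> dfn u w (\<lambda>e. \<not> P e)"
| dfn_disj: "dfn u w P \<Longrightarrow> dfn u w Q \<Longrightarrow> dfn u w (\<lambda>e. P e \<or> Q e)"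
| dfn_bex00: "trm t \<Longrightarrow> dfn u w P \<Longrightarrow> dfn u w (\<lambda>e. \<exists>y. y < t e \<and> P (case_nat y e))"
| dfn_ex00: "u \<Longrightarrow> dfn u w P \<Longrightarrow> dfn u w (\<lambda>e. \<exists>y. P (case_nat y e))"

text \<open>
  The variables of the environment are named by \<open>\<nu>\<close> and the parameters by \<open>\<pi>\<close>; only those in the
  finite sets \<open>I\<close> and \<open>C\<close> matter.
\<close>

definition agree :: "(nat \<Rightarrow> nat) \<Rightarrow> (el \<Rightarrow> nat) \<Rightarrow> nat set \<Rightarrow> el set \<Rightarrow> (nat \<Rightarrow> el) \<Rightarrow> (nat \<Rightarrow> el) \<Rightarrow> bool" where
  "agree \<nu> \<pi> I C \<sigma> e \<longleftrightarrow> (\<forall>i\<in>I. \<sigma> (\<nu> i) = e i) \<and> (\<forall>c\<in>C. \<sigma> (\<pi> c) = c)"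

lemma agree_Un: "agree \<nu> \<pi> (I \<union> J) (C \<union> D) \<sigma> e \<longleftrightarrow> agree \<nu> \<pi> I C \<sigma> e \<and> agree \<nu> \<pi> J D \<sigma> e"
  by (auto simp: agree_def)

text \<open>All namings \<open>\<nu>\<close> and \<open>\<pi>\<close> are allowed because a
  quantifier extends \<open>\<nu>\<close> by a new name at index \<open>0\<close>. The variables of
  \<open>r\<close> are controlled to meet the side condition of \<open>delta0\<close> on bounding
  terms.\<close>

definition tm_rep :: "((nat \<Rightarrow> el) \<Rightarrow> el) \<Rightarrow> nat set \<Rightarrow> el set \<Rightarrow> bool" where
  "tm_rep t I C \<longleftrightarrow> finite I \<and> finite C \<and>
    (\<forall>\<nu> \<pi>. \<exists>r. tvars r \<subseteq> \<nu> ` I \<union> \<pi> ` C \<and> (\<forall>\<sigma> e. agree \<nu> \<pi> I C \<sigma> e \<longrightarrow> tval M0 \<sigma> r = t e))"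

definition fm_rep :: "bool \<Rightarrow> bool \<Rightarrow> ((nat \<Rightarrow> el) \<Rightarrow> bool) \<Rightarrow> nat set \<Rightarrow> el set \<Rightarrow> bool" where
  "fm_rep u w P I C \<longleftrightarrow> finite I \<and> finite C \<and>
    (\<forall>\<nu> \<pi>. \<exists>A. (u \<or> delta0 A) \<and> (w \<or> arithmetical A) \<and>
       (\<forall>\<sigma> e. agree \<nu> \<pi> I C \<sigma> e \<longrightarrow> sat M0 \<sigma> A = P e))"

lemma tm_repE:
  assumes "tm_rep t I C"
  obtains r where "tvars r \<subseteq> \<nu> ` I \<union> \<pi> ` C" "\<And>\<sigma> e. agree \<nu> \<pi> I C \<sigma> e \<Longrightarrow> tval M0 \<sigma> r = t e"
proof -
  have "\<exists>r. tvars r \<subseteq> \<nu> ` I \<union> \<pi> ` C \<and> (\<forall>\<sigma> e. agree \<nu> \<pi> I C \<sigma> e \<longrightarrow> tval M0 \<sigma> r = t e)"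
    using assms by (simp add: tm_rep_def)
  then show ?thesis using that by auto
qed

lemma fm_repE:
  assumes "fm_rep u w P I C"
  obtains A where "u \<or> delta0 A" "w \<or> arithmetical A"
    "\<And>\<sigma> e. agree \<nu> \<pi> I C \<sigma> e \<Longrightarrow> sat M0 \<sigma> A = P e"
proof -
  have "\<exists>A. (u \<or> delta0 A) \<and> (w \<or> arithmetical A) \<and>
       (\<forall>\<sigma> e. agree \<nu> \<pi> I C \<sigma> e \<longrightarrow> sat M0 \<sigma> A = P e)"
    using assms by (simp add: fm_rep_def)
  then show ?thesis using that by auto
qed

lemma tm_rep_mono:
  assumes "tm_rep t I C" "finite J" "finite D"
  shows "tm_rep t (I \<union> J) (C \<union> D)"
  unfolding tm_rep_def agree_Un
proof (intro conjI allI)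
  fix \<nu> \<pi>
  obtain r where "tvars r \<subseteq> \<nu> ` I \<union> \<pi> ` C" "\<And>\<sigma> e. agree \<nu> \<pi> I C \<sigma> e \<Longrightarrow> tval M0 \<sigma> r = t e"
    by (rule tm_repE[OF assms(1)]) blast
  then show "\<exists>r. tvars r \<subseteq> \<nu> ` (I \<union> J) \<union> \<pi> ` (C \<union> D) \<and>
      (\<forall>\<sigma> e. agree \<nu> \<pi> I C \<sigma> e \<and> agree \<nu> \<pi> J D \<sigma> e \<longrightarrow> tval M0 \<sigma> r = t e)"
    by (intro exI[of _ r]) auto
qed (use assms in \<open>auto simp: tm_rep_def\<close>)

lemma fm_rep_mono:
  assumes "fm_rep u w P I C" "finite J" "finite D"
  shows "fm_rep u w P (I \<union> J) (C \<union> D)"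
  unfolding fm_rep_def agree_Un
proof (intro conjI allI)
  fix \<nu> \<pi>
  obtain A where "u \<or> delta0 A" "w \<or> arithmetical A"
    "\<And>\<sigma> e. agree \<nu> \<pi> I C \<sigma> e \<Longrightarrow> sat M0 \<sigma> A = P e" by (rule fm_repE[OF assms(1)]) blast
  then show "\<exists>A. (u \<or> delta0 A) \<and> (w \<or> arithmetical A) \<and>
      (\<forall>\<sigma> e. agree \<nu> \<pi> I C \<sigma> e \<and> agree \<nu> \<pi> J D \<sigma> e \<longrightarrow> sat M0 \<sigma> A = P e)"
    by (intro exI[of _ A]) auto
qed (use assms in \<open>auto simp: fm_rep_def\<close>)

lemma tm_rep_2:
  assumes "tm_rep s I C" "tm_rep t J D"
  shows "tm_rep s (I \<union> J) (C \<union> D)" "tm_rep t (I \<union> J) (C \<union> D)"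
proof -
  have "finite I" "finite C" "finite J" "finite D" using assms by (simp_all add: tm_rep_def)
  then show "tm_rep s (I \<union> J) (C \<union> D)" "tm_rep t (I \<union> J) (C \<union> D)"
    using tm_rep_mono[OF assms(1), of J D] tm_rep_mono[OF assms(2), of I C]
    by (simp_all only: Un_commute)
qed

lemma fm_rep_2:
  assumes "fm_rep u w P I C" "fm_rep u w Q J D"
  shows "fm_rep u w P (I \<union> J) (C \<union> D)" "fm_rep u w Q (I \<union> J) (C \<union> D)"
proof -
  have "finite I" "finite C" "finite J" "finite D" using assms by (simp_all add: fm_rep_def)
  then show "fm_rep u w P (I \<union> J) (C \<union> D)" "fm_rep u w Q (I \<union> J) (C \<union> D)"
    using fm_rep_mono[OF assms(1), of J D] fm_rep_mono[OF assms(2), of I C]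
    by (simp_all only: Un_commute)
qed

lemma trm_formula: "trm t \<Longrightarrow> \<exists>I C. tm_rep t I C"
proof (induction rule: trm.induct)
  case (trm_var i)
  have "tm_rep (\<lambda>e. e i) {i} {}"
    unfolding tm_rep_def agree_def
  proof (intro conjI allI)
    fix \<nu> :: "nat \<Rightarrow> nat" and \<pi> :: "el \<Rightarrow> nat"
    show "\<exists>r. tvars r \<subseteq> \<nu> ` {i} \<union> \<pi> ` {} \<and> (\<forall>\<sigma> e. (\<forall>j\<in>{i}. \<sigma> (\<nu> j) = e j) \<and>
        (\<forall>c\<in>{}. \<sigma> (\<pi> c) = c) \<longrightarrow> tval M0 \<sigma> r = e i)"
      by (rule exI[of _ "Var (\<nu> i)"]) simp
  qed auto
  then show ?case by (intro exI)
next
  case (trm_const c)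
  have "tm_rep (\<lambda>e. c) {} {c}"
    unfolding tm_rep_def agree_def
  proof (intro conjI allI)
    fix \<nu> :: "nat \<Rightarrow> nat" and \<pi> :: "el \<Rightarrow> nat"
    show "\<exists>r. tvars r \<subseteq> \<nu> ` {} \<union> \<pi> ` {c} \<and> (\<forall>\<sigma> e :: nat \<Rightarrow> el. (\<forall>j\<in>{}. \<sigma> (\<nu> j) = e j) \<and>
        (\<forall>c\<in>{c}. \<sigma> (\<pi> c) = c) \<longrightarrow> tval M0 \<sigma> r = c)"
      by (rule exI[of _ "Var (\<pi> c)"]) simp
  qed auto
  then show ?case by (intro exI)
next
  case (trm_plus s t)
  obtain I1 C1 where "tm_rep s I1 C1" using trm_plus.IH(1) by (elim exE)
  moreover obtain I2 C2 where "tm_rep t I2 C2" using trm_plus.IH(2) by (elim exE)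
  moreover define I C where "I = I1 \<union> I2" "C = C1 \<union> C2"
  ultimately have r: "tm_rep s I C" "tm_rep t I C" using tm_rep_2 by simp_all
  have "\<exists>r. tvars r \<subseteq> \<nu> ` I \<union> \<pi> ` C \<and> (\<forall>\<sigma> e. agree \<nu> \<pi> I C \<sigma> e \<longrightarrow> tval M0 \<sigma> r = s e + t e)" for \<nu> \<pi>
  proof -
    obtain r1 where r1: "tvars r1 \<subseteq> \<nu> ` I \<union> \<pi> ` C"
      "\<And>\<sigma> e. agree \<nu> \<pi> I C \<sigma> e \<Longrightarrow> tval M0 \<sigma> r1 = s e" by (rule tm_repE[OF r(1)]) blast
    obtain r2 where r2: "tvars r2 \<subseteq> \<nu> ` I \<union> \<pi> ` C"
      "\<And>\<sigma> e. agree \<nu> \<pi> I C \<sigma> e \<Longrightarrow> tval M0 \<sigma> r2 = t e" by (rule tm_repE[OF r(2)]) blast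
    show ?thesis by (rule exI[of _ "r1 \<^bold>+ r2"]) (use r1 r2 in simp)
  qed
  then have "tm_rep (\<lambda>e. s e + t e) I C" using r by (simp add: tm_rep_def)
  then show ?case by (intro exI)
next
  case (trm_times s t)
  obtain I1 C1 where "tm_rep s I1 C1" using trm_times.IH(1) by (elim exE)
  moreover obtain I2 C2 where "tm_rep t I2 C2" using trm_times.IH(2) by (elim exE)
  moreover define I C where "I = I1 \<union> I2" "C = C1 \<union> C2"
  ultimately have r: "tm_rep s I C" "tm_rep t I C" using tm_rep_2 by simp_all
  have "\<exists>r. tvars r \<subseteq> \<nu> ` I \<union> \<pi> ` C \<and> (\<forall>\<sigma> e. agree \<nu> \<pi> I C \<sigma> e \<longrightarrow> tval M0 \<sigma> r = s e * t e)" for \<nu> \<pi>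
  proof -
    obtain r1 where r1: "tvars r1 \<subseteq> \<nu> ` I \<union> \<pi> ` C"
      "\<And>\<sigma> e. agree \<nu> \<pi> I C \<sigma> e \<Longrightarrow> tval M0 \<sigma> r1 = s e" by (rule tm_repE[OF r(1)]) blast
    obtain r2 where r2: "tvars r2 \<subseteq> \<nu> ` I \<union> \<pi> ` C"
      "\<And>\<sigma> e. agree \<nu> \<pi> I C \<sigma> e \<Longrightarrow> tval M0 \<sigma> r2 = t e" by (rule tm_repE[OF r(2)]) blast
    show ?thesis by (rule exI[of _ "r1 \<^bold>* r2"]) (use r1 r2 in simp)
  qed
  then have "tm_rep (\<lambda>e. s e * t e) I C" using r by (simp add: tm_rep_def)
  then show ?case by (intro exI)
qed

lemma trm2E:
  assumes "trm s" "trm t"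
  obtains I C where "finite I" "finite C" "\<And>\<nu> \<pi>. \<exists>r1 r2. \<forall>\<sigma> e. agree \<nu> \<pi> I C \<sigma> e \<longrightarrow>
      tval M0 \<sigma> r1 = s e \<and> tval M0 \<sigma> r2 = t e"
proof -
  obtain I1 C1 where "tm_rep s I1 C1" using trm_formula[OF assms(1)] by (elim exE)
  moreover obtain I2 C2 where "tm_rep t I2 C2" using trm_formula[OF assms(2)] by (elim exE)
  moreover define I C where "I = I1 \<union> I2" "C = C1 \<union> C2"
  ultimately have r: "tm_rep s I C" "tm_rep t I C" using tm_rep_2 by simp_all
  show ?thesis
  proof (rule that[of I C])
    fix \<nu> \<pi>
    obtain r1 where "\<And>\<sigma> e. agree \<nu> \<pi> I C \<sigma> e \<Longrightarrow> tval M0 \<sigma> r1 = s e"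
      by (rule tm_repE[OF r(1)]) blast
    moreover obtain r2 where "\<And>\<sigma> e. agree \<nu> \<pi> I C \<sigma> e \<Longrightarrow> tval M0 \<sigma> r2 = t e"
      by (rule tm_repE[OF r(2)]) blast
    ultimately show "\<exists>r1 r2. \<forall>\<sigma> e. agree \<nu> \<pi> I C \<sigma> e \<longrightarrow> tval M0 \<sigma> r1 = s e \<and> tval M0 \<sigma> r2 = t e"
      by blast
  qed (use r in \<open>simp_all add: tm_rep_def\<close>)
qed

text \<open>The bridge from closure rules to genuine formulae, which are what the induction axioms
  speak about.\<close>

lemma dfn_formula: "dfn u w P \<Longrightarrow> \<exists>I C. fm_rep u w P I C"
proof (induction rule: dfn.induct)
  case (dfn_eq0 s t)
  then obtain I C where f: "finite I" "finite C" and r: "\<And>\<nu> \<pi>. \<exists>r1 r2. \<forall>\<sigma> e. agree \<nu> \<pi> I C \<sigma> e \<longrightarrow>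
      tval M0 \<sigma> r1 = s e \<and> tval M0 \<sigma> r2 = t e" using trm2E by metis
  have "\<exists>A. (u \<or> delta0 A) \<and> (w \<or> arithmetical A) \<and>
       (\<forall>\<sigma> e. agree \<nu> \<pi> I C \<sigma> e \<longrightarrow> sat M0 \<sigma> A = (s e = t e))" for \<nu> \<pi>
  proof -
    obtain r1 r2 where "\<forall>\<sigma> e. agree \<nu> \<pi> I C \<sigma> e \<longrightarrow> tval M0 \<sigma> r1 = s e \<and> tval M0 \<sigma> r2 = t e"
      using r by metis
    then show ?thesis by (intro exI[of _ "r1 \<^bold>= r2"]) (simp add: delta0.intros)
  qed
  then show ?case using f unfolding fm_rep_def by (intro exI[of _ I] exI[of _ C]) simp
next
  case (dfn_less0 s t)
  then obtain I C where f: "finite I" "finite C" and r: "\<And>\<nu> \<pi>. \<exists>r1 r2. \<forall>\<sigma> e. agree \<nu> \<pi> I C \<sigma> e \<longrightarrow>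
      tval M0 \<sigma> r1 = s e \<and> tval M0 \<sigma> r2 = t e" using trm2E by metis
  have "\<exists>A. (u \<or> delta0 A) \<and> (w \<or> arithmetical A) \<and>
       (\<forall>\<sigma> e. agree \<nu> \<pi> I C \<sigma> e \<longrightarrow> sat M0 \<sigma> A = (s e < t e))" for \<nu> \<pi>
  proof -
    obtain r1 r2 where "\<forall>\<sigma> e. agree \<nu> \<pi> I C \<sigma> e \<longrightarrow> tval M0 \<sigma> r1 = s e \<and> tval M0 \<sigma> r2 = t e"
      using r by metis
    then show ?thesis by (intro exI[of _ "r1 \<^bold>< r2"]) (simp add: delta0.intros)
  qed
  then show ?case using f unfolding fm_rep_def by (intro exI[of _ I] exI[of _ C]) simp
next
  case (dfn_TT0 t)
  obtain I C where r: "tm_rep t I C" using trm_formula[OF dfn_TT0(2)] by (elim exE)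
  have "\<exists>A. (u \<or> delta0 A) \<and> (w \<or> arithmetical A) \<and>
       (\<forall>\<sigma> e. agree \<nu> \<pi> I C \<sigma> e \<longrightarrow> sat M0 \<sigma> A = TT (t e))" for \<nu> \<pi>
  proof -
    obtain r1 where "\<And>\<sigma> e. agree \<nu> \<pi> I C \<sigma> e \<Longrightarrow> tval M0 \<sigma> r1 = t e"
      by (rule tm_repE[OF r]) blast
    then show ?thesis using dfn_TT0(1) by (intro exI[of _ "Tr r1"]) (simp add: delta0.intros)
  qed
  then show ?case using r unfolding fm_rep_def tm_rep_def by (intro exI[of _ I] exI[of _ C]) simp
next
  case (dfn_not P)
  then obtain I C where r: "fm_rep u w P I C" by (elim exE)
  have "\<exists>A. (u \<or> delta0 A) \<and> (w \<or> arithmetical A) \<and>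
       (\<forall>\<sigma> e. agree \<nu> \<pi> I C \<sigma> e \<longrightarrow> sat M0 \<sigma> A = (\<not> P e))" for \<nu> \<pi>
  proof -
    obtain A where "u \<or> delta0 A" "w \<or> arithmetical A"
      "\<And>\<sigma> e. agree \<nu> \<pi> I C \<sigma> e \<Longrightarrow> sat M0 \<sigma> A = P e" by (rule fm_repE[OF r]) blast
    then show ?thesis by (intro exI[of _ "\<^bold>\<not> A"]) (auto intro: delta0.intros)
  qed
  then have "fm_rep u w (\<lambda>e. \<not> P e) I C" using r by (simp add: fm_rep_def)
  then show ?case by (intro exI)
next
  case (dfn_disj P Q)
  obtain I1 C1 where "fm_rep u w P I1 C1" using dfn_disj.IH(1) by (elim exE)
  moreover obtain I2 C2 where "fm_rep u w Q I2 C2" using dfn_disj.IH(2) by (elim exE)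
  moreover define I C where "I = I1 \<union> I2" "C = C1 \<union> C2"
  ultimately have r: "fm_rep u w P I C" "fm_rep u w Q I C" using fm_rep_2 by simp_all
  have "\<exists>A. (u \<or> delta0 A) \<and> (w \<or> arithmetical A) \<and>
       (\<forall>\<sigma> e. agree \<nu> \<pi> I C \<sigma> e \<longrightarrow> sat M0 \<sigma> A = (P e \<or> Q e))" for \<nu> \<pi>
  proof -
    obtain A where A: "u \<or> delta0 A" "w \<or> arithmetical A"
      "\<And>\<sigma> e. agree \<nu> \<pi> I C \<sigma> e \<Longrightarrow> sat M0 \<sigma> A = P e" by (rule fm_repE[OF r(1)]) blast
    obtain B where B: "u \<or> delta0 B" "w \<or> arithmetical B"
      "\<And>\<sigma> e. agree \<nu> \<pi> I C \<sigma> e \<Longrightarrow> sat M0 \<sigma> B = Q e" by (rule fm_repE[OF r(2)]) blast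
    show ?thesis by (rule exI[of _ "A \<^bold>\<or> B"]) (use A B in \<open>auto intro: delta0.intros\<close>)
  qed
  then have "fm_rep u w (\<lambda>e. P e \<or> Q e) I C" using r by (simp add: fm_rep_def)
  then show ?case by (intro exI)
next
  case (dfn_bex00 t P)
  obtain J D where "tm_rep t J D" using trm_formula[OF dfn_bex00(1)] by (elim exE)
  moreover obtain J' D' where P: "fm_rep u w P J' D'" using dfn_bex00.IH by (elim exE)
  \<comment> \<open>Inside the body index \<open>0\<close> is the quantified value, so each other
    index of the body is one more than its index outside.\<close>
  moreover define I where "I = J \<union> {i. Suc i \<in> J'}"
  moreover define C where "C = D \<union> D'"
  moreover have "finite {i. Suc i \<in> J'}"
    using P finite_vimageI[of J' Suc] by (simp add: fm_rep_def vimage_def)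
  moreover have "finite J" "finite D" "finite D'"
    using P \<open>tm_rep t J D\<close> by (simp_all add: fm_rep_def tm_rep_def)
  ultimately have t: "tm_rep t I C" and f: "finite I" "finite C"
    by (simp_all add: tm_rep_mono)
  have "\<exists>A. (u \<or> delta0 A) \<and> (w \<or> arithmetical A) \<and>
       (\<forall>\<sigma> e. agree \<nu> \<pi> I C \<sigma> e \<longrightarrow> sat M0 \<sigma> A = (\<exists>y. y < t e \<and> P (case_nat y e)))" for \<nu> \<pi>
  proof -
    have "finite (\<nu> ` I \<union> \<pi> ` C)" using f by simp
    then obtain z where z: "z \<notin> \<nu> ` I \<union> \<pi> ` C" using ex_new_if_finite infinite_UNIV_nat by blast
    obtain r where r: "tvars r \<subseteq> \<nu> ` I \<union> \<pi> ` C"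
      "\<And>\<sigma> e. agree \<nu> \<pi> I C \<sigma> e \<Longrightarrow> tval M0 \<sigma> r = t e" by (rule tm_repE[OF t]) blast
    obtain A where A: "u \<or> delta0 A" "w \<or> arithmetical A"
      "\<And>\<sigma> e. agree (case_nat z \<nu>) \<pi> J' D' \<sigma> e \<Longrightarrow> sat M0 \<sigma> A = P e" by (rule fm_repE[OF P]) blast
    have ag: "agree \<nu> \<pi> I C (\<sigma>(z := y)) e" "agree (case_nat z \<nu>) \<pi> J' D' (\<sigma>(z := y)) (case_nat y e)"
      if "agree \<nu> \<pi> I C \<sigma> e" for \<sigma> e y
      using that z by (auto simp: agree_def I_def C_def split: nat.split)
    show ?thesis
    proof (intro exI[of _ "\<^bold>\<exists>z. Var z \<^bold>< r \<^bold>\<and> A"] conjI allI impI)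
      show "u \<or> delta0 (\<^bold>\<exists>z. Var z \<^bold>< r \<^bold>\<and> A)" using A(1) r(1) z delta0.intros(6) by blast
      fix \<sigma> e assume a: "agree \<nu> \<pi> I C \<sigma> e"
      then have "sat M0 (\<sigma>(z := y)) A = P (case_nat y e)" "tval M0 (\<sigma>(z := y)) r = t e" for y
        using A(3) r(2) ag by blast+
      then show "sat M0 \<sigma> (\<^bold>\<exists>z. Var z \<^bold>< r \<^bold>\<and> A) = (\<exists>y. y < t e \<and> P (case_nat y e))" by simp
    qed (use A(2) in simp)
  qed
  then have "fm_rep u w (\<lambda>e. \<exists>y. y < t e \<and> P (case_nat y e)) I C" using f by (simp add: fm_rep_def)
  then show ?case by (intro exI)
next
  case (dfn_ex00 P)
  obtain J' D' where P: "fm_rep u w P J' D'" using dfn_ex00.IH by (elim exE)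
  define I where "I = {i. Suc i \<in> J'}"
  have f: "finite I" "finite D'"
    using P finite_vimageI[of J' Suc] by (simp_all add: fm_rep_def vimage_def I_def)
  have "\<exists>A. (u \<or> delta0 A) \<and> (w \<or> arithmetical A) \<and>
       (\<forall>\<sigma> e. agree \<nu> \<pi> I D' \<sigma> e \<longrightarrow> sat M0 \<sigma> A = (\<exists>y. P (case_nat y e)))" for \<nu> \<pi>
  proof -
    have "finite (\<nu> ` I \<union> \<pi> ` D')" using f by simp
    then obtain z where z: "z \<notin> \<nu> ` I \<union> \<pi> ` D'" using ex_new_if_finite infinite_UNIV_nat by blast
    obtain A where A: "u \<or> delta0 A" "w \<or> arithmetical A"
      "\<And>\<sigma> e. agree (case_nat z \<nu>) \<pi> J' D' \<sigma> e \<Longrightarrow> sat M0 \<sigma> A = P e" by (rule fm_repE[OF P]) blast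
    have ag: "agree (case_nat z \<nu>) \<pi> J' D' (\<sigma>(z := y)) (case_nat y e)"
      if "agree \<nu> \<pi> I D' \<sigma> e" for \<sigma> e y
      using that z by (auto simp: agree_def I_def split: nat.split)
    show ?thesis
    proof (intro exI[of _ "\<^bold>\<exists>z. A"] conjI allI impI)
      fix \<sigma> e assume "agree \<nu> \<pi> I D' \<sigma> e"
      then have "sat M0 (\<sigma>(z := y)) A = P (case_nat y e)" for y using A(3) ag by blast
      then show "sat M0 \<sigma> (\<^bold>\<exists>z. A) = (\<exists>y. P (case_nat y e))" by simp
    qed (use A(2) dfn_ex00(1) in simp_all)
  qed
  then have "fm_rep u w (\<lambda>e. \<exists>y. P (case_nat y e)) I D'" using f by (simp add: fm_rep_def)
  then show ?case by (intro exI)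
qed

text \<open>\<open>Ind False False\<close> is bounded induction, \<open>Ind True False\<close> is
  arithmetical induction, and \<open>Ind False True\<close> is bounded induction with truth.
  Parameters are built into \<open>dfn\<close> as constants.\<close>

definition Ind :: "bool \<Rightarrow> bool \<Rightarrow> bool" where
  "Ind u w \<longleftrightarrow> (\<forall>P. dfn u w (\<lambda>e. P (e 0)) \<longrightarrow> P 0 \<longrightarrow> (\<forall>x. P x \<longrightarrow> P (x + 1)) \<longrightarrow> (\<forall>x. P x))"

lemma Ind_of_axioms:
  assumes "\<And>x A. (u \<or> delta0 A) \<Longrightarrow> (w \<or> arithmetical A) \<Longrightarrow> models M0 {ind_axiom x A}"
  shows "Ind u w"
  unfolding Ind_def
proof (intro allI impI)
  fix P x assume P: "dfn u w (\<lambda>e. P (e 0))" "P 0" "\<forall>x. P x \<longrightarrow> P (x + 1)"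
  obtain I C where r: "fm_rep u w (\<lambda>e. P (e 0)) I C" using dfn_formula[OF P(1)] by (elim exE)
  obtain g :: "el \<Rightarrow> nat" where g: "inj_on g C"
    using r finite_imp_inj_to_nat_seg unfolding fm_rep_def by metis
  \<comment> \<open>Variable \<open>0\<close> is reserved for the induction and parameters get
    positive variables. All indices of the environment may share the name \<open>0\<close>, because
    only constant environments are tested.\<close>
  define \<pi> where "\<pi> c = Suc (g c)" for c
  define \<sigma> where "\<sigma> n = inv_into C \<pi> n" for n
  obtain A where A: "u \<or> delta0 A" "w \<or> arithmetical A"
    "\<And>\<sigma> e. agree (\<lambda>_. 0) \<pi> I C \<sigma> e \<Longrightarrow> sat M0 \<sigma> A = P (e 0)" by (rule fm_repE[OF r]) blast
  have "inj_on \<pi> C" using g by (auto simp: \<pi>_def inj_on_def)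
  then have "agree (\<lambda>_. 0) \<pi> I C (\<sigma>(0 := a)) (\<lambda>_. a)" for a
  proof -
    have "\<pi> c = 0 \<longleftrightarrow> False" for c by (simp add: \<pi>_def)
    then show ?thesis using \<open>inj_on \<pi> C\<close> by (simp add: agree_def \<sigma>_def del: neq0_conv)
  qed
  then have "sat M0 (\<sigma>(0 := a)) A = P a" for a using A(3) by blast
  moreover have "sat M0 \<sigma> (ind_axiom 0 A)" using assms[OF A(1,2)] by (simp add: models_def)
  ultimately show "P x"
    using P(2,3) unfolding sat_ind_axiom by (metis Sc_eq zero_el_def)
qed

lemma Ind_Delta0: "Ind False False"
  by (rule Ind_of_axioms) (use M0_properties(1) in \<open>auto simp: models_def IDelta0_def\<close>)

lemma induct_Delta0:
  "dfn False False (\<lambda>e. P (e 0)) \<Longrightarrow> P 0 \<Longrightarrow> (\<And>x. P x \<Longrightarrow> P (x + 1)) \<Longrightarrow> P x"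
  using Ind_Delta0 unfolding Ind_def by blast

subsection \<open>Ordered semiring structure\<close>

lemma el_add_0_left: "0 + x = (x :: el)"
proof (rule induct_Delta0[where P = "\<lambda>x. 0 + x = x"])
  show "dfn False False (\<lambda>e. 0 + e 0 = e 0)" by (intro dfn.intros trm_intros)
next
  fix x :: el assume "0 + x = x"
  then show "0 + (x + 1) = x + 1" using add_Sc[of 0 x] by (simp add: Sc_eq)
qed (rule add_0)

lemma el_add_1: "x + (y + 1) = x + y + (1 :: el)"
  using add_Sc[of x y] by (simp add: Sc_eq)

lemma el_add_1_left: "x + 1 + y = x + y + (1 :: el)"
proof (rule induct_Delta0[where P = "\<lambda>y. x + 1 + y = x + y + 1"])
  show "dfn False False (\<lambda>e. x + 1 + e 0 = x + e 0 + 1)" by (intro dfn.intros trm_intros)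
qed (simp_all add: add_0 el_add_1)

lemma el_add_comm: "x + y = y + (x :: el)"
proof (rule induct_Delta0[where P = "\<lambda>y. x + y = y + x"])
  show "dfn False False (\<lambda>e. x + e 0 = e 0 + x)" by (intro dfn.intros trm_intros)
qed (simp_all add: add_0 el_add_0_left el_add_1 el_add_1_left)

lemma el_add_assoc: "x + y + z = x + (y + z :: el)"
proof (rule induct_Delta0[where P = "\<lambda>z. x + y + z = x + (y + z)"])
  show "dfn False False (\<lambda>e. x + y + e 0 = x + (y + e 0))" by (intro dfn.intros trm_intros)
qed (simp_all add: add_0 el_add_1)

lemma el_mult_1: "x * (y + 1) = x * y + (x :: el)"
  using mult_Sc[of x y] by (simp add: Sc_eq)

lemma el_mult_1_right: "x * 1 = (x :: el)"
  using el_mult_1[of x 0] by (simp add: mult_0 el_add_0_left)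

lemma el_mult_0_left: "0 * x = (0 :: el)"
proof (rule induct_Delta0[where P = "\<lambda>x. 0 * x = 0"])
  show "dfn False False (\<lambda>e. 0 * e 0 = 0)" by (intro dfn.intros trm_intros)
qed (simp_all add: mult_0 el_mult_1 add_0)

lemma el_mult_1_left: "(x + 1) * y = x * y + (y :: el)"
proof (rule induct_Delta0[where P = "\<lambda>y. (x + 1) * y = x * y + y"])
  show "dfn False False (\<lambda>e. (x + 1) * e 0 = x * e 0 + e 0)" by (intro dfn.intros trm_intros)
next
  fix y :: el assume "(x + 1) * y = x * y + y"
  then show "(x + 1) * (y + 1) = x * (y + 1) + (y + 1)"
    by (simp add: el_mult_1) (metis el_add_assoc el_add_comm)
qed (simp_all add: mult_0 add_0)

lemma el_mult_comm: "x * y = y * (x :: el)"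
proof (rule induct_Delta0[where P = "\<lambda>y. x * y = y * x"])
  show "dfn False False (\<lambda>e. x * e 0 = e 0 * x)" by (intro dfn.intros trm_intros)
qed (simp_all add: mult_0 el_mult_0_left el_mult_1 el_mult_1_left)

lemma el_distrib: "x * (y + z) = x * y + x * (z :: el)"
proof (rule induct_Delta0[where P = "\<lambda>z. x * (y + z) = x * y + x * z"])
  show "dfn False False (\<lambda>e. x * (y + e 0) = x * y + x * e 0)" by (intro dfn.intros trm_intros)
qed (simp_all add: mult_0 add_0 el_mult_1 el_add_assoc[symmetric])

lemma el_mult_assoc: "x * y * z = x * (y * z :: el)"
proof (rule induct_Delta0[where P = "\<lambda>z. x * y * z = x * (y * z)"])
  show "dfn False False (\<lambda>e. x * y * e 0 = x * (y * e 0))" by (intro dfn.intros trm_intros)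
qed (simp_all add: mult_0 el_mult_1_right el_distrib)

lemma el_cases: "x \<noteq> 0 \<Longrightarrow> \<exists>y. x = y + (1 :: el)"
  using Sc_cases by (simp add: Sc_eq)

lemma el_add_1_neq_0: "x + 1 \<noteq> (0 :: el)"
  using Sc_neq_0 by (simp add: Sc_eq)

lemma el_add_1_inj: "x + 1 = y + (1 :: el) \<Longrightarrow> x = y"
  using Sc_inj by (simp add: Sc_eq)

lemma el_add_cancel: "x + z = y + (z :: el) \<Longrightarrow> x = y"
proof -
  have "x + z \<noteq> y + z \<or> x = y"
  proof (rule induct_Delta0[where P = "\<lambda>z. x + z \<noteq> y + z \<or> x = y"])
    show "dfn False False (\<lambda>e. x + e 0 \<noteq> y + e 0 \<or> x = y)" by (intro dfn.intros trm_intros)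
  qed (auto simp: add_0 el_add_1 dest: el_add_1_inj)
  then show "x + z = y + z \<Longrightarrow> x = y" by blast
qed

lemma el_less_iff: "x < y \<longleftrightarrow> (\<exists>z. y = x + (z + 1 :: el))"
  unfolding less_iff Sc_eq by (metis el_add_comm)

lemma el_le_iff: "x \<le> y \<longleftrightarrow> (\<exists>z :: el. y = x + z)"
  unfolding less_eq_el_def el_less_iff using add_0 el_cases by metis

lemma el_trichotomy: "x < y \<or> x = y \<or> y < (x :: el)"
proof (rule induct_Delta0[where P = "\<lambda>x. x < y \<or> x = y \<or> y < x"])
  show "dfn False False (\<lambda>e. e 0 < y \<or> e 0 = y \<or> y < e 0)" by (intro dfn.intros trm_intros)
next
  show "0 < y \<or> 0 = y \<or> y < 0" using el_cases[of y] by (auto simp: el_less_iff el_add_0_left)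
next
  fix x assume "x < y \<or> x = y \<or> y < x"
  then show "x + 1 < y \<or> x + 1 = y \<or> y < x + 1"
  proof (elim disjE)
    assume "x < y"
    then obtain z where z: "y = x + (z + 1)" unfolding el_less_iff by (elim exE)
    show ?thesis
    proof (cases "z = 0")
      case True
      then show ?thesis using z by (simp add: el_add_0_left)
    next
      case False
      obtain v where v: "z = v + 1" using el_cases[OF False] by (elim exE)
      have "y = x + 1 + (v + 1)" unfolding z v by (simp only: el_add_1) (simp only: el_add_1_left[of x v])
      then show ?thesis unfolding el_less_iff by blast
    qed
  next
    assume "x = y"
    then show ?thesis by (metis el_less_iff el_add_0_left)
  next
    assume "y < x"
    then show ?thesis by (metis el_less_iff el_add_assoc)
  qed
qed

lemma el_le_antisym: "x \<le> y \<Longrightarrow> y \<le> x \<Longrightarrow> x = (y :: el)"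
proof -
  assume "x \<le> y" "y \<le> x"
  then obtain u v where uv: "y = x + u" "x = y + v" by (auto simp: el_le_iff)
  then have "0 + x = v + u + x" by (metis el_add_0_left el_add_assoc el_add_comm)
  then have "v + u = 0" using el_add_cancel by metis
  then have "u = 0" using el_cases el_add_1_neq_0 el_add_1 by metis
  then show ?thesis using uv by (simp add: add_0)
qed

lemma el_less_neq: "x < y \<Longrightarrow> x \<noteq> (y :: el)"
  unfolding el_less_iff by (metis el_add_0_left el_add_1_neq_0 el_add_cancel el_add_comm)

lemma el_minus_eq: "x + y - x = (y :: el)"
proof -
  have "x \<le> x + y" by (auto simp: el_le_iff)
  moreover have "(THE z. x + z = x + y) = y"
    by (rule the_equality) (auto intro: el_add_cancel simp: el_add_comm[of x])
  ultimately show ?thesis by (simp add: minus_el_def)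
qed

lemma el_minus_0: "\<not> y \<le> x \<Longrightarrow> x - y = (0 :: el)"
  by (simp add: minus_el_def)

instance el :: discrete_linordered_semidom
proof
  fix a b c :: el
  show "a + b + c = a + (b + c)" by (rule el_add_assoc)
  show "a + b = b + a" by (rule el_add_comm)
  show "0 + a = a" by (rule el_add_0_left)
  show "a + b - a = b" by (rule el_minus_eq)
  show "a * b * c = a * (b * c)" by (rule el_mult_assoc)
  show "a * b = b * a" by (rule el_mult_comm)
  show "(a + b) * c = a * c + b * c" using el_distrib el_mult_comm by metis
  show "a * (b + c) = a * b + a * c" by (rule el_distrib)
  show "0 * a = 0" "a * 0 = 0" by (rule el_mult_0_left mult_0)+
  show m1: "1 * a = a" by (simp add: el_mult_1_right el_mult_comm[of 1])
  show "(0 :: el) \<noteq> 1" using el_add_1_neq_0[of 0] by (simp add: el_add_0_left)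
  show "(0 :: el) < 1" unfolding el_less_iff using el_add_0_left by metis
  have le_refl: "x \<le> x" for x :: el by (simp add: less_eq_el_def)
  show "a \<le> a" by (rule le_refl)
  show le_trans: "a \<le> b \<Longrightarrow> b \<le> c \<Longrightarrow> a \<le> c" unfolding el_le_iff using el_add_assoc by metis
  show "a \<le> b \<Longrightarrow> b \<le> a \<Longrightarrow> a = b" by (rule el_le_antisym)
  show "a < b \<longleftrightarrow> a \<le> b \<and> \<not> b \<le> a"
    using el_le_antisym el_less_neq el_trichotomy unfolding less_eq_el_def by metis
  show "a \<le> b \<or> b \<le> a" using el_trichotomy unfolding less_eq_el_def by blast
  show "a \<le> b \<Longrightarrow> c + a \<le> c + b" unfolding el_le_iff using el_add_assoc by metis
  show "a < b \<Longrightarrow> 0 < c \<Longrightarrow> c * a < c * b"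
  proof -
    assume "a < b" "0 < c"
    then obtain u v where "b = a + (u + 1)" "c = v + 1" by (auto simp: el_less_iff el_add_0_left)
    then have "c * b = c * a + (c * u + v + 1)" by (simp add: el_distrib el_mult_1_right el_add_assoc)
    then show ?thesis by (auto simp: el_less_iff)
  qed
  show "b \<le> a \<Longrightarrow> a - b + b = a" using el_minus_eq el_add_comm unfolding el_le_iff by metis
  show "a < b \<longleftrightarrow> a + 1 \<le> b" unfolding el_less_iff el_le_iff by (metis el_add_assoc el_add_comm)
  have neq0: "x + y = 0 \<Longrightarrow> y = 0" for x y :: el using el_cases el_add_1_neq_0 el_add_1 by metis
  show "a \<noteq> 0 \<Longrightarrow> b \<noteq> 0 \<Longrightarrow> a * b \<noteq> 0" using el_cases el_mult_1 neq0 by metis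
  show "a - b - c = a - (b + c)"
  proof (cases "b \<le> a")
    case True
    then obtain d where d: "a = b + d" by (auto simp: el_le_iff)
    show ?thesis
    proof (cases "c \<le> d")
      case True
      then obtain f where "d = c + f" by (auto simp: el_le_iff)
      then show ?thesis using d by (metis el_minus_eq el_add_assoc)
    next
      case False
      then have "\<not> b + c \<le> a" using d el_add_cancel unfolding el_le_iff by (metis el_add_assoc el_add_comm)
      then show ?thesis using False d by (simp add: el_minus_eq el_minus_0)
    qed
  next
    case False
    moreover have "0 - c = 0" using neq0 el_minus_eq el_minus_0 unfolding el_le_iff by (metis add_0 el_add_comm)
    moreover have "\<not> b + c \<le> a" using False unfolding el_le_iff by (metis el_add_assoc)
    ultimately show ?thesis by (simp add: el_minus_0)
  qed
  show "a * (b - c) = a * b - a * c"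
  proof (cases "c \<le> b")
    case True
    then show ?thesis unfolding el_le_iff using el_minus_eq el_distrib by metis
  next
    case False
    then obtain d where d: "c = b + d" using el_trichotomy unfolding less_eq_el_def el_less_iff by blast
    have "a * b - a * c = 0"
    proof (cases "a * c \<le> a * b")
      case True
      moreover have "a * b \<le> a * c" using d by (auto simp: el_le_iff el_distrib)
      ultimately have "a * b = a * c + 0" using el_le_antisym by (metis add_0)
      then show ?thesis using el_minus_eq by metis
    qed (rule el_minus_0)
    then show ?thesis using False by (simp add: el_minus_0 mult_0)
  qed
qed

subsection \<open>Closure properties of definability\<close>

text \<open>The body takes the bound value as a separate argument; in this shape the rules unify
  with formulae as they are written.\<close>

lemma dfn_bex0:
  assumes "trm t" "dfn u w (\<lambda>e. P (\<lambda>n. e (Suc n)) (e 0))"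
  shows "dfn u w (\<lambda>e. \<exists>y. y < t e \<and> P e y)"
  using dfn_bex00[OF assms] by simp

lemma dfn_ex:
  assumes "u" "dfn u w (\<lambda>e. P (\<lambda>n. e (Suc n)) (e 0))"
  shows "dfn u w (\<lambda>e. \<exists>y. P e y)"
  using dfn_ex00[OF assms] by simp

lemma dfn_all:
  assumes "u" "dfn u w (\<lambda>e. P (\<lambda>n. e (Suc n)) (e 0))"
  shows "dfn u w (\<lambda>e. \<forall>y. P e y)"
  using dfn_not[OF dfn_ex[where P = "\<lambda>e y. \<not> P e y", OF assms(1) dfn_not[OF assms(2)]]] by simp

lemma dfn_conj: "dfn u w P \<Longrightarrow> dfn u w Q \<Longrightarrow> dfn u w (\<lambda>e. P e \<and> Q e)"
  by (rule back_subst[of "dfn u w", OF dfn_not[OF dfn_disj[OF dfn_not dfn_not]]]) auto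

lemma dfn_imp: "dfn u w P \<Longrightarrow> dfn u w Q \<Longrightarrow> dfn u w (\<lambda>e. P e \<longrightarrow> Q e)"
  by (rule back_subst[of "dfn u w", OF dfn_disj[OF dfn_not]]) auto

lemma dfn_iff: "dfn u w P \<Longrightarrow> dfn u w Q \<Longrightarrow> dfn u w (\<lambda>e. P e \<longleftrightarrow> Q e)"
  by (rule back_subst[of "dfn u w", OF dfn_conj[OF dfn_imp[of u w P Q] dfn_imp[of u w Q P]]]) auto

lemma dfn_const: "dfn u w (\<lambda>e. c)"
  using dfn_eq0[OF trm_const trm_const, of u w 0 0] dfn_not[OF dfn_eq0[OF trm_const trm_const, of u w 0 0]]
  by (cases c) simp_all

lemma dfn_mono: "dfn u w P \<Longrightarrow> (u \<Longrightarrow> u') \<Longrightarrow> (w \<Longrightarrow> w') \<Longrightarrow> dfn u' w' P"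
  by (induction rule: dfn.induct) (auto intro: dfn.intros)

lemma trm_subst: "trm t \<Longrightarrow> (\<And>i. trm (g i)) \<Longrightarrow> trm (\<lambda>e. t (\<lambda>i. g i e))"
  by (induction rule: trm.induct) (auto intro: trm.intros)

lemma trm_shift: "trm t \<Longrightarrow> trm (\<lambda>e. t (\<lambda>n. e (Suc n)))"
  by (rule trm_subst[where g = "\<lambda>n e. e (Suc n)"]) (auto intro: trm_intros)

lemma dfn_subst: "dfn u w P \<Longrightarrow> (\<And>i. trm (g i)) \<Longrightarrow> dfn u w (\<lambda>e. P (\<lambda>i. g i e))"
proof (induction arbitrary: g rule: dfn.induct)
  case (dfn_bex00 t P)
  let ?g = "case_nat (\<lambda>e. e 0) (\<lambda>i e. g i (\<lambda>n. e (Suc n)))"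
  have "trm (?g i)" for i by (cases i) (auto intro: trm_intros trm_shift dfn_bex00.prems)
  then have "dfn u w (\<lambda>e. P (\<lambda>i. ?g i e))" by (rule dfn_bex00.IH)
  moreover have "(\<lambda>i. ?g i e) = case_nat (e 0) (\<lambda>i. g i (\<lambda>n. e (Suc n)))" for e
    by (auto split: nat.split)
  ultimately show ?case
    using dfn_bex0[OF trm_subst[OF dfn_bex00(1) dfn_bex00.prems], of u w "\<lambda>e y. P (case_nat y (\<lambda>i. g i e))"]
    by simp
next
  case (dfn_ex00 P)
  let ?g = "case_nat (\<lambda>e. e 0) (\<lambda>i e. g i (\<lambda>n. e (Suc n)))"
  have "trm (?g i)" for i by (cases i) (auto intro: trm_intros trm_shift dfn_ex00.prems)
  then have "dfn u w (\<lambda>e. P (\<lambda>i. ?g i e))" by (rule dfn_ex00.IH)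
  moreover have "(\<lambda>i. ?g i e) = case_nat (e 0) (\<lambda>i. g i (\<lambda>n. e (Suc n)))" for e
    by (auto split: nat.split)
  ultimately show ?case
    using dfn_ex[OF dfn_ex00(1), of w "\<lambda>e y. P (case_nat y (\<lambda>i. g i e))"] by simp
next
  case (dfn_eq0 s t)
  then show ?case
    using dfn.dfn_eq0[OF trm_subst[of s g] trm_subst[of t g]] by simp
next
  case (dfn_less0 s t)
  then show ?case
    using dfn.dfn_less0[OF trm_subst[of s g] trm_subst[of t g]] by simp
next
  case (dfn_TT0 t)
  then show ?case using dfn.dfn_TT0[OF _ trm_subst[of t g]] by simp
qed (auto intro: dfn_not dfn_disj)

lemma dfn_shift: "dfn u w P \<Longrightarrow> dfn u w (\<lambda>e. P (\<lambda>n. e (Suc n)))"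
  by (rule dfn_subst[where g = "\<lambda>n e. e (Suc n)"]) (auto intro: trm_intros)

text \<open>Terms are polynomials without subtraction. Monotonicity turns bounds on the arguments
  into bounds on the values, for instance in \<open>dfun_bounded_on\<close> and
  \<open>truth_eliminated\<close>.\<close>

lemma trm_mono: "trm t \<Longrightarrow> (\<And>i. e i \<le> e' i) \<Longrightarrow> t e \<le> t e'"
proof (induction rule: trm.induct)
  case (trm_times s t)
  have "0 \<le> x" for x :: el by (simp add: el_le_iff)
  then show ?case using trm_times by (intro mult_mono) auto
qed (auto intro: add_mono)

lemma el_nonneg [simp]: "0 \<le> (x :: el)"
  by (simp add: el_le_iff)

lemma el_not_less_0 [simp]: "\<not> x < (0 :: el)"
  by (simp add: not_less)

lemma el_less_1 [simp]: "x < 1 \<longleftrightarrow> x = (0 :: el)"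
  using less_iff_succ_less_eq[of x 1] by (auto simp: add_le_same_cancel2 order_antisym)

lemma less_add_1 [simp]: "x < y + 1 \<longleftrightarrow> x \<le> (y :: el)"
  by (simp add: less_eq_iff_succ_less)

lemma add_1_le: "x + 1 \<le> y \<longleftrightarrow> x < (y :: el)"
  by (simp add: less_iff_succ_less_eq)

text \<open>The bound allows such functions to be used in bounded formulae.\<close>

definition dfun :: "bool \<Rightarrow> bool \<Rightarrow> ((nat \<Rightarrow> el) \<Rightarrow> el) \<Rightarrow> bool" where
  "dfun u w f \<longleftrightarrow> dfn u w (\<lambda>e. e 0 = f (\<lambda>n. e (Suc n))) \<and> (\<exists>t. trm t \<and> (\<forall>e. f e \<le> t e))"

lemma dfunI: "dfn u w (\<lambda>e. e 0 = f (\<lambda>n. e (Suc n))) \<Longrightarrow> trm t \<Longrightarrow> (\<And>e. f e \<le> t e) \<Longrightarrow> dfun u w f"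
  unfolding dfun_def by blast

lemma dfun_trm: "trm f \<Longrightarrow> dfun u w f"
  by (rule dfunI[of _ _ _ f]) (auto intro!: dfn_eq0 trm_var trm_shift)

text \<open>A quantifier over \<open>y\<close> with \<open>y = f e\<close> names the value; the
  strict bound \<open>t e + 1\<close> leaves room for the value \<open>t e\<close> itself.\<close>

lemma dfn_app:
  assumes "dfun u w f" "dfn u w (\<lambda>e. P (\<lambda>n. e (Suc n)) (e 0))"
  shows "dfn u w (\<lambda>e. P e (f e))"
proof -
  obtain t where t: "trm t" "\<And>e. f e \<le> t e" using assms by (auto simp: dfun_def)
  have "dfn u w (\<lambda>e. \<exists>y. y < t e + 1 \<and> (y = f e \<and> P e y))"
    using assms by (intro dfn_bex0 dfn_conj trm_intros t) (auto simp: dfun_def)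
  moreover have "(\<exists>y. y < t e + 1 \<and> (y = f e \<and> P e y)) \<longleftrightarrow> P e (f e)" for e
    using t(2) by auto
  ultimately show ?thesis by simp
qed

lemma dfun_shift: "dfun u w f \<Longrightarrow> dfun u w (\<lambda>e. f (\<lambda>n. e (Suc n)))"
proof -
  assume f: "dfun u w f"
  then obtain t where t: "trm t" "\<And>e. f e \<le> t e" by (auto simp: dfun_def)
  let ?g = "case_nat (\<lambda>e. e 0) (\<lambda>i e. e (Suc (Suc i)))"
  have "trm (?g i)" for i by (cases i) (auto intro: trm_intros)
  then have "dfn u w (\<lambda>e. (\<lambda>i. ?g i e) 0 = f (\<lambda>n. (\<lambda>i. ?g i e) (Suc n)))"
    using f unfolding dfun_def by (intro dfn_subst[of u w "\<lambda>e. e 0 = f (\<lambda>n. e (Suc n))" ?g]) auto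
  then show ?thesis by (intro dfunI[of _ _ _ "\<lambda>e. t (\<lambda>n. e (Suc n))"] trm_shift t) auto
qed

lemma dfun_mono: "dfun u w f \<Longrightarrow> (u \<Longrightarrow> u') \<Longrightarrow> (w \<Longrightarrow> w') \<Longrightarrow> dfun u' w' f"
  unfolding dfun_def using dfn_mono by blast

lemma dfn_comp1: "dfn u w (\<lambda>e. P (e 0)) \<Longrightarrow> dfun u w f \<Longrightarrow> dfn u w (\<lambda>e. P (f e))"
  by (rule dfn_app[of u w f "\<lambda>e. P"])

lemma dfn_comp2:
  assumes "dfn u w (\<lambda>e. P (e 0) (e 1))" "dfun u w f" "dfun u w g"
  shows "dfn u w (\<lambda>e. P (f e) (g e))"
proof (rule dfn_app[OF assms(2)], rule dfn_app[OF dfun_shift[OF assms(3)]])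
  \<comment> \<open>Peeling off \<open>f\<close> and then \<open>g\<close> puts the value of
    \<open>g\<close> at index \<open>0\<close> and that of \<open>f\<close> at index
    \<open>1\<close>, so the two have to be swapped.\<close>
  let ?g = "\<lambda>i. if i = 0 then (\<lambda>e. e 1) else (\<lambda>e. e 0)"
  have "trm (?g i)" for i :: nat by (auto intro: trm_intros)
  from dfn_subst[OF assms(1), of ?g, OF this] show "dfn u w (\<lambda>e. P (e (Suc 0)) (e 0))" by simp
qed

lemma dfun_comp1:
  assumes "dfun u w (\<lambda>e. h (e 0))" "dfun u w f"
  shows "dfun u w (\<lambda>e. h (f e))"
proof -
  obtain s where s: "trm s" "\<And>e. h (e 0) \<le> s e" using assms by (auto simp: dfun_def)
  obtain t where t: "trm t" "\<And>e. f e \<le> t e" using assms by (auto simp: dfun_def)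
  show ?thesis
  proof (rule dfunI)
    let ?g = "\<lambda>i. if i = 0 then (\<lambda>e. e 1) else (\<lambda>e. e 0)"
    have g: "trm (?g i)" for i :: nat by (auto intro: trm_intros)
    have "dfn u w (\<lambda>e. e 0 = h (e 1))" using assms(1) by (simp add: dfun_def)
    from dfn_subst[OF this, of ?g, OF g] show "dfn u w (\<lambda>e. e 0 = h (f (\<lambda>n. e (Suc n))))"
      by (intro dfn_app[OF dfun_shift[OF assms(2)], where P = "\<lambda>e x. e 0 = h x"]) simp
    show "trm (\<lambda>e. s (\<lambda>i. t e))" by (rule trm_subst[OF s(1), of "\<lambda>i. t"]) (rule t)
    show "h (f e) \<le> s (\<lambda>i. t e)" for e
      using s(2)[of "\<lambda>_. f e"] trm_mono[OF s(1), of "\<lambda>_. f e" "\<lambda>_. t e"] t(2) by (blast intro: order_trans)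
  qed
qed

lemma dfun_comp2:
  assumes "dfun u w (\<lambda>e. h (e 0) (e 1))" "dfun u w f" "dfun u w g"
  shows "dfun u w (\<lambda>e. h (f e) (g e))"
proof -
  obtain s where s: "trm s" "\<And>e. h (e 0) (e 1) \<le> s e" using assms by (auto simp: dfun_def)
  obtain t where t: "trm t" "\<And>e. f e \<le> t e" using assms by (auto simp: dfun_def)
  obtain r where r: "trm r" "\<And>e. g e \<le> r e" using assms by (auto simp: dfun_def)
  show ?thesis
  proof (rule dfunI)
    let ?g = "\<lambda>i. if i = 0 then (\<lambda>e. e 2) else if i = 1 then (\<lambda>e. e 1) else (\<lambda>e. e 0)"
    have g: "trm (?g i)" for i :: nat by (auto intro: trm_intros)
    have "dfn u w (\<lambda>e. e 0 = h (e 1) (e 2))" using assms(1) by (simp add: dfun_def numeral_2_eq_2)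
    from dfn_subst[OF this, of ?g, OF g] have "dfn u w (\<lambda>e. e (Suc (Suc 0)) = h (e (Suc 0)) (e 0))"
      by (simp add: numeral_2_eq_2)
    then have "dfn u w (\<lambda>e. e (Suc 0) = h (e 0) (g (\<lambda>n. e (Suc (Suc n)))))"
      by (rule dfn_app[OF dfun_shift[OF dfun_shift[OF assms(3)]], where P = "\<lambda>e x. e (Suc 0) = h (e 0) x"])
    then show "dfn u w (\<lambda>e. e 0 = h (f (\<lambda>n. e (Suc n))) (g (\<lambda>n. e (Suc n))))"
      by (rule dfn_app[OF dfun_shift[OF assms(2)], where P = "\<lambda>e x. e 0 = h x (g (\<lambda>n. e (Suc n)))"])
    show "trm (\<lambda>e. s (\<lambda>i. t e + r e))"
      by (rule trm_subst[OF s(1), of "\<lambda>i e. t e + r e"]) (intro trm_intros t r)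
    show "h (f e) (g e) \<le> s (\<lambda>i. t e + r e)" for e
    proof -
      have "f e \<le> t e + r e" "g e \<le> t e + r e"
        using t(2)[of e] r(2)[of e] by (auto intro: order_trans add_increasing add_increasing2)
      then have "s (\<lambda>i. if i = 0 then f e else g e) \<le> s (\<lambda>i. t e + r e)"
        by (intro trm_mono[OF s(1)]) auto
      then show ?thesis using s(2)[of "\<lambda>i. if i = 0 then f e else g e"] by simp
    qed
  qed
qed

lemma dfun_var: "dfun u w (\<lambda>e. e i)" and dfun_const: "dfun u w (\<lambda>e. c)"
  by (intro dfun_trm trm_intros)+

lemma dfun_plus: "dfun u w f \<Longrightarrow> dfun u w g \<Longrightarrow> dfun u w (\<lambda>e. f e + g e)"
  by (rule dfun_comp2[where h = "(+)"]) (intro dfun_trm trm_intros)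

lemma dfun_times: "dfun u w f \<Longrightarrow> dfun u w g \<Longrightarrow> dfun u w (\<lambda>e. f e * g e)"
  by (rule dfun_comp2[where h = "(*)"]) (intro dfun_trm trm_intros)

lemma dfun_power: "dfun u w f \<Longrightarrow> dfun u w (\<lambda>e. f e ^ n)"
  by (induction n) (auto intro: dfun_const dfun_times)

lemma dfn_eq: "dfun u w f \<Longrightarrow> dfun u w g \<Longrightarrow> dfn u w (\<lambda>e. f e = g e)"
  by (rule dfn_comp2[where P = "(=)"]) (intro dfn_eq0 trm_intros)

lemma dfn_less: "dfun u w f \<Longrightarrow> dfun u w g \<Longrightarrow> dfn u w (\<lambda>e. f e < g e)"
  by (rule dfn_comp2[where P = "(<)"]) (intro dfn_less0 trm_intros)

lemma dfn_le: "dfun u w f \<Longrightarrow> dfun u w g \<Longrightarrow> dfn u w (\<lambda>e. f e \<le> g e)"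
  using dfn_less[OF _ dfun_plus[OF _ dfun_const[of u w 1]], of f g] by simp

lemma dfn_TT: "w \<Longrightarrow> dfun u w f \<Longrightarrow> dfn u w (\<lambda>e. TT (f e))"
  by (rule dfn_comp1[where P = TT]) (intro dfn_TT0 trm_intros)

lemma dfn_bex:
  assumes "dfun u w f" "dfn u w (\<lambda>e. P (\<lambda>n. e (Suc n)) (e 0))"
  shows "dfn u w (\<lambda>e. \<exists>y. y < f e \<and> P e y)"
proof -
  let ?g = "case_nat (\<lambda>e. e 0) (\<lambda>i e. e (Suc (Suc i)))"
  have "trm (?g i)" for i by (cases i) (auto intro: trm_intros)
  then have "dfn u w (\<lambda>e. P (\<lambda>n. ?g (Suc n) e) (?g 0 e))" by (rule dfn_subst[OF assms(2)])
  then have "dfn u w (\<lambda>e. \<exists>y. y < e 0 \<and> P (\<lambda>n. e (Suc n)) y)"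
    by (intro dfn_bex0 trm_intros) simp
  then show ?thesis by (intro dfn_app[OF assms(1), where P = "\<lambda>e x. \<exists>y. y < x \<and> P e y"])
qed

lemma dfn_bex_le:
  assumes "dfun u w f" "dfn u w (\<lambda>e. P (\<lambda>n. e (Suc n)) (e 0))"
  shows "dfn u w (\<lambda>e. \<exists>y. y \<le> f e \<and> P e y)"
  using dfn_bex[OF dfun_plus[OF assms(1) dfun_const[of u w 1]] assms(2)] by simp

lemma dfn_ball:
  assumes "dfun u w f" "dfn u w (\<lambda>e. P (\<lambda>n. e (Suc n)) (e 0))"
  shows "dfn u w (\<lambda>e. \<forall>y. y < f e \<longrightarrow> P e y)"
  using dfn_not[OF dfn_bex[OF assms(1), of "\<lambda>e y. \<not> P e y"]] dfn_not[OF assms(2)] by simp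

lemma dfn_ball_le:
  assumes "dfun u w f" "dfn u w (\<lambda>e. P (\<lambda>n. e (Suc n)) (e 0))"
  shows "dfn u w (\<lambda>e. \<forall>y. y \<le> f e \<longrightarrow> P e y)"
  using dfn_ball[OF dfun_plus[OF assms(1) dfun_const[of u w 1]] assms(2)] by simp

lemma dfun_if:
  assumes "dfn u w P" "dfun u w f" "dfun u w g"
  shows "dfun u w (\<lambda>e. if P e then f e else g e)"
proof -
  obtain t where t: "trm t" "\<And>e. f e \<le> t e" using assms by (auto simp: dfun_def)
  obtain r where r: "trm r" "\<And>e. g e \<le> r e" using assms by (auto simp: dfun_def)
  show ?thesis
  proof (rule dfunI)
    have "dfn u w (\<lambda>e. (P (\<lambda>n. e (Suc n)) \<and> e 0 = f (\<lambda>n. e (Suc n))) \<or>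
        (\<not> P (\<lambda>n. e (Suc n)) \<and> e 0 = g (\<lambda>n. e (Suc n))))"
      using assms by (intro dfn_disj dfn_conj dfn_not dfn_shift) (auto simp: dfun_def)
    then show "dfn u w (\<lambda>e. e 0 = (if P (\<lambda>n. e (Suc n)) then f (\<lambda>n. e (Suc n)) else g (\<lambda>n. e (Suc n))))"
      by (rule back_subst[of "dfn u w"]) auto
    show "(if P e then f e else g e) \<le> t e + r e" for e
      using t(2)[of e] r(2)[of e] by (auto intro: order_trans add_increasing add_increasing2)
  qed (intro trm_intros t r)
qed

lemmas dfn_intros = dfn_eq dfn_less dfn_le dfn_TT dfn_not dfn_conj dfn_disj dfn_imp dfn_iff
  dfn_bex dfn_bex_le dfn_ball dfn_ball_le
lemmas dfun_intros = dfun_plus dfun_times dfun_power dfun_if dfun_var dfun_const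

subsection \<open>Induction and the least number principle\<close>

lemma Ind_induct:
  "Ind u w \<Longrightarrow> dfn u w (\<lambda>e. P (e 0)) \<Longrightarrow> P 0 \<Longrightarrow> (\<And>x. P x \<Longrightarrow> P (x + 1)) \<Longrightarrow> P x"
  unfolding Ind_def by blast

lemma Ind_less_induct:
  assumes "Ind u w" "dfn u w (\<lambda>e. P (e 0))" "\<And>x. (\<And>y. y < x \<Longrightarrow> P y) \<Longrightarrow> P x"
  shows "P x"
proof -
  have "\<forall>y. y < z \<longrightarrow> P y" for z
  proof (rule Ind_induct[OF assms(1), where P = "\<lambda>z. \<forall>y. y < z \<longrightarrow> P y"])
    show "dfn u w (\<lambda>e. \<forall>y. y < e 0 \<longrightarrow> P y)"
      by (intro dfn_intros dfun_intros assms(2))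
    fix x assume IH: "\<forall>y. y < x \<longrightarrow> P y"
    show "\<forall>y. y < x + 1 \<longrightarrow> P y" using IH assms(3) by (auto simp: le_less)
  qed simp
  then show ?thesis using assms(3) by blast
qed

text \<open>Definable predicates are closed under negation, so course-of-values induction can be
  applied to the complement of \<open>P\<close>.\<close>

lemma LNP:
  assumes "Ind u w" "dfn u w (\<lambda>e. P (e 0))" "P x"
  obtains y where "P y" "\<And>z. z < y \<Longrightarrow> \<not> P z"
proof (rule ccontr)
  assume n: "\<not> thesis"
  have "\<not> P x" for x
    by (rule Ind_less_induct[OF assms(1), where P = "\<lambda>x. \<not> P x"])
      (use that n in \<open>auto intro: dfn_not assms(2)\<close>)
  then show False using assms(3) by blast
qed

section \<open>Coding of sequences\<close>

subsection \<open>Cantor pairing\<close>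

lemma el_pos_iff [simp]: "0 < x \<longleftrightarrow> x \<noteq> (0 :: el)"
  using el_nonneg[of x] by (auto simp: less_le)

lemma el_one_le [simp]: "1 \<le> x \<longleftrightarrow> x \<noteq> (0 :: el)"
  using less_iff_succ_less_eq[of 0 x] by simp

lemma el_le_0 [simp]: "x \<le> 0 \<longleftrightarrow> x = (0 :: el)"
  by (auto intro: order_antisym)

lemma le_addI1: "x \<le> y \<Longrightarrow> x \<le> y + (z :: el)" and le_addI2: "x \<le> z \<Longrightarrow> x \<le> y + (z :: el)"
  by (simp_all add: add_increasing add_increasing2)

lemma el_add_eq_0 [simp]: "x + y = 0 \<longleftrightarrow> x = 0 \<and> y = (0 :: el)"
  by (simp add: add_nonneg_eq_0_iff)

lemma el_double_eq: "x + x = y + y \<longleftrightarrow> x = (y :: el)"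
  by (metis add_less_le_mono antisym_conv3 less_imp_le less_irrefl)

text \<open>The witness is the triangular number of \<open>x + y\<close>, plus \<open>x\<close>;
  that \<open>n (n + 1)\<close> is even follows by induction on a bounded formula.\<close>

lemma pair_exists: "\<exists>p. p + p = (x + y) * (x + y + 1) + (x + x :: el)"
proof -
  have "\<exists>p\<le>n * (n + 1). p + p = n * (n + 1)" for n :: el
  proof (rule induct_Delta0[where P = "\<lambda>n. \<exists>p. p \<le> n * (n + 1) \<and> p + p = n * (n + 1)"])
    show "dfn False False (\<lambda>e. \<exists>p. p \<le> e 0 * (e 0 + 1) \<and> p + p = e 0 * (e 0 + 1))"
      by (intro dfn_intros dfun_intros)
    show "\<exists>p. p \<le> 0 * (0 + 1) \<and> p + p = 0 * (0 + 1 :: el)" by (intro exI[of _ 0]) simp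
    fix n :: el assume "\<exists>p. p \<le> n * (n + 1) \<and> p + p = n * (n + 1)"
    then obtain p where p: "p + p = n * (n + 1)" by blast
    have "(p + n + 1) + (p + n + 1) = (p + p) + (n + 1) + (n + 1)" by (simp add: algebra_simps)
    also have "\<dots> = (n + 1) * (n + 1 + 1)" unfolding p by (simp add: algebra_simps)
    finally have eq: "(p + n + 1) + (p + n + 1) = (n + 1) * (n + 1 + 1)" .
    moreover have "p + n + 1 \<le> (n + 1) * (n + 1 + 1)"
      unfolding eq[symmetric] by (rule add_increasing) auto
    ultimately show "\<exists>p. p \<le> (n + 1) * (n + 1 + 1) \<and> p + p = (n + 1) * (n + 1 + 1)" by blast
  qed
  then obtain p where "p + p = (x + y) * (x + y + 1)" by blast
  moreover have "(p + x) + (p + x) = (p + p) + (x + x)" by (simp add: algebra_simps)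
  ultimately have "(p + x) + (p + x) = (x + y) * (x + y + 1) + (x + x)" by simp
  then show ?thesis by blast
qed

definition pair :: "el \<Rightarrow> el \<Rightarrow> el" where
  "pair x y = (THE p. p + p = (x + y) * (x + y + 1) + (x + x))"

lemma pair_eq: "pair x y + pair x y = (x + y) * (x + y + 1) + (x + x)"
proof -
  have "\<exists>!p. p + p = (x + y) * (x + y + 1) + (x + x)"
    using pair_exists[of x y] el_double_eq by metis
  then show ?thesis unfolding pair_def by (rule theI')
qed

lemma pair_iff: "p = pair x y \<longleftrightarrow> p + p = (x + y) * (x + y + 1) + (x + x)"
  using pair_eq el_double_eq by metis

text \<open>Codes are ordered by diagonals first: on diagonal \<open>n\<close> the doubled code is
  at most \<open>n (n + 1) + 2 n\<close>, which falls short of \<open>(n + 1) (n + 2)\<close> by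
  \<open>2\<close>.\<close>

lemma pair_less: "x + y < x' + y' \<Longrightarrow> pair x y < pair x' y'"
proof (rule ccontr)
  assume less: "x + y < x' + y'" and "\<not> pair x y < pair x' y'"
  then have "pair x' y' + pair x' y' \<le> pair x y + pair x y" by (intro add_mono) auto
  moreover have "(x + y) * (x + y + 1) + (x + x) < (x' + y') * (x' + y' + 1) + (x' + x')"
  proof -
    have "(x + y) * (x + y + 1) + (x + x) \<le> (x + y) * (x + y + 1) + ((x + y) + (x + y))"
      by (intro add_mono) auto
    also have "\<dots> < (x + y) * (x + y + 1) + ((x + y) + (x + y)) + 2" by simp
    also have "\<dots> = (x + y + 1) * (x + y + 1 + 1)"
      by (simp add: algebra_simps flip: one_add_one)
    also have "\<dots> \<le> (x' + y') * (x' + y' + 1)" using less by (intro mult_mono) (auto simp: add_1_le)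
    also have "\<dots> \<le> \<dots> + (x' + x')" by simp
    finally show ?thesis .
  qed
  ultimately show False unfolding pair_eq by simp
qed

lemma pair_inject [simp]: "pair x y = pair x' y' \<longleftrightarrow> x = x' \<and> y = y'"
proof
  assume eq: "pair x y = pair x' y'"
  have s: "x + y = x' + y'" using pair_less[of x y x' y'] pair_less[of x' y' x y] eq by force
  moreover have "x + x = x' + x'" using pair_eq[of x y] pair_eq[of x' y'] eq s by simp
  ultimately show "x = x' \<and> y = y'" by (auto simp: el_double_eq)
qed simp

lemma pair_upper: "pair x y \<le> (x + y) * (x + y + 1) + (x + x)"
  unfolding pair_eq[symmetric] by simp

lemma le_pair: "x \<le> pair x y" "y \<le> pair x y"
proof -
  have le_sq: "a \<le> a * a" for a :: el
  proof (cases "a = 0")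
    case False
    then have "1 \<le> a" using el_less_1[of a] by (metis not_less)
    then show ?thesis using mult_mono[of 1 a a a] by simp
  qed simp
  have "y + y \<le> pair x y + pair x y"
  proof -
    have "y + y \<le> y * y + y" using le_sq by simp
    also have "\<dots> \<le> (x + y) * (x + y + 1) + (x + x)"
      by (simp add: algebra_simps add_increasing)
    finally show ?thesis unfolding pair_eq .
  qed
  moreover have "x + x \<le> pair x y + pair x y" unfolding pair_eq by simp
  ultimately show "x \<le> pair x y" "y \<le> pair x y"
    by (meson add_strict_mono not_less)+
qed

text \<open>With a nonzero tag the code strictly exceeds its contents, so immediate subformulae have
  smaller codes; the applications of \<open>ind_set\<close> rest on this.\<close>

lemma less_pair: "0 < x \<Longrightarrow> y < pair x y"
  using pair_less[of 0 y x y] le_pair(2)[of y 0] by simp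

lemma dfun_pair: "dfun u w f \<Longrightarrow> dfun u w g \<Longrightarrow> dfun u w (\<lambda>e. pair (f e) (g e))"
proof (rule dfun_comp2[where h = pair], rule dfunI)
  show "dfn u w (\<lambda>e. e 0 = pair (e (Suc 0)) (e (Suc 1)))"
    unfolding pair_iff by (intro dfn_intros dfun_intros)
  show "trm (\<lambda>e. (e 0 + e 1) * (e 0 + e 1 + 1) + (e 0 + e 0))" by (intro trm_intros)
qed (rule pair_upper)

subsection \<open>Division and congruences\<close>

lemma division: "0 < m \<Longrightarrow> \<exists>q r. a = q * m + r \<and> r < (m :: el)"
proof -
  assume m: "0 < m"
  have "\<exists>q. q \<le> a \<and> (\<exists>r. r < m \<and> a = q * m + r)"
  proof (rule induct_Delta0[where P = "\<lambda>a. \<exists>q. q \<le> a \<and> (\<exists>r. r < m \<and> a = q * m + r)"])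
    show "dfn False False (\<lambda>e. \<exists>q. q \<le> e 0 \<and> (\<exists>r. r < m \<and> e 0 = q * m + r))"
      by (intro dfn_intros dfun_intros)
    show "\<exists>q. q \<le> 0 \<and> (\<exists>r. r < m \<and> 0 = q * m + r)" using m by auto
    fix a assume "\<exists>q. q \<le> a \<and> (\<exists>r. r < m \<and> a = q * m + r)"
    then obtain q r where q: "q \<le> a" "r < m" "a = q * m + r" by blast
    show "\<exists>q. q \<le> a + 1 \<and> (\<exists>r. r < m \<and> a + 1 = q * m + r)"
    proof (cases "r + 1 < m")
      case True
      moreover have "q \<le> a + 1" using q(1) by (rule le_addI1)
      moreover have "a + 1 = q * m + (r + 1)" using q(3) by (simp add: add.assoc)
      ultimately show ?thesis by blast
    next
      case False
      then have "m = r + 1" using q(2) by (metis add_1_le antisym_conv1 not_le)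
      then have "a + 1 = (q + 1) * m + 0" using q(3) by (simp add: algebra_simps)
      then show ?thesis using q(1) m by (metis add_right_mono)
    qed
  qed
  then show ?thesis by blast
qed

lemma division_unique:
  assumes "q * m + r = q' * m + r'" "r < m" "r' < (m :: el)"
  shows "r = r'"
proof -
  have False if "q < q'" "q * m + r = q' * m + r'" "r < m" for q q' r r'
  proof -
    have "(q + 1) * m \<le> q' * m" using that(1) by (intro mult_right_mono) (auto simp: add_1_le)
    then have "q * m + m \<le> q' * m" by (simp add: algebra_simps)
    also have "\<dots> \<le> q' * m + r'" by simp
    also have "\<dots> = q * m + r" using that(2) by simp
    finally show False using that(3) by simp
  qed
  then have "q = q'" using assms by (metis linorder_neqE)
  then show ?thesis using assms(1) by simp
qed

text \<open>The value \<open>a\<close> for modulus \<open>0\<close> keeps \<open>rem_div\<close>,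
  \<open>rem_le\<close> and \<open>cong_rem\<close> free of side conditions.\<close>

definition rem :: "el \<Rightarrow> el \<Rightarrow> el" where
  "rem a m = (if m = 0 then a else THE r. r < m \<and> (\<exists>q. a = q * m + r))"

lemma rem_iff: "0 < m \<Longrightarrow> r = rem a m \<longleftrightarrow> r < m \<and> (\<exists>q. a = q * m + r)"
proof -
  assume m: "0 < m"
  have "\<exists>!r. r < m \<and> (\<exists>q. a = q * m + r)" using division[OF m, of a] division_unique by metis
  from theI'[OF this] this show ?thesis unfolding rem_def using m by auto
qed

lemma rem_less: "0 < m \<Longrightarrow> rem a m < m"
  using rem_iff by blast

lemma rem_div: "\<exists>q. a = q * m + rem a m"
proof (cases "m = 0")
  case True then show ?thesis by (simp add: rem_def)
next
  case False then show ?thesis using rem_iff[of m "rem a m" a] by (simp add: less_le)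
qed

lemma rem_le: "rem a m \<le> a"
  using rem_div[of a m] by (metis add_increasing el_nonneg order_refl)

lemma dfun_rem: "dfun u w f \<Longrightarrow> dfun u w g \<Longrightarrow> dfun u w (\<lambda>e. rem (f e) (g e))"
proof (rule dfun_comp2[where h = rem], rule dfunI)
  have "r = rem a m \<longleftrightarrow> (m = 0 \<and> r = a) \<or> (r < m \<and> (\<exists>q. q \<le> a \<and> a = q * m + r))" for r a m
  proof (cases "m = 0")
    case False
    then have m: "0 < m" by (simp add: less_le)
    have "q \<le> q * m + r" for q
      using m mult_left_mono[of 1 m q] by (intro le_addI1) simp
    then show ?thesis using m rem_iff[OF m, of r a] False by metis
  qed (simp add: rem_def)
  then show "dfn u w (\<lambda>e. e 0 = rem (e (Suc 0)) (e (Suc 1)))"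
    by simp (intro dfn_intros dfun_intros)
  show "trm (\<lambda>e. e 0)" by (intro trm_intros)
qed (rule rem_le)

text \<open>There are no negative numbers, hence multiples of \<open>m\<close> are added on both
  sides.\<close>

definition cong :: "el \<Rightarrow> el \<Rightarrow> el \<Rightarrow> bool" where
  "cong x y m \<longleftrightarrow> (\<exists>u v. x + u * m = y + v * m)"

lemma cong_refl [simp]: "cong x x m"
  unfolding cong_def by blast

lemma cong_sym: "cong x y m \<Longrightarrow> cong y x m"
  unfolding cong_def by metis

lemma congI: "x + u * m = y + v * m \<Longrightarrow> cong x y m"
  unfolding cong_def by (intro exI)

lemma congE:
  assumes "cong x y m"
  obtains u v where "x + u * m = y + v * m"
  using assms unfolding cong_def by (elim exE)

lemma cong_trans [trans]:
  assumes "cong x y m" "cong y z m"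
  shows "cong x z m"
proof -
  obtain u v where 1: "x + u * m = y + v * m" using assms(1) by (rule congE)
  obtain u' v' where 2: "y + u' * m = z + v' * m" using assms(2) by (rule congE)
  have "x + (u + u') * m = (x + u * m) + u' * m" by (simp add: algebra_simps)
  also have "\<dots> = (y + u' * m) + v * m" unfolding 1 by (simp add: algebra_simps)
  also have "\<dots> = z + (v + v') * m" unfolding 2 by (simp add: algebra_simps)
  finally show ?thesis by (rule congI)
qed

lemma cong_add:
  assumes "cong x y m" "cong x' y' m"
  shows "cong (x + x') (y + y') m"
proof -
  obtain u v where 1: "x + u * m = y + v * m" using assms(1) by (rule congE)
  obtain u' v' where 2: "x' + u' * m = y' + v' * m" using assms(2) by (rule congE)
  have "x + x' + (u + u') * m = (x + u * m) + (x' + u' * m)" by (simp add: algebra_simps)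
  also have "\<dots> = y + y' + (v + v') * m" unfolding 1 2 by (simp add: algebra_simps)
  finally show ?thesis by (rule congI)
qed

lemma cong_mult_left:
  assumes "cong x y m"
  shows "cong (z * x) (z * y) m"
proof -
  obtain u v where 1: "x + u * m = y + v * m" using assms(1) by (rule congE)
  have "z * x + (z * u) * m = z * (x + u * m)" by (simp add: algebra_simps)
  also have "\<dots> = z * y + (z * v) * m" unfolding 1 by (simp add: algebra_simps)
  finally show ?thesis by (rule congI)
qed

lemma cong_mult_right: "cong x y m \<Longrightarrow> cong (x * z) (y * z) m"
  using cong_mult_left[of x y m z] by (simp add: mult.commute)

lemma cong_dvd:
  assumes "n dvd m" "cong x y m"
  shows "cong x y n"
proof -
  obtain k where m: "m = n * k" using assms(1) by (rule dvdE)
  obtain u v where "x + u * m = y + v * m" using assms(2) by (rule congE)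
  then have "x + (u * k) * n = y + (v * k) * n" unfolding m by (simp add: algebra_simps)
  then show ?thesis by (rule congI)
qed

lemma cong_multiple [simp]: "cong (x + y * m) x m" "cong (x + m * y) x m" "cong (m * y) 0 m" "cong (y * m) 0 m"
  by (rule congI[where u = 0 and v = y], simp add: mult.commute)+

lemma cong_rem: "cong (rem a m) a m"
proof -
  obtain q where "a = q * m + rem a m" using rem_div by blast
  then have "rem a m + q * m = a + 0 * m" by (simp add: add.commute)
  then show ?thesis by (rule congI)
qed

lemma rem_cong: "0 < m \<Longrightarrow> cong a b m \<Longrightarrow> rem a m = rem b m"
proof -
  assume m: "0 < m" and "cong a b m"
  then have "cong (rem a m) (rem b m) m" using cong_rem cong_sym cong_trans by meson
  then obtain u v where "rem a m + u * m = rem b m + v * m" by (rule congE)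
  then show ?thesis using division_unique[of u m "rem a m" v "rem b m"] rem_less[OF m] by (simp add: add.commute)
qed

lemma rem_small: "a < m \<Longrightarrow> rem a m = a"
proof -
  assume "a < m"
  moreover from this have "0 < m" using el_nonneg le_less_trans by blast
  moreover have "\<exists>q. a = q * m + a" by (rule exI[of _ 0]) simp
  ultimately show ?thesis using rem_iff[of m a a] by simp
qed

lemma rem_eqI: "cong a r m \<Longrightarrow> r < m \<Longrightarrow> rem a m = r"
  by (metis el_nonneg le_less_trans rem_cong rem_small)

lemma el_dvd_iff_cong: "m dvd x \<longleftrightarrow> cong x 0 m"
proof
  assume "cong x 0 m"
  then obtain u v where "x + u * m = 0 + v * m" by (rule congE)
  then have "m dvd x + u * m" by simp
  then show "m dvd x" by simp
qed (auto elim!: dvdE)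

lemma el_dvd_le: "m dvd x \<Longrightarrow> 0 < x \<Longrightarrow> m \<le> (x :: el)"
proof -
  assume "m dvd x" "0 < x"
  then obtain k where k: "x = m * k" "k \<noteq> 0" by (auto simp: dvd_def)
  then show ?thesis using mult_left_mono[of 1 k m] by simp
qed

lemma dfn_dvd: "dfun u w f \<Longrightarrow> dfun u w g \<Longrightarrow> dfn u w (\<lambda>e. f e dvd g e)"
proof (rule dfn_comp2[where P = "(dvd)"])
  have "x dvd y \<longleftrightarrow> (\<exists>k. k \<le> y \<and> y = x * k)" for x y :: el
  proof
    assume "x dvd y"
    then obtain k where k: "y = x * k" by (auto simp: dvd_def)
    show "\<exists>k. k \<le> y \<and> y = x * k"
    proof (cases "y = 0")
      case True then show ?thesis by (intro exI[of _ 0]) auto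
    next
      case False
      then have "k dvd y" "0 < y" using k by (auto simp: less_le)
      then show ?thesis using el_dvd_le k by blast
    qed
  qed auto
  then show "dfn u w (\<lambda>e. e 0 dvd e 1)" by simp (intro dfn_intros dfun_intros)
qed

section \<open>Coprimality, inverses and Euclid's lemma\<close>

definition coprime' :: "el \<Rightarrow> el \<Rightarrow> bool" where
  "coprime' x y \<longleftrightarrow> (\<forall>d. d dvd x \<longrightarrow> d dvd y \<longrightarrow> d = 1)"

text \<open>The least positive \<open>d\<close> congruent to a multiple of \<open>Q\<close> divides
  whatever is congruent to such a multiple, since a nonzero remainder would be a smaller candidate.
  This covers both \<open>m\<close> and \<open>Q\<close>, so \<open>d = 1\<close>.\<close>

lemma bezout:
  assumes co: "coprime' Q m" and m: "0 < m"
  obtains k where "cong (k * Q) 1 m"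
proof -
  \<comment> \<open>\<open>m'\<close> plays the part of \<open>-1\<close> modulo
    \<open>m\<close>.\<close>
  obtain m' where m': "m = m' + 1" using m el_cases[of m] by auto
  \<comment> \<open>Congruence is stated through \<open>rem\<close> and with \<open>k < m\<close>,
    which keeps the formula bounded; \<open>m\<close> itself is a first candidate for
    \<open>d\<close>.\<close>
  let ?J = "\<lambda>d. 0 < d \<and> d \<le> m \<and> (\<exists>k. k < m \<and> rem (k * Q) m = rem d m)"
  have d: "dfn False False (\<lambda>e. ?J (e 0))" by (intro dfn_intros dfun_intros dfun_rem)
  have "cong (0 * Q) m m" by (rule congI[where u = 1 and v = 0]) simp
  then have "rem (0 * Q) m = rem m m" by (rule rem_cong[OF m])
  then have Jm: "?J m" using m by (intro conjI exI[of _ 0]) simp_all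
  obtain d where J: "?J d" and min: "\<And>z. z < d \<Longrightarrow> \<not> ?J z"
    by (rule LNP[where P = ?J, OF Ind_Delta0 d Jm]) blast
  obtain k where "rem (k * Q) m = rem d m" using J by blast
  then have k: "cong (k * Q) d m" using cong_rem cong_sym cong_trans by metis
  have div: "d dvd y" if "cong y (h * Q) m" for y h
  proof -
    obtain q r where y: "y = q * d + r" "r < d" using division J by blast
    have "cong ((h + q * k * m') * Q) r m"
    proof -
      have "cong (h * Q + q * m' * (k * Q)) (y + q * m' * d) m"
        by (intro cong_add cong_mult_left k cong_sym[OF that])
      also have "y + q * m' * d = r + (q * d) * m" unfolding y m' by (simp add: algebra_simps)
      also have "cong (r + (q * d) * m) r m" by simp
      finally show ?thesis by (simp add: algebra_simps)
    qed
    then have "cong (rem (h + q * k * m') m * Q) r m"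
      using cong_mult_right[OF cong_rem] cong_trans by blast
    then have "rem (rem (h + q * k * m') m * Q) m = rem r m" using rem_cong m by blast
    moreover have "rem (h + q * k * m') m < m" by (rule rem_less[OF m])
    moreover have "r \<le> m" using y(2) J by (meson less_imp_le order_trans)
    ultimately have "r = 0" using min[OF y(2)] by (metis el_pos_iff)
    then show ?thesis using y by simp
  qed
  have "d dvd m" by (rule div[of m 0], rule congI[where u = 0 and v = 1]) simp
  moreover have "d dvd Q" by (rule div[of Q 1]) simp
  ultimately have "d = 1" using co by (auto simp: coprime'_def)
  then show ?thesis using k that by blast
qed

text \<open>Euclid's lemma: multiply by the inverse \<open>k\<close> of \<open>Q\<close> modulo
  \<open>m\<close>.\<close>

lemma coprime_dvd_mult: "coprime' Q m \<Longrightarrow> 0 < m \<Longrightarrow> m dvd z * Q \<Longrightarrow> m dvd z"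
proof -
  assume a: "coprime' Q m" "0 < m" "m dvd z * Q"
  obtain k where k: "cong (k * Q) 1 m" using bezout[OF a(1,2)] .
  have "cong z (z * (k * Q)) m" using cong_mult_left[OF cong_sym[OF k], of z] by simp
  also have "z * (k * Q) = k * (z * Q)" by (simp add: algebra_simps)
  also have "cong (k * (z * Q)) (k * 0) m" using a(3) by (intro cong_mult_left) (simp add: el_dvd_iff_cong)
  finally show ?thesis by (simp add: el_dvd_iff_cong)
qed

subsection \<open>Goedel's beta function\<close>

abbreviation modulus :: "el \<Rightarrow> el \<Rightarrow> el" where
  "modulus b i \<equiv> (i + 1) * b + 1"

definition beta :: "el \<Rightarrow> el \<Rightarrow> el \<Rightarrow> el" where
  "beta a b i = rem a (modulus b i)"

lemma modulus_pos [simp]: "0 < modulus b i"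
  by simp

lemma dfun_beta:
  "dfun u w f \<Longrightarrow> dfun u w g \<Longrightarrow> dfun u w h \<Longrightarrow> dfun u w (\<lambda>e. beta (f e) (g e) (h e))"
  unfolding beta_def by (intro dfun_rem dfun_intros)

lemma beta_le: "beta a b i \<le> a"
  unfolding beta_def by (rule rem_le)

text \<open>A factorial without its growth: common multiples are what coding by the beta function
  requires, and they can be had either from exponentiation or from arithmetical induction.\<close>

definition Fac :: bool where
  "Fac \<longleftrightarrow> (\<forall>N::el. \<exists>B>0. \<forall>j. 0 < j \<longrightarrow> j \<le> N \<longrightarrow> j dvd B)"

text \<open>A common divisor \<open>d\<close> divides \<open>(j - i) b\<close> and is coprime to
  \<open>b\<close>, as the moduli are \<open>1\<close> modulo \<open>b\<close>. Hence
  \<open>d\<close> divides \<open>j - i\<close>, which divides \<open>b\<close> by assumption, and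
  so \<open>d\<close> divides \<open>1\<close>.\<close>

lemma moduli_coprime:
  assumes b: "\<And>j. 0 < j \<Longrightarrow> j \<le> L \<Longrightarrow> j dvd b" and i: "i < j" "j \<le> L"
  shows "coprime' (modulus b i) (modulus b j)"
  unfolding coprime'_def
proof (intro allI impI)
  fix d assume d: "d dvd modulus b i" "d dvd modulus b j"
  obtain k where k: "j = i + (k + 1)" using i by (auto simp: el_less_iff)
  have "modulus b j = (k + 1) * b + modulus b i" unfolding k by (simp add: algebra_simps)
  then have "d dvd (k + 1) * b" using d by (metis dvd_add_left_iff)
  moreover have "coprime' b d"
    unfolding coprime'_def
  proof (intro allI impI)
    fix c assume "c dvd b" "c dvd d"
    then have "c dvd (i + 1) * b" "c dvd modulus b i" using d(1) by (auto intro: dvd_trans)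
    then have "c dvd 1" by (metis dvd_add_right_iff)
    then have "c \<le> 1" using el_dvd_le zero_less_one by blast
    moreover have "c \<noteq> 0" using \<open>c dvd 1\<close> by auto
    ultimately show "c = 1" using el_less_1[of c] by (auto simp: le_less)
  qed
  moreover have "0 < d" using d(1) by (metis dvd_0_left_iff less_le el_nonneg modulus_pos less_irrefl)
  ultimately have "d dvd k + 1" by (rule coprime_dvd_mult[rotated 2])
  moreover have "k + 1 dvd b"
  proof (rule b)
    show "k + 1 \<le> L" using i(2) le_addI2[of "k + 1" "k + 1" i] unfolding k by (meson order_refl order_trans)
  qed simp
  ultimately have "d dvd (i + 1) * b" by (auto intro: dvd_trans)
  then have "d dvd 1" using d(1) by (metis dvd_add_right_iff)
  then have "d \<le> 1" using el_dvd_le zero_less_one by blast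
  then show "d = 1" using \<open>0 < d\<close> by (simp add: order_antisym)
qed

lemma coprime'_commute: "coprime' x y \<Longrightarrow> coprime' y x"
  by (auto simp: coprime'_def)

text \<open>Chinese remaindering for one more modulus, with the new code reduced below a
  \<open>P\<close> fixed in advance so that a recursion can be run inside a bound.\<close>

lemma beta_extend:
  assumes b: "\<And>j. 0 < j \<Longrightarrow> j \<le> L \<Longrightarrow> j dvd b"
    and P: "0 < P" "\<And>j. j \<le> L \<Longrightarrow> modulus b j dvd P"
    and i: "i \<le> L" and v: "v \<le> b"
  obtains a' where "a' < P" "\<And>j. j < i \<Longrightarrow> beta a' b j = beta a b j" "beta a' b i = v"
proof -
  \<comment> \<open>The product of the moduli below \<open>i\<close> is not at hand as a function.
    The least positive common multiple replaces it, and its minimality gives coprimality: a common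
    divisor \<open>d\<close> could be divided out of it.\<close>
  let ?Q = "\<lambda>Q. 0 < Q \<and> (\<forall>j. j < i \<longrightarrow> modulus b j dvd Q)"
  have d: "dfn False False (\<lambda>e. ?Q (e 0))" by (intro dfn_intros dfun_intros dfn_dvd)
  have QP: "?Q P" using P i by auto
  obtain Q where Q: "?Q Q" and min: "\<And>z. z < Q \<Longrightarrow> \<not> ?Q z"
    by (rule LNP[where P = ?Q, OF Ind_Delta0 d QP]) blast
  let ?m = "modulus b i"
  have "coprime' Q ?m"
    unfolding coprime'_def
  proof (intro allI impI)
    fix d assume d: "d dvd Q" "d dvd ?m"
    obtain Q' where Q': "Q = d * Q'" using d(1) by (auto simp: dvd_def)
    have pos: "0 < d" "0 < Q'" using Q Q' by auto
    have "modulus b j dvd Q'" if j: "j < i" for j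
    proof (rule coprime_dvd_mult)
      show "coprime' d (modulus b j)"
        using moduli_coprime[OF b j i] d(2) unfolding coprime'_def by (meson dvd_trans)
      show "modulus b j dvd Q' * d" using Q j Q' by (simp add: mult.commute)
    qed simp
    then have "Q \<le> Q'" using min[of Q'] pos by (auto simp: not_less[symmetric])
    then have "d * Q' \<le> 1 * Q'" using Q' by simp
    then have "d \<le> 1" using mult_strict_right_mono[OF _ pos(2), of 1 d] by (meson not_le)
    then show "d = 1" using pos(1) by (simp add: order_antisym)
  qed
  then obtain k where k: "cong (k * Q) 1 ?m" using bezout modulus_pos by metis
  \<comment> \<open>Modulo the earlier moduli \<open>Q\<close> vanishes and \<open>a\<close>
    remains. Modulo \<open>?m\<close> the factor \<open>k * Q\<close> is \<open>1\<close> and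
    \<open>(i + 1) * b\<close> is \<open>-1\<close>, so \<open>a\<close> cancels and
    \<open>v\<close> remains.\<close>
  define a1 where "a1 = a + (v + a * ((i + 1) * b)) * (k * Q)"
  define a' where "a' = rem a1 P"
  have a': "cong a' a1 (modulus b j)" if "j \<le> L" for j
    using cong_dvd[OF P(2)[OF that] cong_rem] by (simp add: a'_def)
  show ?thesis
  proof (rule that[of a'])
    show "a' < P" unfolding a'_def by (rule rem_less[OF P(1)])
  next
    fix j assume j: "j < i"
    have "cong a' a1 (modulus b j)" using j i by (intro a') simp
    also have "cong a1 (a + (v + a * ((i + 1) * b)) * (k * 0)) (modulus b j)"
      unfolding a1_def using Q j by (intro cong_add cong_mult_left) (simp_all add: el_dvd_iff_cong)
    finally show "beta a' b j = beta a b j" unfolding beta_def by (intro rem_cong) auto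
  next
    have "cong a' a1 ?m" by (rule a'[OF i])
    also have "cong a1 (a + (v + a * ((i + 1) * b)) * 1) ?m"
      unfolding a1_def by (intro cong_add cong_mult_left k) simp
    also have "a + (v + a * ((i + 1) * b)) * 1 = v + a * ?m" by (simp add: algebra_simps)
    also have "cong (v + a * ?m) v ?m" by simp
    finally have "cong a' v ?m" .
    moreover have "v < ?m"
    proof -
      have "b \<le> (i + 1) * b" using mult_right_mono[of 1 "i + 1" b] by simp
      then show ?thesis using v by simp
    qed
    ultimately show "beta a' b i = v" unfolding beta_def by (rule rem_eqI)
  qed
qed

lemma dfun_bounded_on: "dfun u w (\<lambda>e. f (e 0)) \<Longrightarrow> \<exists>Y. \<forall>i\<le>n. f i \<le> Y"
proof -
  assume "dfun u w (\<lambda>e. f (e 0))"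
  then obtain t where t: "trm t" "\<And>e. f (e 0) \<le> t e" by (auto simp: dfun_def)
  have "f i \<le> t (\<lambda>_. n)" if "i \<le> n" for i
    using t(2)[of "\<lambda>_. i"] trm_mono[OF t(1), of "\<lambda>_. i" "\<lambda>_. n"] that by (auto intro: order_trans)
  then show ?thesis by blast
qed

text \<open>Recursion with bounded values; the code \<open>a\<close> is found by induction below a fixed multiple of all moduli.\<close>

lemma recursion:
  assumes Fac and I: "Ind u w"
    and F: "dfun u w (\<lambda>e. F (e 0) (e 1))" and W: "dfun u w (\<lambda>e. W (e 0))"
    and z0: "z0 \<le> W 0" and step: "\<And>i z. i < n \<Longrightarrow> z \<le> W i \<Longrightarrow> F i z \<le> W (i + 1)"
  obtains a b where "beta a b 0 = z0" "\<And>i. i < n \<Longrightarrow> beta a b (i + 1) = F i (beta a b i)"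
    "\<And>i. i \<le> n \<Longrightarrow> beta a b i \<le> W i"
proof -
  obtain Y where Y: "\<And>i. i \<le> n \<Longrightarrow> W i \<le> Y" using dfun_bounded_on[OF W] by blast
  \<comment> \<open>The range \<open>n + 1 + Y\<close> serves two ends: all positive
    \<open>j \<le> n\<close> divide \<open>b\<close>, which makes the moduli coprime, and
    \<open>b\<close> is at least \<open>Y\<close>, so every value fits below its modulus.\<close>
  obtain b where b: "0 < b" "\<And>j. 0 < j \<Longrightarrow> j \<le> n + 1 + Y \<Longrightarrow> j dvd b"
    using \<open>Fac\<close> unfolding Fac_def by metis
  have "n + 1 + Y dvd b" by (rule b(2)) auto
  then have Yb: "Y \<le> b" using el_dvd_le[OF _ b(1)] le_addI2[of Y Y "n + 1"] by (meson order_refl order_trans)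
  have b': "j dvd b" if "0 < j" "j \<le> n" for j
    using that by (intro b(2)) (auto intro: le_addI1)
  obtain P where P: "0 < P" "\<And>j. 0 < j \<Longrightarrow> j \<le> modulus b n \<Longrightarrow> j dvd P"
    using \<open>Fac\<close> unfolding Fac_def by metis
  have P': "modulus b j dvd P" if "j \<le> n" for j
    using that by (intro P(2)) (auto intro: mult_right_mono)
  let ?R = "\<lambda>i. i \<le> n \<longrightarrow> (\<exists>a. a < P \<and> beta a b 0 = z0 \<and>
    (\<forall>j. j < i \<longrightarrow> beta a b (j + 1) = F j (beta a b j)) \<and> (\<forall>j. j \<le> i \<longrightarrow> beta a b j \<le> W j))"
  have "?R n"
  proof (rule Ind_induct[OF I, where P = ?R])
    show "dfn u w (\<lambda>e. ?R (e 0))"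
      by (intro dfn_intros dfun_intros dfun_beta dfun_comp1[OF W] dfun_comp2[OF F])
    have "z0 \<le> b" using z0 Y[of 0] Yb by (meson el_nonneg order_trans)
    then obtain a where "a < P" "beta a b 0 = z0"
      using beta_extend[where L = n and b = b and P = P and i = 0 and v = z0 and a = 0] b' P(1) P'
      by (metis el_nonneg)
    then show "?R 0" using z0 by (intro impI exI[of _ a]) simp
  next
    fix i assume IH: "?R i"
    show "?R (i + 1)"
    proof
      assume i: "i + 1 \<le> n"
      then have i': "i < n" "i \<le> n" by (simp_all add: add_1_le)
      then obtain a where a: "beta a b 0 = z0" "\<And>j. j < i \<Longrightarrow> beta a b (j + 1) = F j (beta a b j)"
        "\<And>j. j \<le> i \<Longrightarrow> beta a b j \<le> W j" using IH by blast
      have le: "F i (beta a b i) \<le> W (i + 1)" using step i' a(3) by blast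
      then have "F i (beta a b i) \<le> b" using Y[OF i] Yb by (meson order_trans)
      then obtain a' where a': "a' < P" "\<And>j. j < i + 1 \<Longrightarrow> beta a' b j = beta a b j"
        "beta a' b (i + 1) = F i (beta a b i)"
        using beta_extend[where L = n and b = b and P = P and i = "i + 1" and a = a] b' P(1) P' i
        by metis
      have "beta a' b 0 = z0" using a(1) a'(2)[of 0] by simp
      moreover have "beta a' b (j + 1) = F j (beta a' b j)" if "j < i + 1" for j
      proof (cases "j = i")
        case True then show ?thesis using a'(2,3) by simp
      next
        case False
        then have "j < i" using that by simp
        moreover from this have "j + 1 < i + 1" by (simp add: add_1_le)
        ultimately show ?thesis using a'(2) a(2) that by simp
      qed
      moreover have "beta a' b j \<le> W j" if "j \<le> i + 1" for j
        using that a' a(3) le by (cases "j = i + 1") (auto simp: le_less)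
      ultimately show "\<exists>a. a < P \<and> beta a b 0 = z0 \<and>
        (\<forall>j. j < i + 1 \<longrightarrow> beta a b (j + 1) = F j (beta a b j)) \<and> (\<forall>j. j \<le> i + 1 \<longrightarrow> beta a b j \<le> W j)"
        using a'(1) by blast
    qed
  qed
  then show ?thesis using that by auto
qed

text \<open>A recursion whose step ignores the previous value, with \<open>f\<close> as its own
  bound.\<close>

lemma comprehension:
  assumes Fac and I: "Ind u w" and f: "dfun u w (\<lambda>e. f (e 0))"
  obtains a b where "\<And>i. i \<le> n \<Longrightarrow> beta a b i = f i"
proof -
  obtain a b where ab: "beta a b 0 = f 0" "\<And>i. i < n \<Longrightarrow> beta a b (i + 1) = f (i + 1)"
  proof (rule recursion[OF assms(1,2), of "\<lambda>i z. f (i + 1)" f "f 0" n])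
    show "dfun u w (\<lambda>e. f (e 0 + 1))" by (rule dfun_comp1[OF f]) (intro dfun_intros)
  qed (use f in auto)
  have "beta a b i = f i" if "i \<le> n" for i
  proof (cases "i = 0")
    case False
    then obtain j where "i = j + 1" using el_cases by blast
    then show ?thesis using ab(2)[of j] that by (simp add: add_1_le)
  qed (use ab in simp)
  then show ?thesis using that by blast
qed

section \<open>Inductively defined classes\<close>

type_synonym srules = "(el \<Rightarrow> bool) \<Rightarrow> el \<Rightarrow> bool"

definition derivation :: "srules \<Rightarrow> el \<Rightarrow> el \<Rightarrow> el \<Rightarrow> bool" where
  "derivation R a b l \<longleftrightarrow> (\<forall>i\<le>l. R (\<lambda>z. \<exists>k<i. beta a b k = z) (beta a b i))"

text \<open>Mirrors \<open>IndF\<close>. The code of the derivation is quantified without a bound,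
  so membership is not itself available to bounded induction.\<close>

definition ind :: "srules \<Rightarrow> el \<Rightarrow> bool" where
  "ind R x \<longleftrightarrow> (\<exists>a b l. beta a b l = x \<and> derivation R a b l)"

definition mono_rules :: "srules \<Rightarrow> bool" where
  "mono_rules R \<longleftrightarrow> (\<forall>E E' y. (\<forall>z. E z \<longrightarrow> E' z) \<longrightarrow> R E y \<longrightarrow> R E' y)"

lemma mono_rulesD: "mono_rules R \<Longrightarrow> R E y \<Longrightarrow> (\<And>z. E z \<Longrightarrow> E' z) \<Longrightarrow> R E' y"
  unfolding mono_rules_def by blast

lemma derivation_prefix: "derivation R a b l \<Longrightarrow> k \<le> l \<Longrightarrow> derivation R a b k"
  unfolding derivation_def using order_trans by blast

text \<open>The induction runs over the positions of one fixed derivation, so only \<open>P\<close>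
  has to be definable; the premises reach the step through some \<open>E\<close> contained both in
  \<open>P\<close> and in the class.\<close>

lemma ind_induct [consumes 3]:
  assumes I: "Ind u w" and P: "dfn u w (\<lambda>e. P (e 0))" and x: "ind R x"
    and step: "\<And>y E. (\<And>z. E z \<Longrightarrow> P z) \<Longrightarrow> (\<And>z. E z \<Longrightarrow> ind R z) \<Longrightarrow> R E y \<Longrightarrow> P y"
  shows "P x"
proof -
  obtain a b l where l: "beta a b l = x" "derivation R a b l" using x by (auto simp: ind_def)
  have "i \<le> l \<longrightarrow> P (beta a b i)" for i
  proof (rule Ind_less_induct[OF I, where P = "\<lambda>i. i \<le> l \<longrightarrow> P (beta a b i)"])
    show "dfn u w (\<lambda>e. e 0 \<le> l \<longrightarrow> P (beta a b (e 0)))"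
      by (intro dfn_intros dfn_comp1[OF P] dfun_intros dfun_beta)
    fix i assume IH: "\<And>k. k < i \<Longrightarrow> k \<le> l \<longrightarrow> P (beta a b k)"
    show "i \<le> l \<longrightarrow> P (beta a b i)"
    proof
      assume i: "i \<le> l"
      show "P (beta a b i)"
      proof (rule step)
        show "R (\<lambda>z. \<exists>k<i. beta a b k = z) (beta a b i)"
          using l(2) i by (simp add: derivation_def)
      next
        fix z assume "\<exists>k<i. beta a b k = z"
        then obtain k where k: "k < i" "beta a b k = z" by blast
        then have kl: "k \<le> l" using i by simp
        show "P z" using IH k kl by blast
        show "ind R z" unfolding ind_def using k(2) derivation_prefix[OF l(2) kl] by blast
      qed
    qed
  qed
  then show ?thesis using l(1) by blast
qed

lemma ind_cases:
  assumes m: "mono_rules R" and x: "ind R x"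
  shows "R (ind R) x"
proof -
  obtain a b l where l: "beta a b l = x" "derivation R a b l" using x by (auto simp: ind_def)
  have "R (\<lambda>z. \<exists>k<l. beta a b k = z) x" using l by (auto simp: derivation_def)
  then show ?thesis
  proof (rule mono_rulesD[OF m])
    fix z assume "\<exists>k<l. beta a b k = z"
    then obtain k where k: "k < l" "beta a b k = z" by blast
    then have "derivation R a b k" using derivation_prefix[OF l(2)] by simp
    then show "ind R z" unfolding ind_def using k(2) by blast
  qed
qed

lemma el_eq_0_add [simp]: "0 = x + y \<longleftrightarrow> x = 0 \<and> y = (0 :: el)"
  using el_add_eq_0[of x y] by (auto simp: eq_commute[of 0])

lemma el_leE:
  assumes "x \<le> y"
  obtains z :: el where "y = x + z"
  using assms unfolding el_le_iff by (elim exE)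

lemma el_diff_iff: "v = x - y \<longleftrightarrow> (y \<le> x \<and> x = y + v) \<or> (x < y \<and> v = (0 :: el))"
proof (cases "y \<le> x")
  case True
  then obtain z where "x = y + z" by (rule el_leE)
  then show ?thesis using True by auto
next
  case False
  moreover from this have "x < y" by simp
  ultimately show ?thesis by (simp add: el_minus_0)
qed

lemma el_diff_le: "x - y \<le> (x :: el)"
proof (cases "y \<le> x")
  case True
  then obtain z where "x = y + z" by (rule el_leE)
  then show ?thesis by simp
next
  case False
  then show ?thesis by (simp add: el_minus_0)
qed

locale fac = assumes Fac: Fac
begin

text \<open>Any definable sequence obeying the rules can serve as a derivation; comprehension
  supplies its code.\<close>

lemma ind_seq:
  assumes I: "Ind u w" and s: "dfun u w (\<lambda>e. s (e 0))"
    and step: "\<And>i. i \<le> n \<Longrightarrow> R (\<lambda>z. \<exists>k<i. s k = z) (s i)"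
  shows "ind R (s n)"
proof -
  obtain a b where ab: "\<And>i. i \<le> n \<Longrightarrow> beta a b i = s i" using comprehension[OF Fac I s] by blast
  have "(\<lambda>z. \<exists>k<i. beta a b k = z) = (\<lambda>z. \<exists>k<i. s k = z)" if "i \<le> n" for i
  proof -
    have "beta a b k = s k" if "k < i" for k using ab \<open>i \<le> n\<close> that by simp
    then show ?thesis by (simp cong: conj_cong)
  qed
  then have "derivation R a b n" using step ab by (simp add: derivation_def)
  then show ?thesis unfolding ind_def using ab by blast
qed

lemma ind_seq_le:
  assumes "Ind u w" "dfun u w (\<lambda>e. s (e 0))"
    "\<And>i. i \<le> n \<Longrightarrow> R (\<lambda>z. \<exists>k<i. s k = z) (s i)" "i \<le> n"
  shows "ind R (s i)"
  by (rule ind_seq[where n = i and s = s, OF assms(1,2)]) (use assms(3,4) order_trans in blast)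

lemma ind_intro0: "R (\<lambda>_. False) y \<Longrightarrow> ind R y"
  by (rule ind_seq[OF Ind_Delta0, of "\<lambda>_. y" 0]) (auto intro: dfun_const)

text \<open>A derivation of \<open>y\<close> is obtained by concatenating the derivations of its premises.\<close>

lemma ind_intro2:
  assumes m: "mono_rules R" and p: "ind R p" "ind R q" and y: "R (\<lambda>z. z = p \<or> z = q) y"
  shows "ind R y"
proof -
  obtain a b l where l: "beta a b l = p" "derivation R a b l" using p by (auto simp: ind_def)
  obtain a' b' l' where l': "beta a' b' l' = q" "derivation R a' b' l'" using p by (auto simp: ind_def)
  \<comment> \<open>Positions up to \<open>l\<close> hold the first derivation, the next
    \<open>l' + 1\<close> positions the second, and \<open>y\<close> follows at
    \<open>l + 1 + l' + 1\<close>.\<close>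
  define s where "s i = (if i \<le> l then beta a b i else if i \<le> l + 1 + l' then beta a' b' (i - (l + 1)) else y)" for i
  have s1: "s i = beta a b i" if "i \<le> l" for i using that by (simp add: s_def)
  have s2: "s (l + 1 + i) = beta a' b' i" if "i \<le> l'" for i
  proof -
    have "\<not> l + 1 + i \<le> l" by (simp add: not_le less_iff_succ_less_eq le_addI1)
    then show ?thesis using that by (simp add: s_def add.assoc)
  qed
  have s3: "s (l + 1 + l' + 1) = y"
  proof -
    have "\<not> l + 1 + l' + 1 \<le> l + 1 + l'" by simp
    moreover have "\<not> l + 1 + l' + 1 \<le> l"
      by (simp only: not_le less_iff_succ_less_eq) (simp add: le_addI1)
    ultimately show ?thesis by (simp add: s_def)
  qed
  have d: "dfun False False (\<lambda>e. s (e 0))"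
  proof -
    have "dfun False False (\<lambda>e. e 0 - (l + 1))"
    proof (rule dfunI)
      show "dfn False False (\<lambda>e. e 0 = e (Suc 0) - (l + 1))"
        unfolding el_diff_iff by (intro dfn_intros dfun_intros)
      show "e 0 - (l + 1) \<le> e 0" for e :: "nat \<Rightarrow> el" by (rule el_diff_le)
    qed (intro trm_intros)
    then show ?thesis unfolding s_def by (intro dfun_if dfn_intros dfun_intros dfun_beta)
  qed
  have "ind R (s (l + 1 + l' + 1))"
  proof (rule ind_seq[OF Ind_Delta0 d])
    fix i assume i: "i \<le> l + 1 + l' + 1"
    consider "i \<le> l" | j where "j \<le> l'" "i = l + 1 + j" | "i = l + 1 + l' + 1"
    proof -
      consider "i \<le> l" | "l + 1 \<le> i" "i \<le> l + 1 + l'" | "l + 1 + l' + 1 \<le> i"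
        by (metis add_1_le not_le)
      then show thesis
      proof cases
        case 2
        then obtain j where "i = l + 1 + j" unfolding el_le_iff by blast
        then show thesis using 2 that(2) by simp
      qed (use i that in \<open>auto intro: order_antisym\<close>)
    qed
    then show "R (\<lambda>z. \<exists>k<i. s k = z) (s i)"
    proof cases
      case 1
      then have "R (\<lambda>z. \<exists>k<i. beta a b k = z) (s i)" using l(2) s1 by (simp add: derivation_def)
      then show ?thesis
      proof (rule mono_rulesD[OF m])
        fix z assume "\<exists>k<i. beta a b k = z"
        then show "\<exists>k<i. s k = z" using s1 1 by (meson less_imp_le less_le_trans)
      qed
    next
      case 2
      then have "R (\<lambda>z. \<exists>k<j. beta a' b' k = z) (s i)" using l'(2) s2 by (simp add: derivation_def)
      then show ?thesis
      proof (rule mono_rulesD[OF m])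
        fix z assume "\<exists>k<j. beta a' b' k = z"
        then obtain k where k: "k < j" "beta a' b' k = z" by blast
        then have "s (l + 1 + k) = z" "l + 1 + k < i" using s2[of k] 2 by auto
        then show "\<exists>k<i. s k = z" by blast
      qed
    next
      case 3
      have "l < i" unfolding 3 by (simp only: less_iff_succ_less_eq) (simp add: le_addI1 add.assoc)
      moreover have "l + 1 + l' < i" unfolding 3 by simp
      moreover have "s l = p" "s (l + 1 + l') = q" using s1 s2 l l' by auto
      ultimately have "\<exists>k<i. s k = p" "\<exists>k<i. s k = q" by blast+
      then show ?thesis using y s3 3 by (auto intro: mono_rulesD[OF m])
    qed
  qed
  then show ?thesis using s3 by simp
qed

lemma ind_intro1:
  "mono_rules R \<Longrightarrow> ind R p \<Longrightarrow> R (\<lambda>z. z = p) y \<Longrightarrow> ind R y"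
  using ind_intro2[of R p p y] by simp

text \<open>
  If every element of \<open>X\<close> is derivable from smaller elements of \<open>X\<close>, then listing \<open>X\<close> in
  increasing order is a derivation; numbers outside \<open>X\<close> are replaced by the least element.
\<close>

lemma ind_set:
  assumes m: "mono_rules R" and I: "Ind u w" and X: "dfn u w (\<lambda>e. X (e 0))" and x: "X x"
    and step: "\<And>y. X y \<Longrightarrow> y \<le> x \<Longrightarrow> R (\<lambda>z. X z \<and> z < y) y"
  shows "ind R x"
proof -
  obtain x0 where x0: "X x0" "\<And>z. z < x0 \<Longrightarrow> \<not> X z" using LNP[where P = X, OF I X x] by blast
  then have le: "x0 \<le> x" using x by (meson not_le)
  have "ind R ((\<lambda>i. if X i then i else x0) x)"
  proof (rule ind_seq[where s = "\<lambda>i. if X i then i else x0" and n = x, OF I])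
    show "dfun u w (\<lambda>e. if X (e 0) then e 0 else x0)" by (intro dfun_intros X)
    fix i assume i: "i \<le> x"
    show "R (\<lambda>z. \<exists>k<i. (if X k then k else x0) = z) (if X i then i else x0)"
    proof (cases "X i")
      case True
      then have "R (\<lambda>z. X z \<and> z < i) i" using step i by blast
      then show ?thesis using True by (auto elim!: mono_rulesD[OF m])
    next
      case False
      have "R (\<lambda>z. X z \<and> z < x0) x0" using step x0(1) le by blast
      then show ?thesis using False x0(2) by (auto elim!: mono_rulesD[OF m])
    qed
  qed
  then show ?thesis using x by simp
qed

end

subsection \<open>Exponentiation\<close>

definition pow2_rules :: srules where
  "pow2_rules E y \<longleftrightarrow> y = pair 0 1 \<or> (\<exists>x p. y = pair (x + 1) (p + p) \<and> E (pair x p))"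

definition Exp :: bool where
  "Exp \<longleftrightarrow> (\<forall>x. \<exists>p. ind pow2_rules (pair x p))"

text \<open>One derivation for \<open>K\<close> contains the powers for all
  \<open>x \<le> K\<close>. Its code is a parameter that bounds them, so this initial part of
  exponentiation has a bounded graph although no term bounds exponentiation.\<close>

lemma exponential:
  assumes Exp
  obtains ex where "dfun False False (\<lambda>e. ex (e 0))" "ex 0 = 1"
    "\<And>x. x < K \<Longrightarrow> ex (x + 1) = ex x + ex x"
proof -
  obtain a b l p where l: "beta a b l = pair K p" "derivation pow2_rules a b l"
    using assms unfolding Exp_def ind_def by blast
  define E where "E x q \<longleftrightarrow> (\<exists>k. k \<le> l \<and> beta a b k = pair x q)" for x q
  have dE: "dfun u w f \<Longrightarrow> dfun u w g \<Longrightarrow> dfn u w (\<lambda>e. E (f e) (g e))" for u w f g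
    unfolding E_def by (intro dfn_intros dfun_beta dfun_pair dfun_intros dfun_shift)
  have le: "q \<le> a" if h: "E x q" for x q
  proof -
    obtain k where "k \<le> l" "beta a b k = pair x q" using h unfolding E_def by (elim exE conjE)
    then have "pair x q \<le> a" using beta_le[of a b k] by simp
    then show ?thesis using le_pair(2)[of q x] by simp
  qed
  have E: "x = 0 \<and> q = 1 \<or> (\<exists>x' q'. x = x' + 1 \<and> q = q' + q' \<and> E x' q')" if h: "E x q" for x q
  proof -
    obtain k where k: "k \<le> l" "beta a b k = pair x q" using h unfolding E_def by (elim exE conjE)
    then have "pow2_rules (\<lambda>z. \<exists>k'<k. beta a b k' = z) (pair x q)" using l(2) unfolding derivation_def by metis
    then show ?thesis unfolding pow2_rules_def E_def using k(1) by (auto intro: order_trans less_imp_le)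
  qed
  have E_0: "q = 1" if "E 0 q" for q using E[OF that] by auto
  have E_Suc: "\<exists>q'. q = q' + q' \<and> E x q'" if "E (x + 1) q" for x q using E[OF that] by auto
  have uniq: "q = q'" if "E x q" "E x q'" for x q q'
  proof -
    have "\<forall>q. q \<le> a \<longrightarrow> (\<forall>q'. q' \<le> a \<longrightarrow> E x q \<longrightarrow> E x q' \<longrightarrow> q = q')"
    proof (rule induct_Delta0[where P = "\<lambda>x. \<forall>q. q \<le> a \<longrightarrow> (\<forall>q'. q' \<le> a \<longrightarrow> E x q \<longrightarrow> E x q' \<longrightarrow> q = q')"])
      show "dfn False False (\<lambda>e. \<forall>q. q \<le> a \<longrightarrow> (\<forall>q'. q' \<le> a \<longrightarrow> E (e 0) q \<longrightarrow> E (e 0) q' \<longrightarrow> q = q'))"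
        by (intro dfn_intros dE dfun_intros)
      show "\<forall>q. q \<le> a \<longrightarrow> (\<forall>q'. q' \<le> a \<longrightarrow> E 0 q \<longrightarrow> E 0 q' \<longrightarrow> q = q')"
      proof (intro allI impI)
        fix q q' assume "E 0 q" "E 0 q'"
        then show "q = q'" using E_0[of q] E_0[of q'] by simp
      qed
      fix x assume IH: "\<forall>q. q \<le> a \<longrightarrow> (\<forall>q'. q' \<le> a \<longrightarrow> E x q \<longrightarrow> E x q' \<longrightarrow> q = q')"
      have "q = q'" if h: "E (x + 1) q" "E (x + 1) q'" for q q'
      proof -
        obtain p p' where p: "q = p + p" "E x p" "q' = p' + p'" "E x p'"
          using E_Suc[OF h(1)] E_Suc[OF h(2)] by (elim exE conjE)
        then have "p \<le> a" "p' \<le> a" using le by auto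
        then have "p = p'" using IH p(2,4) by blast
        then show ?thesis using p by simp
      qed
      then show "\<forall>q. q \<le> a \<longrightarrow> (\<forall>q'. q' \<le> a \<longrightarrow> E (x + 1) q \<longrightarrow> E (x + 1) q' \<longrightarrow> q = q')" by blast
    qed
    then show ?thesis using that le by blast
  qed
  have exists: "\<exists>q. E x q" if "x \<le> K" for x
  proof -
    \<comment> \<open>Downward induction from \<open>K\<close>: \<open>y\<close> is the distance of
      \<open>x\<close> from \<open>K\<close>, and the rules lead from \<open>x + 1\<close> back to
      \<open>x\<close>.\<close>
    have "\<forall>x. x \<le> K \<longrightarrow> x + y = K \<longrightarrow> (\<exists>q. q \<le> a \<and> E x q)" for y
    proof (rule induct_Delta0[where P = "\<lambda>y. \<forall>x. x \<le> K \<longrightarrow> x + y = K \<longrightarrow> (\<exists>q. q \<le> a \<and> E x q)"])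
      show "dfn False False (\<lambda>e. \<forall>x. x \<le> K \<longrightarrow> x + e 0 = K \<longrightarrow> (\<exists>q. q \<le> a \<and> E x q))"
        by (intro dfn_intros dE dfun_intros)
      have "E K p" unfolding E_def using l(1) by blast
      then show "\<forall>x. x \<le> K \<longrightarrow> x + 0 = K \<longrightarrow> (\<exists>q. q \<le> a \<and> E x q)" using le by auto
      fix y assume IH: "\<forall>x. x \<le> K \<longrightarrow> x + y = K \<longrightarrow> (\<exists>q. q \<le> a \<and> E x q)"
      show "\<forall>x. x \<le> K \<longrightarrow> x + (y + 1) = K \<longrightarrow> (\<exists>q. q \<le> a \<and> E x q)"
      proof (intro allI impI)
        fix x assume x: "x + (y + 1) = K"
        then have "x + 1 + y = K" by (simp add: ac_simps)
        moreover from this have "x + 1 \<le> K" unfolding el_le_iff by blast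
        ultimately obtain q where "E (x + 1) q" using IH by blast
        then obtain q' where "E x q'" using E_Suc by blast
        then show "\<exists>q. q \<le> a \<and> E x q" using le by blast
      qed
    qed
    moreover obtain y where "K = x + y" using \<open>x \<le> K\<close> by (rule el_leE)
    ultimately show ?thesis using \<open>x \<le> K\<close> by blast
  qed
  \<comment> \<open>Arguments without an entry in the derivation get the value \<open>0\<close>, so
    \<open>a\<close> bounds the function everywhere.\<close>
  define ex where "ex x = (if \<exists>q. E x q then THE q. E x q else 0)" for x
  have ex: "ex x = q" if "E x q" for x q
    using that uniq by (auto simp: ex_def intro!: the_equality)
  show ?thesis
  proof (rule that[of ex])
    have ex0: "ex x = 0" if "\<nexists>q. E x q" for x using that by (simp add: ex_def)
    have graph: "v = ex x \<longleftrightarrow> (v \<le> a \<and> E x v) \<or> (v = 0 \<and> \<not> (\<exists>q. q \<le> a \<and> E x q))" for v x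
    proof (cases "\<exists>q. E x q")
      case True
      then obtain q where q: "E x q" by (elim exE)
      then have "q \<le> a" using le by blast
      moreover have "v = q \<longleftrightarrow> E x v" using q uniq by blast
      ultimately show ?thesis unfolding ex[OF q] using q by blast
    next
      case False
      then show ?thesis unfolding ex0[OF False] by blast
    qed
    have "dfn False False (\<lambda>e. (e 0 \<le> a \<and> E (e (Suc 0)) (e 0)) \<or> (e 0 = 0 \<and> \<not> (\<exists>q. q \<le> a \<and> E (e (Suc 0)) q)))"
      by (intro dfn_intros dE dfun_intros)
    then have "dfn False False (\<lambda>e. e 0 = ex (e (Suc 0)))" by (simp only: graph)
    moreover have "ex x \<le> a" for x using graph[of "ex x" x] by auto
    ultimately show "dfun False False (\<lambda>e. ex (e 0))" by (intro dfunI[of _ _ _ "\<lambda>e. a"] trm_intros)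
    show "ex 0 = 1" using exists[of 0] E_0 ex[of 0] by auto
    fix x assume x: "x < K"
    then have "x + 1 \<le> K" by (simp add: add_1_le)
    then obtain q where q: "E (x + 1) q" using exists by blast
    then obtain q' where "q = q' + q'" "E x q'" using E_Suc[OF q] by (elim exE conjE)
    then show "ex (x + 1) = ex x + ex x" using ex q by simp
  qed
qed

definition exp_upto :: "el \<Rightarrow> (el \<Rightarrow> el) \<Rightarrow> bool" where
  "exp_upto K f \<longleftrightarrow> dfun False False (\<lambda>e. f (e 0)) \<and> f 0 = 1 \<and>
    (\<forall>x<K. f (x + 1) = f x + f x) \<and> (\<forall>x y. x + y \<le> K \<longrightarrow> f (x + y) = f x * f y) \<and>
    (\<forall>x\<le>K. x < f x) \<and> (\<forall>x y. x \<le> y \<longrightarrow> y \<le> K \<longrightarrow> f x \<le> f y)"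

lemma exp_uptoD:
  assumes "exp_upto K f"
  shows "dfun False False (\<lambda>e. f (e 0))" "f 0 = 1" "\<And>x. x < K \<Longrightarrow> f (x + 1) = f x + f x"
    "\<And>x y. x + y \<le> K \<Longrightarrow> f (x + y) = f x * f y" "\<And>x. x \<le> K \<Longrightarrow> x < f x"
    "\<And>x y. x \<le> y \<Longrightarrow> y \<le> K \<Longrightarrow> f x \<le> f y"
  using assms unfolding exp_upto_def by blast+

lemma exponential':
  assumes Exp
  shows "\<exists>f. exp_upto K f"
proof -
  obtain ex where ex: "dfun False False (\<lambda>e. ex (e 0))" "ex 0 = 1"
    "\<And>x. x < K \<Longrightarrow> ex (x + 1) = ex x + ex x" using exponential[OF assms] by blast
  have le: "x \<le> K \<longrightarrow> x < ex x" for x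
  proof (rule induct_Delta0[where P = "\<lambda>x. x \<le> K \<longrightarrow> x < ex x"])
    show "dfn False False (\<lambda>e. e 0 \<le> K \<longrightarrow> e 0 < ex (e 0))" by (intro dfn_intros ex dfun_intros)
    fix x assume IH: "x \<le> K \<longrightarrow> x < ex x"
    show "x + 1 \<le> K \<longrightarrow> x + 1 < ex (x + 1)"
    proof
      assume x: "x + 1 \<le> K"
      then have "x < K" by (simp add: add_1_le)
      then have "x < ex x" using IH by simp
      then have "x + 1 \<le> ex x" by (simp add: add_1_le)
      moreover have "0 < ex x" using \<open>x < ex x\<close> el_nonneg le_less_trans by blast
      ultimately have "x + 1 + 0 < ex x + ex x" by (rule add_le_less_mono)
      then show "x + 1 < ex (x + 1)" using ex(3) \<open>x < K\<close> by simp
    qed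
  qed (use ex in simp)
  have mult: "x + y \<le> K \<longrightarrow> ex (x + y) = ex x * ex y" for x y
  proof (rule induct_Delta0[where P = "\<lambda>y. x + y \<le> K \<longrightarrow> ex (x + y) = ex x * ex y"])
    show "dfn False False (\<lambda>e. x + e 0 \<le> K \<longrightarrow> ex (x + e 0) = ex x * ex (e 0))"
      by (intro dfn_intros dfun_intros dfun_comp1[OF ex(1)])
    fix y assume IH: "x + y \<le> K \<longrightarrow> ex (x + y) = ex x * ex y"
    show "x + (y + 1) \<le> K \<longrightarrow> ex (x + (y + 1)) = ex x * ex (y + 1)"
    proof
      assume "x + (y + 1) \<le> K"
      then have xy: "x + y < K" by (simp add: add.assoc[symmetric] add_1_le)
      then have "y < K" using le_less_trans[OF le_addI2[of y y x]] by simp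
      then show "ex (x + (y + 1)) = ex x * ex (y + 1)"
        using ex(3)[OF xy] ex(3)[of y] IH xy by (simp add: add.assoc[symmetric] distrib_left)
    qed
  qed (use ex in simp)
  have mono: "ex x \<le> ex y" if "x \<le> y" "y \<le> K" for x y
  proof -
    obtain z where z: "y = x + z" using \<open>x \<le> y\<close> by (rule el_leE)
    then have "z \<le> K" using that(2) order_trans[OF le_addI2[of z z x]] by simp
    then have "1 \<le> ex z" using le[of z] el_not_less_0[of z] by (metis el_one_le)
    then show ?thesis using mult[of x z] that z mult_left_mono[of 1 "ex z" "ex x"] by simp
  qed
  have "exp_upto K ex" unfolding exp_upto_def using ex le mult mono by blast
  then show ?thesis by blast
qed

text \<open>A product of \<open>n\<close> factors, each at most \<open>2^N\<close>, is at most
  \<open>2^(N n)\<close>; this makes the usual construction of a factorial a bounded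
  induction.\<close>

lemma Fac_of_Exp:
  assumes Exp
  shows Fac
  unfolding Fac_def
proof
  fix N :: el
  obtain ex where "exp_upto (N * N) ex" using exponential'[OF assms, of "N * N"] by (elim exE)
  note ex = exp_uptoD[OF this]
  have "n \<le> N \<longrightarrow> (\<exists>B. B \<le> ex (N * n) \<and> 0 < B \<and> (\<forall>j. j \<le> n \<longrightarrow> 0 < j \<longrightarrow> j dvd B))" for n
  proof (rule induct_Delta0[where P = "\<lambda>n. n \<le> N \<longrightarrow>
      (\<exists>B. B \<le> ex (N * n) \<and> 0 < B \<and> (\<forall>j. j \<le> n \<longrightarrow> 0 < j \<longrightarrow> j dvd B))"])
    show "dfn False False (\<lambda>e. e 0 \<le> N \<longrightarrow>
      (\<exists>B. B \<le> ex (N * e 0) \<and> 0 < B \<and> (\<forall>j. j \<le> e 0 \<longrightarrow> 0 < j \<longrightarrow> j dvd B)))"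
      by (intro dfn_intros dfun_intros dfn_dvd dfun_comp1[OF ex(1)])
    show "0 \<le> N \<longrightarrow> (\<exists>B. B \<le> ex (N * 0) \<and> 0 < B \<and> (\<forall>j. j \<le> 0 \<longrightarrow> 0 < j \<longrightarrow> j dvd B))"
      using ex(2) by (intro impI exI[of _ 1]) simp
    fix n assume IH: "n \<le> N \<longrightarrow> (\<exists>B. B \<le> ex (N * n) \<and> 0 < B \<and> (\<forall>j. j \<le> n \<longrightarrow> 0 < j \<longrightarrow> j dvd B))"
    show "n + 1 \<le> N \<longrightarrow> (\<exists>B. B \<le> ex (N * (n + 1)) \<and> 0 < B \<and> (\<forall>j. j \<le> n + 1 \<longrightarrow> 0 < j \<longrightarrow> j dvd B))"
    proof
      assume n: "n + 1 \<le> N"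
      then have "n < N" by (simp add: add_1_le)
      then obtain B where B: "B \<le> ex (N * n)" "0 < B" "\<forall>j. j \<le> n \<longrightarrow> 0 < j \<longrightarrow> j dvd B"
        using IH by auto
      have "N * (n + 1) \<le> N * N" using n by (intro mult_left_mono) auto
      then have "ex (N * (n + 1)) = ex (N * n) * ex N" using ex(4)[of "N * n" N] by (simp add: distrib_left)
      moreover have "n + 1 \<le> ex N"
      proof -
        have "N \<noteq> 0" using \<open>n < N\<close> by auto
        then have "N \<le> N * N" using mult_left_mono[of 1 N N] by simp
        then show ?thesis using ex(5)[of N] n by simp
      qed
      ultimately have "B * (n + 1) \<le> ex (N * (n + 1))" using B(1) by (simp add: mult_mono)
      moreover have "j dvd B * (n + 1)" if "j \<le> n + 1" "0 < j" for j
      proof (cases "j = n + 1")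
        case True
        then show ?thesis by simp
      next
        case False
        then have "j \<le> n" using that(1) by (simp add: le_less)
        then show ?thesis using B(3) that(2) by (blast intro: dvd_mult2)
      qed
      moreover have "0 < B * (n + 1)" using B(2) by simp
      ultimately show "\<exists>B. B \<le> ex (N * (n + 1)) \<and> 0 < B \<and> (\<forall>j. j \<le> n + 1 \<longrightarrow> 0 < j \<longrightarrow> j dvd B)" by blast
    qed
  qed
  then show "\<exists>B>0. \<forall>j. 0 < j \<longrightarrow> j \<le> N \<longrightarrow> j dvd B" by blast
qed

text \<open>Iterated exponentiation yields bounds for recursions with polynomial growth.\<close>

definition bound_seq :: "el \<Rightarrow> el \<Rightarrow> nat \<Rightarrow> (el \<Rightarrow> el) \<Rightarrow> bool" where
  "bound_seq n q k W \<longleftrightarrow> dfun False False (\<lambda>e. W (e 0)) \<and> (\<forall>i\<le>n. q \<le> W i) \<and>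
    (\<forall>i<n. W (i + 1) = W i ^ (2 ^ k))"

text \<open>\<open>W i\<close> is \<open>2^(2^(q + k i))\<close>. Adding \<open>1\<close> to the
  inner exponent squares the value, so \<open>k\<close> such steps raise it to the power
  \<open>2^k\<close>; the summand \<open>q\<close> gives the lower bound.\<close>

lemma growth:
  assumes Exp
  shows "\<exists>W. bound_seq n q k W"
proof -
  define K where "K = q + of_nat k * n"
  obtain f where "exp_upto K f" using exponential'[OF assms, of K] by (elim exE)
  note f = exp_uptoD[OF this]
  obtain g where "exp_upto (f K) g" using exponential'[OF assms, of "f K"] by (elim exE)
  note g = exp_uptoD[OF this]
  define v where "v j = g (f (q + j))" for j
  have v: "v (j + 1) = v j ^ 2" if "q + j < K" for j
  proof -
    have "f (q + j + 1) = f (q + j) + f (q + j)" "f (q + j + 1) \<le> f K"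
      using f(3)[OF that] f(6)[of "q + j + 1" K] that by (auto simp: add_1_le)
    then show ?thesis using g(4)[of "f (q + j)" "f (q + j)"] by (simp add: v_def power2_eq_square add.assoc)
  qed
  have vk: "v (j + of_nat m) = v j ^ (2 ^ m)" if "q + (j + of_nat m) \<le> K" for j m
    using that
  proof (induction m)
    case (Suc m)
    then have "q + (j + of_nat m) < K" by (simp add: less_iff_succ_less_eq ac_simps)
    then have "v (j + of_nat m + 1) = v (j + of_nat m) ^ 2" "v (j + of_nat m) = v j ^ (2 ^ m)"
      using v[of "j + of_nat m"] Suc.IH by simp_all
    then have "v (j + of_nat m + 1) = v j ^ (2 ^ m * 2)" by (simp add: power_mult)
    then show ?case by (simp add: ac_simps)
  qed simp
  have vq: "q \<le> v j" if "q + j \<le> K" for j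
  proof -
    have "q \<le> q + j" by simp
    also have "\<dots> < f (q + j)" using f(5) that by blast
    also have "\<dots> < g (f (q + j))" using f(6)[OF that order_refl] g(5) by blast
    finally show ?thesis by (simp add: v_def)
  qed
  define W where "W i = v (of_nat k * i)" for i
  have K: "q + of_nat k * i \<le> K" if "i \<le> n" for i
    unfolding K_def using that by (intro add_mono mult_mono) auto
  have "bound_seq n q k W"
    unfolding bound_seq_def
  proof (intro conjI allI impI)
    show "dfun False False (\<lambda>e. W (e 0))"
      unfolding W_def v_def by (intro dfun_comp1[OF g(1)] dfun_comp1[OF f(1)] dfun_intros)
    show "q \<le> W i" if "i \<le> n" for i unfolding W_def using vq[OF K[OF that]] .
  next
    fix i assume "i < n"
    then have "q + of_nat k * (i + 1) \<le> K" by (intro K) (simp add: add_1_le)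
    then show "W (i + 1) = W i ^ (2 ^ k)" using vk[of "of_nat k * i" k] by (simp add: W_def distrib_left)
  qed
  then show ?thesis by blast
qed

text \<open>The defining polynomial is at most \<open>8 w^2\<close>, and \<open>8 \<le> w^2\<close>
  because \<open>4 \<le> w\<close>. Each pairing thus costs a fourth power, the source of the
  exponents in the growth bounds.\<close>

lemma pair_bound:
  assumes "4 \<le> w" "x \<le> w" "y \<le> w"
  shows "pair x y \<le> w ^ 4"
proof -
  have w1: "1 \<le> w" using assms(1) by auto
  have "pair x y \<le> (x + y) * (x + y + 1) + (x + x)" by (rule pair_upper)
  also have "\<dots> \<le> (w + w) * (w + w + w) + (w + w)" using assms w1 by (intro add_mono mult_mono) auto
  also have "\<dots> \<le> (w + w) * (w + w + w) + (w + w) * w" using mult_left_mono[OF w1, of "w + w"] by simp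
  also have "\<dots> = 8 * (w * w)"
    by (simp only: numeral_Bit0 numeral_One distrib_right distrib_left mult_1 add.assoc)
  also have "\<dots> \<le> (w * w) * (w * w)"
  proof (intro mult_right_mono)
    have "(8 :: el) \<le> 4 * 4" by simp
    also have "\<dots> \<le> w * w" using assms(1) by (intro mult_mono) auto
    finally show "8 \<le> w * w" .
  qed simp
  finally show ?thesis by (simp add: power4_eq_xxxx mult.assoc)
qed

section \<open>The arithmetized syntax in the generic model\<close>

lemma tval_upd [simp]: "x \<notin> tvars t \<Longrightarrow> tval M (\<sigma>(x := a)) t = tval M \<sigma> t"
  by (rule tval_cong) auto

lemma tval_num_tm [simp]: "tval M0 \<sigma> (num_tm k) = of_nat k"
  by (induction k) (auto simp: add.commute)

lemma sat_PairF [simp]: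
  "sat M0 \<sigma> (PairF s t p) \<longleftrightarrow> tval M0 \<sigma> p = pair (tval M0 \<sigma> s) (tval M0 \<sigma> t)"
  by (simp add: PairF_def pair_iff)

lemma sat_Node1 [simp]:
  "sat M0 \<sigma> (Node1 c s p) \<longleftrightarrow> tval M0 \<sigma> p = pair (of_nat c) (tval M0 \<sigma> s)"
  by (simp add: Node1_def)

lemma sat_Node2 [simp]:
  "n \<notin> tvars s \<Longrightarrow> n \<notin> tvars t \<Longrightarrow> n \<notin> tvars p \<Longrightarrow>
    sat M0 \<sigma> (Node2 n c s t p) \<longleftrightarrow> tval M0 \<sigma> p = pair (of_nat c) (pair (tval M0 \<sigma> s) (tval M0 \<sigma> t))"
  by (simp add: Node2_def)

lemma sat_BetaF [simp]:
  assumes "n \<notin> tvars a" "n \<notin> tvars b" "n \<notin> tvars i" "n \<notin> tvars y"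
  shows "sat M0 \<sigma> (BetaF n a b i y) \<longleftrightarrow> tval M0 \<sigma> y = beta (tval M0 \<sigma> a) (tval M0 \<sigma> b) (tval M0 \<sigma> i)"
  using assms rem_iff[OF modulus_pos] by (simp add: BetaF_def beta_def)

lemma exs_simps [simp]: "exs [] A = A" "exs (x # xs) A = (\<^bold>\<exists>x. exs xs A)"
  by (simp_all add: exs_def)

lemma alls_simps [simp]: "alls [] A = A" "alls (x # xs) A = (\<^bold>\<forall>x. alls xs A)"
  by (simp_all add: alls_def)

text \<open>\<open>Rs\<close> is the meaning of the rules \<open>R\<close> when the variables below \<open>n\<close> are interpreted by \<open>\<sigma>\<close>.\<close>

definition realizes :: "nat \<Rightarrow> (nat \<Rightarrow> el) \<Rightarrow> rules \<Rightarrow> srules \<Rightarrow> bool" where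
  "realizes n \<sigma> R Rs \<longleftrightarrow> (\<forall>m \<tau> E Es y. n \<le> m \<longrightarrow> (\<forall>v<n. \<tau> v = \<sigma> v) \<longrightarrow> tvars y \<subseteq> {..<m} \<longrightarrow>
    (\<forall>k \<rho> z. m \<le> k \<longrightarrow> (\<forall>v<m. \<rho> v = \<tau> v) \<longrightarrow> tvars z \<subseteq> {..<k} \<longrightarrow>
       sat M0 \<rho> (E k z) = Es (tval M0 \<rho> z)) \<longrightarrow>
    sat M0 \<tau> (R m E y) = Rs Es (tval M0 \<tau> y))"

lemma realizesI:
  assumes "\<And>m \<tau> E Es y. n \<le> m \<Longrightarrow> (\<And>v. v < n \<Longrightarrow> \<tau> v = \<sigma> v) \<Longrightarrow> (\<And>k. m \<le> k \<Longrightarrow> k \<notin> tvars y) \<Longrightarrow>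
    (\<And>k \<rho> z. m \<le> k \<Longrightarrow> (\<And>v. v < m \<Longrightarrow> \<rho> v = \<tau> v) \<Longrightarrow> tvars z \<subseteq> {..<k} \<Longrightarrow>
       sat M0 \<rho> (E k z) = Es (tval M0 \<rho> z)) \<Longrightarrow>
    sat M0 \<tau> (R m E y) = Rs Es (tval M0 \<tau> y)"
  shows "realizes n \<sigma> R Rs"
  unfolding realizes_def
proof (intro allI impI)
  fix m \<tau> E Es y
  assume a: "n \<le> m" "\<forall>v<n. \<tau> v = \<sigma> v" "tvars y \<subseteq> {..<m}"
    "\<forall>k \<rho> z. m \<le> k \<longrightarrow> (\<forall>v<m. \<rho> v = \<tau> v) \<longrightarrow> tvars z \<subseteq> {..<k} \<longrightarrow>
       sat M0 \<rho> (E k z) = Es (tval M0 \<rho> z)"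
  show "sat M0 \<tau> (R m E y) = Rs Es (tval M0 \<tau> y)"
    by (rule assms) (use a in auto)
qed

lemma sat_IndF:
  assumes R: "realizes n \<sigma> R Rs" and x: "tvars x \<subseteq> {..<n}"
  shows "sat M0 \<sigma> (IndF n R x) \<longleftrightarrow> ind Rs (tval M0 \<sigma> x)"
proof -
  have x': "k \<notin> tvars x" if "n \<le> k" for k using x that by auto
  let ?\<tau> = "\<lambda>a b l i y. \<sigma>(n := a, n + 1 := b, n + 2 := l, n + 3 := i, n + 4 := y)"
  let ?E = "\<lambda>k z. \<^bold>\<exists>k. Var k \<^bold>< Var (n + 3) \<^bold>\<and> BetaF (k + 1) (Var n) (Var (n + 1)) (Var k) z"
  have *: "sat M0 (?\<tau> a b l i y) (R (n + 5) ?E (Var (n + 4))) \<longleftrightarrow>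
      Rs (\<lambda>z. \<exists>k<i. beta a b k = z) y" for a b l i y
  proof -
    have E: "sat M0 \<rho> (?E k z) = (\<exists>j<i. beta a b j = tval M0 \<rho> z)"
      if h: "n + 5 \<le> k" "\<forall>v<n + 5. \<rho> v = ?\<tau> a b l i y v" "tvars z \<subseteq> {..<k}" for k \<rho> z
    proof -
      have z: "k \<notin> tvars z" "k + 1 \<notin> tvars z" using h(3) by auto
      have "\<rho> (n + 3) = i" "\<rho> n = a" "\<rho> (n + 1) = b" using h(2) by simp_all
      then show ?thesis using h(1) z by (auto simp: eq_commute)
    qed
    have "sat M0 (?\<tau> a b l i y) (R (n + 5) ?E (Var (n + 4))) =
        Rs (\<lambda>z. \<exists>k<i. beta a b k = z) (tval M0 (?\<tau> a b l i y) (Var (n + 4)))"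
      by (rule R[unfolded realizes_def, rule_format]) (use E in auto)
    then show ?thesis by simp
  qed
  show ?thesis
    unfolding IndF_def ind_def derivation_def Let_def
    using * x' by (simp add: eq_commute)
qed

lemma sat_Rel:
  assumes "\<And>p. sat M0 (\<sigma>(k := p)) (E (k + 1) (Var k)) = Es p" "k \<notin> tvars x" "k \<notin> tvars y"
  shows "sat M0 \<sigma> (Rel E k x y) \<longleftrightarrow> Es (pair (tval M0 \<sigma> x) (tval M0 \<sigma> y))"
  using assms by (simp add: Rel_def)

lemma sat_Rel_IndF:
  assumes "\<And>p. realizes (n + 1) (\<sigma>(n := p)) R Rs" "tvars x \<subseteq> {..<n}" "tvars y \<subseteq> {..<n}"
  shows "sat M0 \<sigma> (Rel (\<lambda>k. IndF k R) n x y) \<longleftrightarrow> ind Rs (pair (tval M0 \<sigma> x) (tval M0 \<sigma> y))"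
proof (rule sat_Rel)
  show "sat M0 (\<sigma>(n := p)) (IndF (n + 1) R (Var n)) = ind Rs p" for p
    using sat_IndF[OF assms(1), of "Var n" p] by simp
qed (use assms in auto)

section \<open>Meanings of the rules for the coded syntax\<close>

definition term_rules :: srules where
  "term_rules E y \<longleftrightarrow> y = pair 0 0 \<or> (\<exists>s. y = pair 1 s) \<or> (\<exists>s. y = pair 2 s \<and> E s) \<or>
    (\<exists>s t. (y = pair 3 (pair s t) \<or> y = pair 4 (pair s t)) \<and> E s \<and> E t)"

definition form_rules :: srules where
  "form_rules E y \<longleftrightarrow>
    (\<exists>s t. (y = pair 5 (pair s t) \<or> y = pair 6 (pair s t)) \<and> ind term_rules s \<and> ind term_rules t) \<or>
    (\<exists>s. y = pair 7 s \<and> E s) \<or> (\<exists>s t. y = pair 8 (pair s t) \<and> E s \<and> E t) \<or>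
    (\<exists>s t. y = pair 9 (pair s t) \<and> E t)"

definition free_rules :: "el \<Rightarrow> srules" where
  "free_rules v E y \<longleftrightarrow> y = pair 1 v \<or> (\<exists>s. (y = pair 2 s \<or> y = pair 7 s) \<and> E s) \<or>
    (\<exists>s t. (y = pair 3 (pair s t) \<or> y = pair 4 (pair s t) \<or> y = pair 5 (pair s t) \<or>
       y = pair 6 (pair s t) \<or> y = pair 8 (pair s t)) \<and> (E s \<or> E t)) \<or>
    (\<exists>s t. y = pair 9 (pair s t) \<and> s \<noteq> v \<and> E t)"

definition val_rules :: srules where
  "val_rules E y \<longleftrightarrow> (\<exists>t w. y = pair t w \<and> (t = pair 0 0 \<and> w = 0 \<or>
    (\<exists>t1 w1. t = pair 2 t1 \<and> w = w1 + 1 \<and> E (pair t1 w1)) \<or>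
    (\<exists>t1 w1 t2 w2. (t = pair 3 (pair t1 t2) \<and> w = w1 + w2 \<or> t = pair 4 (pair t1 t2) \<and> w = w1 * w2) \<and>
       E (pair t1 w1) \<and> E (pair t2 w2))))"

definition numeral_rules :: srules where
  "numeral_rules E y \<longleftrightarrow> (\<exists>x c. y = pair x c \<and> (x = 0 \<and> c = pair 0 0 \<or>
    (\<exists>x' c'. x = x' + 1 \<and> c = pair 2 c' \<and> E (pair x' c'))))"

definition subst_rules :: "el \<Rightarrow> el \<Rightarrow> srules" where
  "subst_rules v c E y \<longleftrightarrow> (\<exists>x z. y = pair x z \<and>
    (x = pair 0 0 \<and> z = pair 0 0 \<or> x = pair 1 v \<and> z = c \<or>
     (\<exists>s. x = pair 1 s \<and> s \<noteq> v \<and> z = pair 1 s) \<or>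
     (\<exists>s s'. (x = pair 2 s \<and> z = pair 2 s' \<or> x = pair 7 s \<and> z = pair 7 s') \<and> E (pair s s')) \<or>
     (\<exists>s s'. E (pair s s') \<and>
       (\<exists>t t'. (x = pair 3 (pair s t) \<and> z = pair 3 (pair s' t') \<or>
        x = pair 4 (pair s t) \<and> z = pair 4 (pair s' t') \<or>
        x = pair 5 (pair s t) \<and> z = pair 5 (pair s' t') \<or>
        x = pair 6 (pair s t) \<and> z = pair 6 (pair s' t') \<or>
        x = pair 8 (pair s t) \<and> z = pair 8 (pair s' t')) \<and> E (pair t t'))) \<or>
     (\<exists>s. x = pair 9 (pair v s) \<and> z = pair 9 (pair v s)) \<or>
     (\<exists>s s' t. x = pair 9 (pair t s) \<and> z = pair 9 (pair t s') \<and> t \<noteq> v \<and> E (pair s s'))))"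

text \<open>Index \<open>0\<close> already carries entry \<open>0\<close>, so index \<open>1\<close>
  carries that entry twice; from index \<open>1\<close> on the entries that occur are exactly those
  below the index.\<close>

definition disj_rules :: "el \<Rightarrow> el \<Rightarrow> srules" where
  "disj_rules a b E y \<longleftrightarrow> (\<exists>s d. y = pair s d \<and> (s = 0 \<and> d = beta a b 0 \<or>
    (\<exists>t d'. s = t + 1 \<and> d = pair 8 (pair d' (beta a b t)) \<and> E (pair t d'))))"

lemma realizes_Pow2R: "realizes n \<sigma> Pow2R pow2_rules"
proof (rule realizesI)
  fix m \<tau> E Es y
  assume y: "\<And>k. m \<le> k \<Longrightarrow> k \<notin> tvars y"
    and E: "\<And>k \<rho> z. m \<le> k \<Longrightarrow> (\<And>v. v < m \<Longrightarrow> \<rho> v = \<tau> v) \<Longrightarrow> tvars z \<subseteq> {..<k} \<Longrightarrow>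
       sat M0 \<rho> (E k z) = Es (tval M0 \<rho> z)"
  show "sat M0 \<tau> (Pow2R m E y) = pow2_rules Es (tval M0 \<tau> y)"
    unfolding Pow2R_def Let_def pow2_rules_def
    by (simp add: y E sat_Rel[where Es = Es] del: ex_simps)
qed

lemma realizes_TermR: "realizes n \<sigma> TermR term_rules"
proof (rule realizesI)
  fix m \<tau> E Es y
  assume y: "\<And>k. m \<le> k \<Longrightarrow> k \<notin> tvars y"
    and E: "\<And>k \<rho> z. m \<le> k \<Longrightarrow> (\<And>v. v < m \<Longrightarrow> \<rho> v = \<tau> v) \<Longrightarrow> tvars z \<subseteq> {..<k} \<Longrightarrow>
       sat M0 \<rho> (E k z) = Es (tval M0 \<rho> z)"
  show "sat M0 \<tau> (TermR m E y) = term_rules Es (tval M0 \<tau> y)"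
    unfolding TermR_def Let_def term_rules_def
    by (simp add: y E del: ex_simps) blast
qed

lemma sat_TermF: "tvars x \<subseteq> {..<n} \<Longrightarrow> sat M0 \<sigma> (TermF n x) \<longleftrightarrow> ind term_rules (tval M0 \<sigma> x)"
  unfolding TermF_def by (rule sat_IndF[OF realizes_TermR])

lemma realizes_FormR: "realizes n \<sigma> FormR form_rules"
proof (rule realizesI)
  fix m \<tau> E Es y
  assume y: "\<And>k. m \<le> k \<Longrightarrow> k \<notin> tvars y"
    and E: "\<And>k \<rho> z. m \<le> k \<Longrightarrow> (\<And>v. v < m \<Longrightarrow> \<rho> v = \<tau> v) \<Longrightarrow> tvars z \<subseteq> {..<k} \<Longrightarrow>
       sat M0 \<rho> (E k z) = Es (tval M0 \<rho> z)"
  show "sat M0 \<tau> (FormR m E y) = form_rules Es (tval M0 \<tau> y)"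
    unfolding FormR_def Let_def form_rules_def
    by (simp add: y E sat_TermF del: ex_simps) blast
qed

lemma sat_FormF: "tvars x \<subseteq> {..<n} \<Longrightarrow> sat M0 \<sigma> (FormF n x) \<longleftrightarrow> ind form_rules (tval M0 \<sigma> x)"
  unfolding FormF_def by (rule sat_IndF[OF realizes_FormR])

lemma realizes_FreeR:
  assumes v: "tvars v \<subseteq> {..<n}"
  shows "realizes n \<sigma> (FreeR v) (free_rules (tval M0 \<sigma> v))"
proof (rule realizesI)
  fix m \<tau> E Es y
  assume n: "n \<le> m" and \<tau>: "\<And>v. v < n \<Longrightarrow> \<tau> v = \<sigma> v"
    and y: "\<And>k. m \<le> k \<Longrightarrow> k \<notin> tvars y"
    and E: "\<And>k \<rho> z. m \<le> k \<Longrightarrow> (\<And>v. v < m \<Longrightarrow> \<rho> v = \<tau> v) \<Longrightarrow> tvars z \<subseteq> {..<k} \<Longrightarrow>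
       sat M0 \<rho> (E k z) = Es (tval M0 \<rho> z)"
  have "k \<notin> tvars v" if "m \<le> k" for k using v n that by auto
  moreover have "tval M0 \<tau> v = tval M0 \<sigma> v" using v \<tau> by (intro tval_cong) auto
  ultimately show "sat M0 \<tau> (FreeR v m E y) = free_rules (tval M0 \<sigma> v) Es (tval M0 \<tau> y)"
    unfolding FreeR_def Let_def free_rules_def
    by (simp add: y E del: ex_simps)
qed

lemma sat_FreeF: "tvars v \<subseteq> {..<n} \<Longrightarrow> tvars x \<subseteq> {..<n} \<Longrightarrow>
    sat M0 \<sigma> (FreeF n v x) \<longleftrightarrow> ind (free_rules (tval M0 \<sigma> v)) (tval M0 \<sigma> x)"
  unfolding FreeF_def by (rule sat_IndF[OF realizes_FreeR])

lemma realizes_ValR: "realizes n \<sigma> ValR val_rules"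
proof (rule realizesI)
  fix m \<tau> E Es y
  assume y: "\<And>k. m \<le> k \<Longrightarrow> k \<notin> tvars y"
    and E: "\<And>k \<rho> z. m \<le> k \<Longrightarrow> (\<And>v. v < m \<Longrightarrow> \<rho> v = \<tau> v) \<Longrightarrow> tvars z \<subseteq> {..<k} \<Longrightarrow>
       sat M0 \<rho> (E k z) = Es (tval M0 \<rho> z)"
  show "sat M0 \<tau> (ValR m E y) = val_rules Es (tval M0 \<tau> y)"
    unfolding ValR_def Let_def val_rules_def
    by (simp add: y E sat_Rel[where Es = Es] del: ex_simps) blast
qed

lemma realizes_NumeralR: "realizes n \<sigma> NumeralR numeral_rules"
proof (rule realizesI)
  fix m \<tau> E Es y
  assume y: "\<And>k. m \<le> k \<Longrightarrow> k \<notin> tvars y"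
    and E: "\<And>k \<rho> z. m \<le> k \<Longrightarrow> (\<And>v. v < m \<Longrightarrow> \<rho> v = \<tau> v) \<Longrightarrow> tvars z \<subseteq> {..<k} \<Longrightarrow>
       sat M0 \<rho> (E k z) = Es (tval M0 \<rho> z)"
  show "sat M0 \<tau> (NumeralR m E y) = numeral_rules Es (tval M0 \<tau> y)"
    unfolding NumeralR_def Let_def numeral_rules_def
    by (simp add: y E sat_Rel[where Es = Es] del: ex_simps) blast
qed

lemma realizes_SubstR:
  assumes v: "tvars v \<subseteq> {..<n}" and c: "tvars c \<subseteq> {..<n}"
  shows "realizes n \<sigma> (SubstR v c) (subst_rules (tval M0 \<sigma> v) (tval M0 \<sigma> c))"
proof (rule realizesI)
  fix m \<tau> E Es y
  assume n: "n \<le> m" and \<tau>: "\<And>v. v < n \<Longrightarrow> \<tau> v = \<sigma> v"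
    and y: "\<And>k. m \<le> k \<Longrightarrow> k \<notin> tvars y"
    and E: "\<And>k \<rho> z. m \<le> k \<Longrightarrow> (\<And>v. v < m \<Longrightarrow> \<rho> v = \<tau> v) \<Longrightarrow> tvars z \<subseteq> {..<k} \<Longrightarrow>
       sat M0 \<rho> (E k z) = Es (tval M0 \<rho> z)"
  have "k \<notin> tvars v" "k \<notin> tvars c" if "m \<le> k" for k using v c n that by auto
  moreover have "tval M0 \<tau> v = tval M0 \<sigma> v" "tval M0 \<tau> c = tval M0 \<sigma> c"
    using v c \<tau> by (auto intro!: tval_cong)
  ultimately show "sat M0 \<tau> (SubstR v c m E y) =
      subst_rules (tval M0 \<sigma> v) (tval M0 \<sigma> c) Es (tval M0 \<tau> y)"
    unfolding SubstR_def Let_def subst_rules_def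
    by (simp add: y E sat_Rel[where Es = Es] del: ex_simps)
qed

lemma realizes_DisjR:
  assumes a: "tvars a \<subseteq> {..<n}" and b: "tvars b \<subseteq> {..<n}"
  shows "realizes n \<sigma> (DisjR a b) (disj_rules (tval M0 \<sigma> a) (tval M0 \<sigma> b))"
proof (rule realizesI)
  fix m \<tau> E Es y
  assume n: "n \<le> m" and \<tau>: "\<And>v. v < n \<Longrightarrow> \<tau> v = \<sigma> v"
    and y: "\<And>k. m \<le> k \<Longrightarrow> k \<notin> tvars y"
    and E: "\<And>k \<rho> z. m \<le> k \<Longrightarrow> (\<And>v. v < m \<Longrightarrow> \<rho> v = \<tau> v) \<Longrightarrow> tvars z \<subseteq> {..<k} \<Longrightarrow>
       sat M0 \<rho> (E k z) = Es (tval M0 \<rho> z)"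
  have "k \<notin> tvars a" "k \<notin> tvars b" if "m \<le> k" for k using a b n that by auto
  moreover have "tval M0 \<tau> a = tval M0 \<sigma> a" "tval M0 \<tau> b = tval M0 \<sigma> b"
    using a b \<tau> by (auto intro!: tval_cong)
  ultimately show "sat M0 \<tau> (DisjR a b m E y) =
      disj_rules (tval M0 \<sigma> a) (tval M0 \<sigma> b) Es (tval M0 \<tau> y)"
    unfolding DisjR_def Let_def disj_rules_def
    by (simp add: y E sat_Rel[where Es = Es] del: ex_simps) blast
qed

lemma sat_Pow2F: "tvars x \<subseteq> {..<n} \<Longrightarrow> tvars p \<subseteq> {..<n} \<Longrightarrow>
    sat M0 \<sigma> (Pow2F n x p) \<longleftrightarrow> ind pow2_rules (pair (tval M0 \<sigma> x) (tval M0 \<sigma> p))"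
  unfolding Pow2F_def by (rule sat_Rel_IndF[OF realizes_Pow2R])

lemma sat_ValF: "tvars t \<subseteq> {..<n} \<Longrightarrow> tvars w \<subseteq> {..<n} \<Longrightarrow>
    sat M0 \<sigma> (ValF n t w) \<longleftrightarrow> ind val_rules (pair (tval M0 \<sigma> t) (tval M0 \<sigma> w))"
  unfolding ValF_def by (rule sat_Rel_IndF[OF realizes_ValR])

lemma sat_NumeralF: "tvars x \<subseteq> {..<n} \<Longrightarrow> tvars c \<subseteq> {..<n} \<Longrightarrow>
    sat M0 \<sigma> (NumeralF n x c) \<longleftrightarrow> ind numeral_rules (pair (tval M0 \<sigma> x) (tval M0 \<sigma> c))"
  unfolding NumeralF_def by (rule sat_Rel_IndF[OF realizes_NumeralR])

lemma tvars_less_weaken: "tvars t \<subseteq> {..<n} \<Longrightarrow> tvars t \<subseteq> {..<n + 1}" "tvars t \<subseteq> {..<n} \<Longrightarrow> n \<notin> tvars t"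
  by auto

lemma sat_SubstF:
  assumes "tvars v \<subseteq> {..<n}" "tvars c \<subseteq> {..<n}" "tvars x \<subseteq> {..<n}" "tvars z \<subseteq> {..<n}"
  shows "sat M0 \<sigma> (SubstF n v c x z) \<longleftrightarrow>
    ind (subst_rules (tval M0 \<sigma> v) (tval M0 \<sigma> c)) (pair (tval M0 \<sigma> x) (tval M0 \<sigma> z))"
  unfolding SubstF_def
proof (rule sat_Rel_IndF[OF _ assms(3,4)])
  show "realizes (n + 1) (\<sigma>(n := p)) (SubstR v c) (subst_rules (tval M0 \<sigma> v) (tval M0 \<sigma> c))" for p
    using realizes_SubstR[of v "n + 1" c "\<sigma>(n := p)"] tvars_less_weaken assms(1,2) by simp
qed

lemma sat_DisjF:
  assumes "tvars a \<subseteq> {..<n}" "tvars b \<subseteq> {..<n}" "tvars s \<subseteq> {..<n}" "tvars d \<subseteq> {..<n}"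
  shows "sat M0 \<sigma> (DisjF n a b s d) \<longleftrightarrow>
    ind (disj_rules (tval M0 \<sigma> a) (tval M0 \<sigma> b)) (pair (tval M0 \<sigma> s) (tval M0 \<sigma> d))"
  unfolding DisjF_def
proof (rule sat_Rel_IndF[OF _ assms(3,4)])
  show "realizes (n + 1) (\<sigma>(n := p)) (DisjR a b) (disj_rules (tval M0 \<sigma> a) (tval M0 \<sigma> b))" for p
    using realizes_DisjR[of a "n + 1" b "\<sigma>(n := p)"] tvars_less_weaken assms(1,2) by simp
qed

definition Sent :: "el \<Rightarrow> bool" where
  "Sent x \<longleftrightarrow> ind form_rules x \<and> (\<forall>v. \<not> ind (free_rules v) x)"

definition ClosedTerm :: "el \<Rightarrow> bool" where
  "ClosedTerm x \<longleftrightarrow> ind term_rules x \<and> (\<forall>v. \<not> ind (free_rules v) x)"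

lemma sat_SentF: "tvars x \<subseteq> {..<n} \<Longrightarrow> sat M0 \<sigma> (SentF n x) \<longleftrightarrow> Sent (tval M0 \<sigma> x)"
  using tvars_less_weaken[of x n] by (simp add: SentF_def Sent_def sat_FormF sat_FreeF)

lemma sat_ClosedTermF: "tvars x \<subseteq> {..<n} \<Longrightarrow> sat M0 \<sigma> (ClosedTermF n x) \<longleftrightarrow> ClosedTerm (tval M0 \<sigma> x)"
  using tvars_less_weaken[of x n] by (simp add: ClosedTermF_def ClosedTerm_def sat_TermF sat_FreeF)

lemmas sat_syntax = sat_FormF sat_FreeF sat_SentF sat_ClosedTermF sat_ValF sat_NumeralF sat_SubstF sat_DisjF

section \<open>Axioms of the theories read in the generic model\<close>

lemma models_Exp_total: "models M0 {Exp_total} \<longleftrightarrow> Exp"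
  by (simp add: models_def Exp_total_def sat_Pow2F Exp_def)

lemma models_T_sent: "models M0 {T_sent} \<longleftrightarrow> (\<forall>x. TT x \<longrightarrow> Sent x)"
  by (auto simp: models_def T_sent_def sat_syntax)

lemma models_T_eq: "models M0 {T_eq} \<longleftrightarrow> (\<forall>s t. ClosedTerm s \<longrightarrow> ClosedTerm t \<longrightarrow>
    (TT (pair 5 (pair s t)) \<longleftrightarrow> (\<exists>w. ind val_rules (pair s w) \<and> ind val_rules (pair t w))))"
  by (simp add: models_def T_eq_def Let_def sat_syntax) blast

lemma models_T_neg: "models M0 {T_neg} \<longleftrightarrow> (\<forall>p. Sent p \<longrightarrow> (TT (pair 7 p) \<longleftrightarrow> \<not> TT p))"
  by (simp add: models_def T_neg_def Let_def sat_syntax) blast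

lemma models_T_or: "models M0 {T_or} \<longleftrightarrow>
    (\<forall>p q. Sent p \<longrightarrow> Sent q \<longrightarrow> (TT (pair 8 (pair p q)) \<longleftrightarrow> TT p \<or> TT q))"
  by (simp add: models_def T_or_def Let_def sat_syntax) blast

lemma models_T_ex: "models M0 {T_ex} \<longleftrightarrow>
    (\<forall>v g. ind form_rules g \<longrightarrow> (\<forall>u. ind (free_rules u) g \<longleftrightarrow> u = v) \<longrightarrow>
      (TT (pair 9 (pair v g)) \<longleftrightarrow>
       (\<exists>x c h. ind numeral_rules (pair x c) \<and> ind (subst_rules v c) (pair g h) \<and> TT h)))"
  by (simp add: models_def T_ex_def Let_def sat_syntax) blast

lemma models_DC: "models M0 {DC} \<longleftrightarrow>
    (\<forall>a b s d. 0 < s \<longrightarrow> (\<forall>i<s. Sent (beta a b i)) \<longrightarrow> ind (disj_rules a b) (pair s d) \<longrightarrow>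
      (TT d \<longleftrightarrow> (\<exists>i<s. TT (beta a b i))))"
  by (simp add: models_def DC_def Let_def sat_syntax) blast

section \<open>Syntax of standard formulae with numerals\<close>

lemma mono_rules_syntax [simp]:
  "mono_rules term_rules" "mono_rules form_rules" "mono_rules (free_rules v)" "mono_rules val_rules"
  "mono_rules numeral_rules" "mono_rules (subst_rules v c)" "mono_rules (disj_rules a b)"
  unfolding mono_rules_def term_rules_def form_rules_def free_rules_def val_rules_def
    numeral_rules_def subst_rules_def disj_rules_def
  by (intro allI impI, erule rev_mp, intro ex_mono disj_mono conj_mono imp_refl; simp)+

text \<open>Thus \<open>Zero\<close> has the code \<open>0\<close>.\<close>

lemma pair_0_0 [simp]: "pair 0 0 = 0"
  using pair_iff[of 0 0 0] by simp

locale expo = assumes Exp: Exp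
begin

sublocale fac
  by unfold_locales (rule Fac_of_Exp[OF Exp])

lemmas cases_ind = ind_cases[OF mono_rules_syntax(1)] ind_cases[OF mono_rules_syntax(2)]
  ind_cases[OF mono_rules_syntax(3)] ind_cases[OF mono_rules_syntax(4)]
  ind_cases[OF mono_rules_syntax(5)] ind_cases[OF mono_rules_syntax(6)] ind_cases[OF mono_rules_syntax(7)]

subsection \<open>Numerals\<close>

text \<open>Codes of numerals outgrow every term, so the function is available to bounded induction
  only on initial segments, where a parameter bounds it.\<close>

definition num_upto :: "el \<Rightarrow> (el \<Rightarrow> el) \<Rightarrow> bool" where
  "num_upto N h \<longleftrightarrow> dfun False False (\<lambda>e. h (e 0)) \<and> h 0 = pair 0 0 \<and> (\<forall>x<N. h (x + 1) = pair 2 (h x))"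

lemma num_upto_exists: "\<exists>h. num_upto N h"
proof -
  \<comment> \<open>One pairing per step costs a fourth power, hence the exponent
    \<open>2 ^ 2\<close>. The lower bound \<open>4\<close> meets the premise of
    \<open>pair_bound\<close>.\<close>
  obtain W where W: "bound_seq N 4 2 W" using growth[OF Exp] by blast
  have step: "pair 2 z \<le> W (i + 1)" if "i < N" "z \<le> W i" for i z
  proof -
    have "4 \<le> W i" "W (i + 1) = W i ^ 4" using W that(1) by (auto simp: bound_seq_def)
    moreover have "(2 :: el) \<le> 4" by simp
    ultimately show ?thesis using pair_bound[of "W i" 2 z] that(2) order_trans by metis
  qed
  have d: "dfun False False (\<lambda>e. pair 2 (e 1))" by (intro dfun_pair dfun_intros)
  obtain a b where ab: "beta a b 0 = 0" "\<And>i. i < N \<Longrightarrow> beta a b (i + 1) = pair 2 (beta a b i)"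
    "\<And>i. i \<le> N \<Longrightarrow> beta a b i \<le> W i"
    by (rule recursion[OF Fac Ind_Delta0 d, of W 0 N]) (use W step in \<open>auto simp: bound_seq_def\<close>)
  have "num_upto N (beta a b)"
    unfolding num_upto_def using ab by (auto intro: dfun_beta dfun_intros)
  then show ?thesis by blast
qed

lemma num_upto_unique:
  assumes h: "num_upto N h" "num_upto N' h'"
  shows "x \<le> N \<longrightarrow> x \<le> N' \<longrightarrow> h x = h' x"
proof (rule induct_Delta0[where P = "\<lambda>x. x \<le> N \<longrightarrow> x \<le> N' \<longrightarrow> h x = h' x"])
  have "dfun False False (\<lambda>e. h (e 0))" "dfun False False (\<lambda>e. h' (e 0))"
    using h by (simp_all add: num_upto_def)
  then show "dfn False False (\<lambda>e. e 0 \<le> N \<longrightarrow> e 0 \<le> N' \<longrightarrow> h (e 0) = h' (e 0))"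
    by (intro dfn_intros dfun_intros)
next
  fix x assume IH: "x \<le> N \<longrightarrow> x \<le> N' \<longrightarrow> h x = h' x"
  show "x + 1 \<le> N \<longrightarrow> x + 1 \<le> N' \<longrightarrow> h (x + 1) = h' (x + 1)"
    using IH h by (auto simp: add_1_le num_upto_def)
qed (use h in \<open>simp add: num_upto_def\<close>)

text \<open>Total but without a term bound: each value comes from its own initial segment, and these
  agree by \<open>num_upto_unique\<close>.\<close>

definition nm :: "el \<Rightarrow> el" where
  "nm x = (SOME h. num_upto x h) x"

lemma nm_eq: "num_upto N h \<Longrightarrow> x \<le> N \<Longrightarrow> nm x = h x"
  unfolding nm_def using num_upto_unique[OF someI_ex[OF num_upto_exists], of N h x x] by simp

lemma nm_0: "nm 0 = 0"
  using num_upto_exists[of 0] nm_eq[of 0 _ 0] by (auto simp: num_upto_def)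

lemma nm_Suc: "nm (x + 1) = pair 2 (nm x)"
proof -
  obtain h where h: "num_upto (x + 1) h" using num_upto_exists by blast
  then have "nm (x + 1) = h (x + 1)" "nm x = h x" by (auto intro: nm_eq)
  then show ?thesis using h by (simp add: num_upto_def)
qed

lemma nm_cases: "(x = 0 \<and> nm x = 0) \<or> (\<exists>y. x = y + 1 \<and> nm x = pair 2 (nm y))"
  using el_cases[of x] nm_0 nm_Suc by auto

lemma num_uptoD:
  assumes "num_upto N h"
  shows "dfun False False (\<lambda>e. h (e 0))" "\<And>x. x \<le> N \<Longrightarrow> nm x = h x"
  using assms nm_eq by (auto simp: num_upto_def)

lemma pair_eq_0 [simp]: "pair x y = 0 \<longleftrightarrow> x = 0 \<and> y = 0" "0 = pair x y \<longleftrightarrow> x = 0 \<and> y = 0"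
  using pair_inject[of x y 0 0] by (auto simp del: pair_inject)

lemma nm_neq_var [simp]: "nm x \<noteq> pair 1 y" "pair 1 y \<noteq> nm x"
  using nm_cases[of x] by auto

text \<open>The inductions are about an initial segment \<open>h\<close> in place of
  \<open>nm\<close>, and about pairs whose components are bounded by the pair itself, which keeps
  them bounded. The lemmas on free variables, values and substitution in numerals follow the same
  pattern.\<close>

lemma ind_numeral: "ind numeral_rules (pair x c) \<longleftrightarrow> c = nm x"
proof
  obtain h where "num_upto x h" using num_upto_exists by blast
  note h = num_uptoD[OF this]
  let ?P = "\<lambda>y. \<forall>x'. x' \<le> x \<longrightarrow> (\<forall>c'. c' \<le> y \<longrightarrow> y = pair x' c' \<longrightarrow> c' = h x')"
  assume "ind numeral_rules (pair x c)"
  then have "?P (pair x c)"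
  proof (rule ind_induct[OF Ind_Delta0, where P = ?P, rotated])
    show "dfn False False (\<lambda>e. ?P (e 0))" by (intro dfn_intros dfun_intros dfun_pair dfun_comp1[OF h(1)])
    fix y E assume E: "\<And>z. E z \<Longrightarrow> ?P z" and R: "numeral_rules E y"
    show "?P y"
    proof (intro allI impI)
      fix x' c' assume x': "x' \<le> x" and y: "y = pair x' c'"
      from R consider "x' = 0" "c' = 0" | x1 c1 where "x' = x1 + 1" "c' = pair 2 c1" "E (pair x1 c1)"
        unfolding numeral_rules_def y by auto
      then show "c' = h x'"
      proof cases
        case 1 then show ?thesis using h(2)[of 0] nm_0 by simp
      next
        case 2
        then have x1: "x1 \<le> x" using x' by (simp add: add_1_le)
        have "c1 = h x1" using E[OF 2(3)] x1 le_pair(2)[of c1 x1] by blast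
        then show ?thesis using 2 h(2)[OF x1] h(2)[OF x'] nm_Suc[of x1] by simp
      qed
    qed
  qed
  then show "c = nm x" using h(2)[of x] le_pair(2)[of c x] by simp
next
  assume c: "c = nm x"
  obtain h where "num_upto x h" using num_upto_exists by blast
  note h = num_uptoD[OF this]
  have "ind numeral_rules ((\<lambda>i. pair i (h i)) x)"
  proof (rule ind_seq[OF Ind_Delta0, where s = "\<lambda>i. pair i (h i)" and n = x])
    show "dfun False False (\<lambda>e. pair (e 0) (h (e 0)))" by (intro dfun_pair dfun_intros h)
    fix i assume i: "i \<le> x"
    show "numeral_rules (\<lambda>z. \<exists>k<i. pair k (h k) = z) (pair i (h i))"
    proof (cases "i = 0")
      case True
      then show ?thesis using h(2)[of 0] nm_0 by (simp add: numeral_rules_def)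
    next
      case False
      then obtain j where j: "i = j + 1" using el_cases by blast
      then have "j < i" "j \<le> x" using i by (simp_all add: add_1_le)
      then have "h i = pair 2 (h j)" using h(2)[of i] h(2)[of j] i nm_Suc[of j] j by simp
      then show ?thesis using \<open>j < i\<close> j by (auto simp: numeral_rules_def)
    qed
  qed
  then show "ind numeral_rules (pair x c)" using c h(2)[of x] by simp
qed

lemma ind_term_nm: "ind term_rules (nm x)"
proof -
  obtain h where "num_upto x h" using num_upto_exists by blast
  note h = num_uptoD[OF this]
  have "ind term_rules (h x)"
  proof (rule ind_seq[OF Ind_Delta0 h(1)])
    fix i assume i: "i \<le> x"
    show "term_rules (\<lambda>z. \<exists>k<i. h k = z) (h i)"
    proof (cases "i = 0")
      case True
      then show ?thesis using h(2)[of 0] nm_0 by (simp add: term_rules_def)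
    next
      case False
      then obtain j where j: "i = j + 1" using el_cases by blast
      then have "j < i" "j \<le> x" using i by (simp_all add: add_1_le)
      then have "h i = pair 2 (h j)" using h(2)[of i] h(2)[of j] i nm_Suc[of j] j by simp
      then show ?thesis using \<open>j < i\<close> by (auto simp: term_rules_def)
    qed
  qed
  then show ?thesis using h(2)[of x] by simp
qed

lemma not_free_nm: "\<not> ind (free_rules v) (nm x)"
proof
  obtain h where "num_upto x h" using num_upto_exists by blast
  note h = num_uptoD[OF this]
  let ?P = "\<lambda>y. \<forall>i. i \<le> x \<longrightarrow> y \<noteq> h i"
  assume "ind (free_rules v) (nm x)"
  then have "?P (nm x)"
  proof (rule ind_induct[OF Ind_Delta0, where P = ?P, rotated])
    show "dfn False False (\<lambda>e. ?P (e 0))" by (intro dfn_intros dfun_intros dfun_comp1[OF h(1)])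
    fix y E assume E: "\<And>z. E z \<Longrightarrow> ?P z" and R: "free_rules v E y"
    show "?P y"
    proof (intro allI impI notI)
      fix i assume i: "i \<le> x" and y: "y = h i"
      then have "y = nm i" using h(2) by simp
      then consider "y = 0" | j where "i = j + 1" "y = pair 2 (nm j)" using nm_cases[of i] by auto
      then show False
      proof cases
        case 1 then show ?thesis using R by (auto simp: free_rules_def)
      next
        case 2
        then have "E (nm j)" using R by (auto simp: free_rules_def)
        moreover have "j \<le> x" using 2 i by (simp add: add_1_le)
        ultimately show ?thesis using E h(2) by blast
      qed
    qed
  qed
  then show False using h(2)[of x] by (metis order_refl)
qed

lemma ind_val_nm: "ind val_rules (pair (nm x) w) \<longleftrightarrow> w = x"
proof
  obtain h where "num_upto x h" using num_upto_exists by blast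
  note h = num_uptoD[OF this]
  let ?P = "\<lambda>y. \<forall>i. i \<le> x \<longrightarrow> (\<forall>w. w \<le> y \<longrightarrow> y = pair (h i) w \<longrightarrow> w = i)"
  assume "ind val_rules (pair (nm x) w)"
  then have "?P (pair (nm x) w)"
  proof (rule ind_induct[OF Ind_Delta0, where P = ?P, rotated])
    show "dfn False False (\<lambda>e. ?P (e 0))" by (intro dfn_intros dfun_intros dfun_pair dfun_comp1[OF h(1)])
    fix y E assume E: "\<And>z. E z \<Longrightarrow> ?P z" and R: "val_rules E y"
    show "?P y"
    proof (intro allI impI)
      fix i w assume i: "i \<le> x" and y: "y = pair (h i) w"
      then have y': "y = pair (nm i) w" using h(2) by simp
      from nm_cases[of i] show "w = i"
      proof
        assume "i = 0 \<and> nm i = 0"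
        then show ?thesis using R unfolding val_rules_def y' by auto
      next
        assume "\<exists>j. i = j + 1 \<and> nm i = pair 2 (nm j)"
        then obtain j where j: "i = j + 1" "nm i = pair 2 (nm j)" by blast
        then obtain w1 where w: "w = w1 + 1" "E (pair (nm j) w1)"
          using R unfolding val_rules_def y' by auto
        have "j \<le> x" using j(1) i by (simp add: add_1_le)
        then have "w1 = j" using E[OF w(2)] le_pair(2)[of w1 "nm j"] h(2) by simp
        then show ?thesis using w(1) j(1) by simp
      qed
    qed
  qed
  then show "w = x" using h(2)[of x] le_pair(2)[of w "nm x"] by simp
next
  assume w: "w = x"
  obtain h where "num_upto x h" using num_upto_exists by blast
  note h = num_uptoD[OF this]
  have "ind val_rules ((\<lambda>i. pair (h i) i) x)"
  proof (rule ind_seq[OF Ind_Delta0, where s = "\<lambda>i. pair (h i) i" and n = x])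
    show "dfun False False (\<lambda>e. pair (h (e 0)) (e 0))" by (intro dfun_pair dfun_intros h)
    fix i assume i: "i \<le> x"
    show "val_rules (\<lambda>z. \<exists>k<i. pair (h k) k = z) (pair (h i) i)"
    proof (cases "i = 0")
      case True
      then show ?thesis using h(2)[of 0] nm_0 by (simp add: val_rules_def)
    next
      case False
      then obtain j where j: "i = j + 1" using el_cases by blast
      then have "j < i" "j \<le> x" using i by (simp_all add: add_1_le)
      then have "h i = pair 2 (h j)" using h(2)[of i] h(2)[of j] i nm_Suc[of j] j by simp
      then show ?thesis using \<open>j < i\<close> j by (auto simp: val_rules_def)
    qed
  qed
  then show "ind val_rules (pair (nm x) w)" using w h(2)[of x] by simp
qed

lemma ind_subst_nm: "ind (subst_rules v c) (pair (nm x) z) \<longleftrightarrow> z = nm x"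
proof
  obtain h where "num_upto x h" using num_upto_exists by blast
  note h = num_uptoD[OF this]
  let ?P = "\<lambda>y. \<forall>i. i \<le> x \<longrightarrow> (\<forall>z. z \<le> y \<longrightarrow> y = pair (h i) z \<longrightarrow> z = h i)"
  assume "ind (subst_rules v c) (pair (nm x) z)"
  then have "?P (pair (nm x) z)"
  proof (rule ind_induct[OF Ind_Delta0, where P = ?P, rotated])
    show "dfn False False (\<lambda>e. ?P (e 0))" by (intro dfn_intros dfun_intros dfun_pair dfun_comp1[OF h(1)])
    fix y E assume E: "\<And>z. E z \<Longrightarrow> ?P z" and R: "subst_rules v c E y"
    show "?P y"
    proof (intro allI impI)
      fix i z assume i: "i \<le> x" and y: "y = pair (h i) z"
      then have y': "y = pair (nm i) z" using h(2) by simp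
      from nm_cases[of i] have "z = nm i"
      proof
        assume "i = 0 \<and> nm i = 0"
        then show ?thesis using R unfolding subst_rules_def y' by auto
      next
        assume "\<exists>j. i = j + 1 \<and> nm i = pair 2 (nm j)"
        then obtain j where j: "i = j + 1" "nm i = pair 2 (nm j)" by blast
        then obtain w1 where w: "z = pair 2 w1" "E (pair (nm j) w1)"
          using R unfolding subst_rules_def y' by auto
        have "j \<le> x" using j(1) i by (simp add: add_1_le)
        then have "w1 = nm j" using E[OF w(2)] le_pair(2)[of w1 "nm j"] h(2) by simp
        then show ?thesis using w(1) j(2) by simp
      qed
      then show "z = h i" using h(2)[OF i] by simp
    qed
  qed
  then show "z = nm x" using h(2)[of x] le_pair(2)[of z "nm x"] by simp
next
  assume z: "z = nm x"
  obtain h where "num_upto x h" using num_upto_exists by blast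
  note h = num_uptoD[OF this]
  have "ind (subst_rules v c) ((\<lambda>i. pair (h i) (h i)) x)"
  proof (rule ind_seq[OF Ind_Delta0, where s = "\<lambda>i. pair (h i) (h i)" and n = x])
    show "dfun False False (\<lambda>e. pair (h (e 0)) (h (e 0)))" by (intro dfun_pair dfun_intros h)
    fix i assume i: "i \<le> x"
    show "subst_rules v c (\<lambda>z. \<exists>k<i. pair (h k) (h k) = z) (pair (h i) (h i))"
    proof (cases "i = 0")
      case True
      then show ?thesis using h(2)[of 0] nm_0 by (simp add: subst_rules_def)
    next
      case False
      then obtain j where j: "i = j + 1" using el_cases by blast
      then have "j < i" "j \<le> x" using i by (simp_all add: add_1_le)
      then have "h i = pair 2 (h j)" using h(2)[of i] h(2)[of j] i nm_Suc[of j] j by simp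
      then show ?thesis using \<open>j < i\<close> by (auto simp: subst_rules_def)
    qed
  qed
  then show "ind (subst_rules v c) (pair (nm x) z)" using z h(2)[of x] by simp
qed

subsection \<open>Inversion of the syntactic classes\<close>

lemma term_intros:
  "ind term_rules 0" "ind term_rules (pair 1 v)" "ind term_rules s \<Longrightarrow> ind term_rules (pair 2 s)"
  "ind term_rules s \<Longrightarrow> ind term_rules t \<Longrightarrow> ind term_rules (pair 3 (pair s t))"
  "ind term_rules s \<Longrightarrow> ind term_rules t \<Longrightarrow> ind term_rules (pair 4 (pair s t))"
proof -
  show "ind term_rules 0" "ind term_rules (pair 1 v)"
    by (rule ind_intro0; simp add: term_rules_def)+
  show "ind term_rules s \<Longrightarrow> ind term_rules (pair 2 s)"
    by (erule ind_intro1[rotated]) (simp_all add: term_rules_def)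
  show "ind term_rules s \<Longrightarrow> ind term_rules t \<Longrightarrow> ind term_rules (pair 3 (pair s t))"
    "ind term_rules s \<Longrightarrow> ind term_rules t \<Longrightarrow> ind term_rules (pair 4 (pair s t))"
    by (rule ind_intro2[of _ s t]; simp add: term_rules_def)+
qed

lemma form_intros:
  "ind term_rules s \<Longrightarrow> ind term_rules t \<Longrightarrow> ind form_rules (pair 5 (pair s t))"
  "ind term_rules s \<Longrightarrow> ind term_rules t \<Longrightarrow> ind form_rules (pair 6 (pair s t))"
  "ind form_rules s \<Longrightarrow> ind form_rules (pair 7 s)"
  "ind form_rules s \<Longrightarrow> ind form_rules t \<Longrightarrow> ind form_rules (pair 8 (pair s t))"
  "ind form_rules t \<Longrightarrow> ind form_rules (pair 9 (pair v t))"
proof -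
  show "ind term_rules s \<Longrightarrow> ind term_rules t \<Longrightarrow> ind form_rules (pair 5 (pair s t))"
    "ind term_rules s \<Longrightarrow> ind term_rules t \<Longrightarrow> ind form_rules (pair 6 (pair s t))"
    by (rule ind_intro0; simp add: form_rules_def)+
  show "ind form_rules s \<Longrightarrow> ind form_rules (pair 7 s)"
    "ind form_rules t \<Longrightarrow> ind form_rules (pair 9 (pair v t))"
    by (erule ind_intro1[rotated]; simp add: form_rules_def)+
  show "ind form_rules s \<Longrightarrow> ind form_rules t \<Longrightarrow> ind form_rules (pair 8 (pair s t))"
    by (rule ind_intro2[of _ s t]) (simp_all add: form_rules_def)
qed

lemma free_iffs [simp]:
  "\<not> ind (free_rules v) 0"
  "ind (free_rules v) (pair 1 u) \<longleftrightarrow> u = v"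
  "ind (free_rules v) (pair 2 s) \<longleftrightarrow> ind (free_rules v) s"
  "ind (free_rules v) (pair 3 (pair s t)) \<longleftrightarrow> ind (free_rules v) s \<or> ind (free_rules v) t"
  "ind (free_rules v) (pair 4 (pair s t)) \<longleftrightarrow> ind (free_rules v) s \<or> ind (free_rules v) t"
  "ind (free_rules v) (pair 5 (pair s t)) \<longleftrightarrow> ind (free_rules v) s \<or> ind (free_rules v) t"
  "ind (free_rules v) (pair 6 (pair s t)) \<longleftrightarrow> ind (free_rules v) s \<or> ind (free_rules v) t"
  "ind (free_rules v) (pair 7 s) \<longleftrightarrow> ind (free_rules v) s"
  "ind (free_rules v) (pair 8 (pair s t)) \<longleftrightarrow> ind (free_rules v) s \<or> ind (free_rules v) t"
  "ind (free_rules v) (pair 9 (pair u t)) \<longleftrightarrow> u \<noteq> v \<and> ind (free_rules v) t"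
proof -
  have I0: "ind (free_rules v) y" if "free_rules v (\<lambda>_. False) y" for y
    by (rule ind_intro0[of "free_rules v", OF that])
  have I1: "ind (free_rules v) y" if "ind (free_rules v) p" "free_rules v (\<lambda>z. z = p) y" for y p
    by (rule ind_intro1[OF mono_rules_syntax(3) that])
  note C = cases_ind(3)[of v]
  show "\<not> ind (free_rules v) 0" using C[of 0] by (auto simp: free_rules_def)
  show "ind (free_rules v) (pair 1 u) \<longleftrightarrow> u = v"
    using C[of "pair 1 u"] I0[of "pair 1 u"] by (auto simp: free_rules_def)
  show "ind (free_rules v) (pair 2 s) \<longleftrightarrow> ind (free_rules v) s"
    using C[of "pair 2 s"] I1[of s "pair 2 s"] by (auto simp: free_rules_def)
  show "ind (free_rules v) (pair 7 s) \<longleftrightarrow> ind (free_rules v) s"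
    using C[of "pair 7 s"] I1[of s "pair 7 s"] by (auto simp: free_rules_def)
  show "ind (free_rules v) (pair 9 (pair u t)) \<longleftrightarrow> u \<noteq> v \<and> ind (free_rules v) t"
    using C[of "pair 9 (pair u t)"] I1[of t "pair 9 (pair u t)"] by (auto simp: free_rules_def)
  show "ind (free_rules v) (pair 3 (pair s t)) \<longleftrightarrow> ind (free_rules v) s \<or> ind (free_rules v) t"
    using C[of "pair 3 (pair s t)"] I1[of s "pair 3 (pair s t)"] I1[of t "pair 3 (pair s t)"]
    by (auto simp: free_rules_def)
  show "ind (free_rules v) (pair 4 (pair s t)) \<longleftrightarrow> ind (free_rules v) s \<or> ind (free_rules v) t"
    using C[of "pair 4 (pair s t)"] I1[of s "pair 4 (pair s t)"] I1[of t "pair 4 (pair s t)"]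
    by (auto simp: free_rules_def)
  show "ind (free_rules v) (pair 5 (pair s t)) \<longleftrightarrow> ind (free_rules v) s \<or> ind (free_rules v) t"
    using C[of "pair 5 (pair s t)"] I1[of s "pair 5 (pair s t)"] I1[of t "pair 5 (pair s t)"]
    by (auto simp: free_rules_def)
  show "ind (free_rules v) (pair 6 (pair s t)) \<longleftrightarrow> ind (free_rules v) s \<or> ind (free_rules v) t"
    using C[of "pair 6 (pair s t)"] I1[of s "pair 6 (pair s t)"] I1[of t "pair 6 (pair s t)"]
    by (auto simp: free_rules_def)
  show "ind (free_rules v) (pair 8 (pair s t)) \<longleftrightarrow> ind (free_rules v) s \<or> ind (free_rules v) t"
    using C[of "pair 8 (pair s t)"] I1[of s "pair 8 (pair s t)"] I1[of t "pair 8 (pair s t)"]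
    by (auto simp: free_rules_def)
qed

lemma val_iffs [simp]:
  "ind val_rules (pair 0 w) \<longleftrightarrow> w = 0"
  "ind val_rules (pair (pair 2 s) w) \<longleftrightarrow> (\<exists>w'. w = w' + 1 \<and> ind val_rules (pair s w'))"
  "ind val_rules (pair (pair 3 (pair s t)) w) \<longleftrightarrow>
    (\<exists>w1 w2. w = w1 + w2 \<and> ind val_rules (pair s w1) \<and> ind val_rules (pair t w2))"
  "ind val_rules (pair (pair 4 (pair s t)) w) \<longleftrightarrow>
    (\<exists>w1 w2. w = w1 * w2 \<and> ind val_rules (pair s w1) \<and> ind val_rules (pair t w2))"
proof -
  have I2: "ind val_rules y" if "ind val_rules p" "ind val_rules q" "val_rules (\<lambda>z. z = p \<or> z = q) y" for y p q
    by (rule ind_intro2[OF mono_rules_syntax(4) that])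
  note C = cases_ind(4)
  show "ind val_rules (pair 0 w) \<longleftrightarrow> w = 0"
    using C[of "pair 0 w"] ind_intro0[of val_rules "pair 0 w"] by (auto simp: val_rules_def)
  show "ind val_rules (pair (pair 2 s) w) \<longleftrightarrow> (\<exists>w'. w = w' + 1 \<and> ind val_rules (pair s w'))"
  proof
    assume "ind val_rules (pair (pair 2 s) w)"
    from C[OF this] show "\<exists>w'. w = w' + 1 \<and> ind val_rules (pair s w')" by (auto simp: val_rules_def)
  next
    assume "\<exists>w'. w = w' + 1 \<and> ind val_rules (pair s w')"
    then obtain w' where w: "w = w' + 1" "ind val_rules (pair s w')" by blast
    show "ind val_rules (pair (pair 2 s) w)"
      by (rule I2[OF w(2) w(2)]) (use w(1) in \<open>auto simp: val_rules_def\<close>)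
  qed
  show "ind val_rules (pair (pair 3 (pair s t)) w) \<longleftrightarrow>
    (\<exists>w1 w2. w = w1 + w2 \<and> ind val_rules (pair s w1) \<and> ind val_rules (pair t w2))" (is "?L = ?R")
  proof
    assume ?L
    from C[OF this] show ?R by (auto simp: val_rules_def)
  next
    assume ?R
    then obtain w1 w2 where w: "w = w1 + w2" "ind val_rules (pair s w1)" "ind val_rules (pair t w2)" by blast
    show ?L by (rule I2[OF w(2,3)]) (use w(1) in \<open>auto simp: val_rules_def\<close>)
  qed
  show "ind val_rules (pair (pair 4 (pair s t)) w) \<longleftrightarrow>
    (\<exists>w1 w2. w = w1 * w2 \<and> ind val_rules (pair s w1) \<and> ind val_rules (pair t w2))" (is "?L = ?R")
  proof
    assume ?L
    from C[OF this] show ?R by (auto simp: val_rules_def)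
  next
    assume ?R
    then obtain w1 w2 where w: "w = w1 * w2" "ind val_rules (pair s w1)" "ind val_rules (pair t w2)" by blast
    show ?L by (rule I2[OF w(2,3)]) (use w(1) in \<open>auto simp: val_rules_def\<close>)
  qed
qed

lemma subst_iffs:
  fixes v c defines "S \<equiv> ind (subst_rules v c)"
  shows "S (pair 0 z) \<longleftrightarrow> z = 0"
    and "S (pair (pair 1 u) z) \<longleftrightarrow> z = (if u = v then c else pair 1 u)"
    and "k \<in> {2, 7} \<Longrightarrow> S (pair (pair k s) z) \<longleftrightarrow> (\<exists>s'. z = pair k s' \<and> S (pair s s'))"
    and "k \<in> {3, 4, 5, 6, 8} \<Longrightarrow> S (pair (pair k (pair s t)) z) \<longleftrightarrow>
      (\<exists>s' t'. z = pair k (pair s' t') \<and> S (pair s s') \<and> S (pair t t'))"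
    and "S (pair (pair 9 (pair v s)) z) \<longleftrightarrow> z = pair 9 (pair v s)"
    and "u \<noteq> v \<Longrightarrow> S (pair (pair 9 (pair u s)) z) \<longleftrightarrow> (\<exists>s'. z = pair 9 (pair u s') \<and> S (pair s s'))"
proof -
  have I0: "S y" if "subst_rules v c (\<lambda>_. False) y" for y
    unfolding S_def by (rule ind_intro0[of "subst_rules v c", OF that])
  have I2: "S y" if "S p" "S q" "\<And>E. E p \<Longrightarrow> E q \<Longrightarrow> subst_rules v c E y" for y p q
  proof -
    have "subst_rules v c (\<lambda>z. z = p \<or> z = q) y" by (rule that(3)) simp_all
    then show ?thesis
      using ind_intro2[OF mono_rules_syntax(6) that(1,2)[unfolded S_def]] unfolding S_def by blast
  qed
  have C: "subst_rules v c S y" if "S y" for y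
    using that cases_ind(6) unfolding S_def by blast
  show "S (pair 0 z) \<longleftrightarrow> z = 0"
    using C[of "pair 0 z"] I0[of "pair 0 z"] by (auto simp: subst_rules_def)
  show "S (pair (pair 1 u) z) \<longleftrightarrow> z = (if u = v then c else pair 1 u)"
    using C[of "pair (pair 1 u) z"] I0[of "pair (pair 1 u) z"] by (auto simp: subst_rules_def)
  show "S (pair (pair 9 (pair v s)) z) \<longleftrightarrow> z = pair 9 (pair v s)"
    using C[of "pair (pair 9 (pair v s)) z"] I0[of "pair (pair 9 (pair v s)) z"]
    by (auto simp: subst_rules_def)
  show "S (pair (pair k s) z) \<longleftrightarrow> (\<exists>s'. z = pair k s' \<and> S (pair s s'))" if k: "k \<in> {2, 7}"
  proof
    assume "S (pair (pair k s) z)"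
    from C[OF this] k show "\<exists>s'. z = pair k s' \<and> S (pair s s')" by (auto simp: subst_rules_def)
  next
    assume "\<exists>s'. z = pair k s' \<and> S (pair s s')"
    then obtain s' where s': "z = pair k s'" "S (pair s s')" by blast
    show "S (pair (pair k s) z)"
      by (rule I2[OF s'(2) s'(2)], use k in \<open>elim insertE emptyE\<close>; simp add: subst_rules_def s'(1))
  qed
  show "S (pair (pair k (pair s t)) z) \<longleftrightarrow>
      (\<exists>s' t'. z = pair k (pair s' t') \<and> S (pair s s') \<and> S (pair t t'))" (is "?L = ?R")
    if k: "k \<in> {3, 4, 5, 6, 8}"
  proof
    assume ?L
    from C[OF this] k show ?R by (auto simp: subst_rules_def)
  next
    assume ?R
    then obtain s' t' where s': "z = pair k (pair s' t')" "S (pair s s')" "S (pair t t')" by blast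
    show ?L
      by (rule I2[OF s'(2,3)], use k in \<open>elim insertE emptyE\<close>; simp add: subst_rules_def s'(1))
  qed
  show "S (pair (pair 9 (pair u s)) z) \<longleftrightarrow> (\<exists>s'. z = pair 9 (pair u s') \<and> S (pair s s'))" if u: "u \<noteq> v"
  proof
    assume "S (pair (pair 9 (pair u s)) z)"
    from C[OF this] u show "\<exists>s'. z = pair 9 (pair u s') \<and> S (pair s s')" by (auto simp: subst_rules_def)
  next
    assume "\<exists>s'. z = pair 9 (pair u s') \<and> S (pair s s')"
    then obtain s' where s': "z = pair 9 (pair u s')" "S (pair s s')" by blast
    show "S (pair (pair 9 (pair u s)) z)"
      by (rule I2[OF s'(2) s'(2)]) (use u in \<open>simp add: subst_rules_def s'(1)\<close>)
  qed
qed

lemma Sent_neg: "Sent p \<Longrightarrow> Sent (pair 7 p)"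
  by (simp add: Sent_def form_intros)

lemma Sent_or: "Sent p \<Longrightarrow> Sent q \<Longrightarrow> Sent (pair 8 (pair p q))"
  by (simp add: Sent_def form_intros)

end

subsection \<open>Codes of standard formulae\<close>

text \<open>\<open>\<rho>\<close> gives the codes of the terms put for the free variables.\<close>

primrec tcode :: "(nat \<Rightarrow> el) \<Rightarrow> tm \<Rightarrow> el" where
  "tcode \<rho> Zero = 0"
| "tcode \<rho> (Var n) = \<rho> n"
| "tcode \<rho> (Succ t) = pair 2 (tcode \<rho> t)"
| "tcode \<rho> (s \<^bold>+ t) = pair 3 (pair (tcode \<rho> s) (tcode \<rho> t))"
| "tcode \<rho> (s \<^bold>* t) = pair 4 (pair (tcode \<rho> s) (tcode \<rho> t))"

text \<open>A bound variable is sent back to its own code, whatever is to be put for its free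
  occurrences. The value at \<open>Tr\<close> is a dummy.\<close>

primrec fcode :: "(nat \<Rightarrow> el) \<Rightarrow> fm \<Rightarrow> el" where
  "fcode \<rho> (s \<^bold>= t) = pair 5 (pair (tcode \<rho> s) (tcode \<rho> t))"
| "fcode \<rho> (s \<^bold>< t) = pair 6 (pair (tcode \<rho> s) (tcode \<rho> t))"
| "fcode \<rho> (Tr t) = 0"
| "fcode \<rho> (\<^bold>\<not> A) = pair 7 (fcode \<rho> A)"
| "fcode \<rho> (A \<^bold>\<or> B) = pair 8 (pair (fcode \<rho> A) (fcode \<rho> B))"
| "fcode \<rho> (\<^bold>\<exists>n. A) = pair 9 (pair (of_nat n) (fcode (\<rho>(n := pair 1 (of_nat n))) A))"

context expo
begin

text \<open>Numerals are closed and the other variables stay themselves, so no capture can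
  occur.\<close>

definition inst :: "(nat \<Rightarrow> el) \<Rightarrow> bool" where
  "inst \<rho> \<longleftrightarrow> (\<forall>n. \<rho> n = pair 1 (of_nat n) \<or> (\<exists>x. \<rho> n = nm x))"

lemma inst_upd_var: "inst \<rho> \<Longrightarrow> inst (\<rho>(n := pair 1 (of_nat n)))"
  by (auto simp: inst_def)

lemma inst_nm [simp]: "inst (\<lambda>n. nm (\<sigma> n))"
  by (auto simp: inst_def)

lemma ind_tcode: "inst \<rho> \<Longrightarrow> ind term_rules (tcode \<rho> t)"
proof (induction t)
  case (Var n)
  then have "\<rho> n = pair 1 (of_nat n) \<or> (\<exists>x. \<rho> n = nm x)" by (simp add: inst_def)
  then show ?case using term_intros(2) ind_term_nm by auto
qed (auto intro: term_intros)

lemma ind_fcode: "inst \<rho> \<Longrightarrow> arithmetical A \<Longrightarrow> ind form_rules (fcode \<rho> A)"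
  by (induction A arbitrary: \<rho>) (auto intro: form_intros ind_tcode inst_upd_var)

lemma free_tcode: "inst \<rho> \<Longrightarrow> ind (free_rules u) (tcode \<rho> t) \<longleftrightarrow> (\<exists>n\<in>tvars t. \<rho> n = pair 1 u)"
proof (induction t)
  case (Var n)
  then have "\<rho> n = pair 1 (of_nat n) \<or> (\<exists>x. \<rho> n = nm x)" by (simp add: inst_def)
  then show ?case using not_free_nm by auto
qed auto

lemma free_fcode:
  "inst \<rho> \<Longrightarrow> arithmetical A \<Longrightarrow> ind (free_rules u) (fcode \<rho> A) \<longleftrightarrow> (\<exists>n\<in>fvars A. \<rho> n = pair 1 u)"
proof (induction A arbitrary: \<rho>)
  case (Ex n A)
  have \<rho>: "\<rho> m = pair 1 (of_nat m) \<or> (\<exists>x. \<rho> m = nm x)" for m using Ex.prems by (simp add: inst_def)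
  have "ind (free_rules u) (fcode \<rho> (\<^bold>\<exists>n. A)) \<longleftrightarrow>
      of_nat n \<noteq> u \<and> (\<exists>m\<in>fvars A. (\<rho>(n := pair 1 (of_nat n))) m = pair 1 u)"
    using Ex.IH[OF inst_upd_var[OF Ex.prems(1)], of n] Ex.prems by (simp del: fun_upd_apply)
  also have "\<dots> \<longleftrightarrow> (\<exists>m\<in>fvars A - {n}. \<rho> m = pair 1 u)"
  proof
    assume "\<exists>m\<in>fvars A - {n}. \<rho> m = pair 1 u"
    then obtain m where m: "m \<in> fvars A" "m \<noteq> n" "\<rho> m = pair 1 u" by blast
    then have "u = of_nat m" using \<rho>[of m] by auto
    then show "of_nat n \<noteq> u \<and> (\<exists>m\<in>fvars A. (\<rho>(n := pair 1 (of_nat n))) m = pair 1 u)"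
      using m by auto
  qed (auto split: if_splits)
  finally show ?case by simp
qed (auto simp: free_tcode)

lemma subst_tcode:
  "inst \<rho> \<Longrightarrow> \<rho> v = pair 1 (of_nat v) \<Longrightarrow>
    ind (subst_rules (of_nat v) c) (pair (tcode \<rho> t) z) \<longleftrightarrow> z = tcode (\<rho>(v := c)) t"
proof (induction t arbitrary: z)
  case (Var n)
  then have "\<rho> n = pair 1 (of_nat n) \<or> (\<exists>x. \<rho> n = nm x \<and> n \<noteq> v)" unfolding inst_def by (metis nm_neq_var(2))
  then show ?case using Var ind_subst_nm by (auto simp: subst_iffs)
qed (auto simp: subst_iffs)

lemma subst_fcode:
  "inst \<rho> \<Longrightarrow> \<rho> v = pair 1 (of_nat v) \<Longrightarrow> arithmetical A \<Longrightarrow>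
    ind (subst_rules (of_nat v) c) (pair (fcode \<rho> A) z) \<longleftrightarrow> z = fcode (\<rho>(v := c)) A"
proof (induction A arbitrary: \<rho> z)
  case (Ex n A)
  show ?case
  proof (cases "n = v")
    case True
    then show ?thesis by (simp add: subst_iffs del: fun_upd_apply)
  next
    case False
    let ?\<rho> = "\<rho>(n := pair 1 (of_nat n))"
    have "ind (subst_rules (of_nat v) c) (pair (fcode ?\<rho> A) s) \<longleftrightarrow> s = fcode (?\<rho>(v := c)) A" for s
      using False Ex.prems by (intro Ex.IH inst_upd_var) auto
    moreover have "?\<rho>(v := c) = (\<rho>(v := c))(n := pair 1 (of_nat n))"
      using False by (rule fun_upd_twist)
    ultimately show ?thesis using False by (simp add: subst_iffs(6) del: fun_upd_apply)
  qed
qed (auto simp: subst_iffs subst_tcode)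

lemma val_tcode: "ind val_rules (pair (tcode (\<lambda>n. nm (\<sigma> n)) t) w) \<longleftrightarrow> w = tval M0 \<sigma> t"
  by (induction t arbitrary: w) (auto simp: ind_val_nm)

lemma Sent_fcode: "arithmetical A \<Longrightarrow> Sent (fcode (\<lambda>n. nm (\<sigma> n)) A)"
  by (simp add: Sent_def ind_fcode free_fcode)

end

text \<open>
  The truth axioms determine the truth of those sentences that avoid \<open><\<close> and vacuous quantifiers.
\<close>

primrec proper :: "fm \<Rightarrow> bool" where
  "proper (s \<^bold>= t) \<longleftrightarrow> True"
| "proper (s \<^bold>< t) \<longleftrightarrow> False"
| "proper (Tr t) \<longleftrightarrow> False"
| "proper (\<^bold>\<not> A) \<longleftrightarrow> proper A"
| "proper (A \<^bold>\<or> B) \<longleftrightarrow> proper A \<and> proper B"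
| "proper (\<^bold>\<exists>x. A) \<longleftrightarrow> proper A \<and> x \<in> fvars A"

lemma proper_arithmetical: "proper A \<Longrightarrow> arithmetical A"
  by (induction A) auto

text \<open>An order atom becomes \<open>\<exists>z. t = s + S z\<close>, and a quantifier over
  \<open>x\<close> gets the conjunct \<open>x = x\<close>, so that its variable is sure to
  occur.\<close>

lemma proper_equivalent: "arithmetical A \<Longrightarrow> \<exists>B. proper B \<and> (\<forall>\<sigma>. sat M0 \<sigma> B \<longleftrightarrow> sat M0 \<sigma> A)"
proof (induction A)
  case (Eq s t) then show ?case by (intro exI[of _ "s \<^bold>= t"]) simp
next
  case (Less s t)
  obtain z where z: "z \<notin> tvars s \<union> tvars t"
    using ex_new_if_finite[OF infinite_UNIV_nat, of "tvars s \<union> tvars t"] by auto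
  show ?case
    by (intro exI[of _ "\<^bold>\<exists>z. t \<^bold>= s \<^bold>+ Succ (Var z)"]) (use z in \<open>simp add: el_less_iff\<close>)
next
  case (Neg A)
  then obtain B where "proper B" "\<forall>\<sigma>. sat M0 \<sigma> B \<longleftrightarrow> sat M0 \<sigma> A" by auto
  then show ?case by (intro exI[of _ "\<^bold>\<not> B"]) simp
next
  case (Or A1 A2)
  then obtain B1 B2 where "proper B1" "\<forall>\<sigma>. sat M0 \<sigma> B1 \<longleftrightarrow> sat M0 \<sigma> A1"
    "proper B2" "\<forall>\<sigma>. sat M0 \<sigma> B2 \<longleftrightarrow> sat M0 \<sigma> A2" by auto
  then show ?case by (intro exI[of _ "B1 \<^bold>\<or> B2"]) simp
next
  case (Ex x A)
  then obtain B where "proper B" "\<forall>\<sigma>. sat M0 \<sigma> B \<longleftrightarrow> sat M0 \<sigma> A" by auto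
  then show ?case by (intro exI[of _ "\<^bold>\<exists>x. B \<^bold>\<and> Var x \<^bold>= Var x"]) simp
qed simp

locale ct = expo +
  assumes T_sent: "\<And>x. TT x \<Longrightarrow> Sent x"
    and T_eq: "\<And>s t. ClosedTerm s \<Longrightarrow> ClosedTerm t \<Longrightarrow>
      TT (pair 5 (pair s t)) \<longleftrightarrow> (\<exists>w. ind val_rules (pair s w) \<and> ind val_rules (pair t w))"
    and T_neg: "\<And>p. Sent p \<Longrightarrow> TT (pair 7 p) \<longleftrightarrow> \<not> TT p"
    and T_or: "\<And>p q. Sent p \<Longrightarrow> Sent q \<Longrightarrow> TT (pair 8 (pair p q)) \<longleftrightarrow> TT p \<or> TT q"
    and T_ex: "\<And>v g. ind form_rules g \<Longrightarrow> (\<And>u. ind (free_rules u) g \<longleftrightarrow> u = v) \<Longrightarrow>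
      TT (pair 9 (pair v g)) \<longleftrightarrow>
       (\<exists>x c h. ind numeral_rules (pair x c) \<and> ind (subst_rules v c) (pair g h) \<and> TT h)"
begin

text \<open>Tarski's biconditionals. The induction is on actual formulae in the metatheory, while
  the numerals put for their variables denote arbitrary, possibly nonstandard elements.\<close>

lemma TT_fcode: "proper A \<Longrightarrow> TT (fcode (\<lambda>n. nm (\<sigma> n)) A) \<longleftrightarrow> sat M0 \<sigma> A"
proof (induction A arbitrary: \<sigma>)
  case (Eq s t)
  have "ClosedTerm (tcode (\<lambda>n. nm (\<sigma> n)) t)" for t
    by (simp add: ClosedTerm_def ind_tcode free_tcode)
  then show ?case by (simp add: T_eq val_tcode)
next
  case (Neg A)
  then show ?case by (simp add: T_neg Sent_fcode proper_arithmetical)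
next
  case (Or A B)
  then show ?case by (simp add: T_or Sent_fcode proper_arithmetical)
next
  case (Ex n A)
  then have A: "arithmetical A" "proper A" "n \<in> fvars A" by (simp_all add: proper_arithmetical)
  let ?\<rho> = "(\<lambda>n. nm (\<sigma> n))(n := pair 1 (of_nat n))"
  have i: "inst ?\<rho>" by (intro inst_upd_var inst_nm)
  have fr: "ind (free_rules u) (fcode ?\<rho> A) \<longleftrightarrow> u = of_nat n" for u
    using A by (auto simp: free_fcode[OF i A(1)] split: if_splits)
  have "TT (fcode (\<lambda>n. nm (\<sigma> n)) (\<^bold>\<exists>n. A)) \<longleftrightarrow> (\<exists>x. TT (fcode (?\<rho>(n := nm x)) A))"
    using T_ex[OF ind_fcode[OF i A(1)] fr] by (simp add: ind_numeral subst_fcode[OF i _ A(1)])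
  also have "\<dots> \<longleftrightarrow> (\<exists>x. sat M0 (\<sigma>(n := x)) A)"
  proof -
    have "?\<rho>(n := nm x) = (\<lambda>m. nm ((\<sigma>(n := x)) m))" for x by auto
    then show ?thesis using Ex.IH[OF A(2)] by metis
  qed
  finally show ?case by simp
qed simp_all

end

section \<open>Disjunctive correctness yields induction\<close>

lemma power_bound:
  fixes w :: el
  assumes "4 \<le> w" "0 < m" "x \<le> w ^ m" "y \<le> w ^ m"
  shows "pair x y \<le> w ^ (m * 4)"
proof -
  have "w ^ 1 \<le> w ^ m" using assms(1,2) by (intro power_increasing) auto
  then have "4 \<le> w ^ m" using assms(1) by simp
  then show ?thesis using pair_bound[of "w ^ m" x y] assms(3,4) by (simp add: power_mult)
qed

lemma le_power: "1 \<le> w \<Longrightarrow> 0 < m \<Longrightarrow> x \<le> w \<Longrightarrow> x \<le> (w :: el) ^ m"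
  using power_increasing[of 1 m w] by auto

context expo
begin

lemma disj_seq:
  assumes I: "Ind u w" and D: "dfun u w (\<lambda>e. D (e 0))" and "D 0 = beta a b 0"
    and step: "\<And>i. i < n \<Longrightarrow> D (i + 1) = pair 8 (pair (D i) (beta a b i))" and i: "i \<le> n"
  shows "ind (disj_rules a b) (pair i (D i))"
proof (rule ind_seq_le[where s = "\<lambda>i. pair i (D i)" and n = n, OF I _ _ i])
  show "dfun u w (\<lambda>e. pair (e 0) (D (e 0)))" by (intro dfun_pair dfun_intros D)
  fix i assume i: "i \<le> n"
  show "disj_rules a b (\<lambda>z. \<exists>k<i. pair k (D k) = z) (pair i (D i))"
  proof (cases "i = 0")
    case True
    then show ?thesis using assms(3) by (simp add: disj_rules_def)
  next
    case False
    then obtain j where j: "i = j + 1" using el_cases by blast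
    then have "j < i" "j < n" using i by (simp_all add: add_1_le)
    then have "D i = pair 8 (pair (D j) (beta a b j))" using step j by simp
    then show ?thesis using \<open>j < i\<close> j by (auto simp: disj_rules_def)
  qed
qed

end

locale ctdc = ct +
  assumes DC: "\<And>a b s d. 0 < s \<Longrightarrow> (\<And>i. i < s \<Longrightarrow> Sent (beta a b i)) \<Longrightarrow>
    ind (disj_rules a b) (pair s d) \<Longrightarrow> TT d \<longleftrightarrow> (\<exists>i<s. TT (beta a b i))"
begin

text \<open>
  The sentence \<open>\<theta>\<^sub>i\<close> says that \<open>\<psi>\<^sub>i\<close> is false and that no \<open>\<theta>\<^sub>j\<close> with \<open>j < i\<close> is true. If there were no
  least \<open>i\<close> such that \<open>\<psi>\<^sub>i\<close> is false, then every \<open>\<theta>\<^sub>i\<close> would be false: otherwise take \<open>j < i\<close>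
  with \<open>\<psi>\<^sub>j\<close> false; as \<open>\<theta>\<^sub>j\<close> is false, some \<open>\<theta>\<^sub>k\<close> with \<open>k < j\<close> is true. But then \<open>\<theta>\<^sub>i\<close> is true
  whenever \<open>\<psi>\<^sub>i\<close> is false.

  The set \<open>X\<close> contains derivations of all \<open>\<psi>\<^sub>i\<close> as formulae; it replaces an appeal to collection.
\<close>

lemma least_false:
  assumes I: "Ind u False" and \<psi>: "dfun u False (\<lambda>e. \<psi> (e 0))" and S: "\<And>i. i \<le> n \<Longrightarrow> Sent (\<psi> i)"
    and X: "dfn u False (\<lambda>e. X (e 0))" "\<And>i. i \<le> n \<Longrightarrow> X (\<psi> i)"
      "\<And>y. X y \<Longrightarrow> form_rules (\<lambda>z. X z \<and> z < y) y"
    and false: "\<not> TT (\<psi> n)"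
  shows "\<exists>m. m \<le> n \<and> \<not> TT (\<psi> m) \<and> (\<forall>k<m. TT (\<psi> k))"
proof -
  \<comment> \<open>\<open>z\<close> stands for the disjunction of the earlier
    \<open>\<theta>\<close>; at \<open>i = 0\<close> there is none, so only \<open>\<psi> 0\<close>
    is negated.\<close>
  define \<theta> where "\<theta> i z = (if i = 0 then pair 7 (\<psi> 0) else pair 7 (pair 8 (pair (\<psi> i) z)))" for i z
  obtain Y where Y: "\<And>i. i \<le> n \<Longrightarrow> \<psi> i \<le> Y" using dfun_bounded_on[OF \<psi>] by blast
  \<comment> \<open>Dominates the tags, all \<open>\<psi> i\<close> with \<open>i \<le> n\<close>,
    and the start of the recursion.\<close>
  define q where "q = 8 + Y + pair 7 (\<psi> 0)"
  \<comment> \<open>One step nests five pairings, so it costs the power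
    \<open>4^5 = 2^10 = 1024\<close>.\<close>
  obtain W where W: "bound_seq n q 10 W" using growth[OF Exp] by blast
  have step: "pair 8 (pair z (\<theta> i z)) \<le> W (i + 1)" if i: "i < n" and z: "z \<le> W i" for i z
  proof -
    have q: "q \<le> W i" and Wi: "W (i + 1) = W i ^ 1024" using W i by (auto simp: bound_seq_def)
    have "8 \<le> q" "Y \<le> q" unfolding q_def by (auto intro: le_addI1 le_addI2)
    then have le: "8 \<le> W i" "\<psi> i \<le> W i" "\<psi> 0 \<le> W i" using q Y[of 0] Y[OF less_imp_le[OF i]] by auto
    have le7: "7 \<le> W i" "4 \<le> W i" "1 \<le> W i"
      by (rule order_trans[OF _ le(1)]; simp)+
    have p: "x \<le> W i ^ m" if "x \<le> W i" "0 < m" for x m using that le7 by (intro le_power)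
    have "pair (\<psi> i) z \<le> W i ^ 4" using power_bound[of "W i" 1] le le7 z by simp
    then have "pair 8 (pair (\<psi> i) z) \<le> W i ^ 16" using power_bound[of "W i" 4 8] le le7 p by simp
    then have "pair 7 (pair 8 (pair (\<psi> i) z)) \<le> W i ^ 64" using power_bound[of "W i" 16 7] le7 p by simp
    moreover have "pair 7 (\<psi> 0) \<le> W i ^ 64" using power_bound[of "W i" 16 7] le le7 p by simp
    ultimately have "\<theta> i z \<le> W i ^ 64" unfolding \<theta>_def by (cases "i = 0") simp_all
    then have "pair z (\<theta> i z) \<le> W i ^ 256" using power_bound[of "W i" 64 z] le7 p z by simp
    then show ?thesis using power_bound[of "W i" 256 8] le le7 p by (simp add: Wi)
  qed
  have d\<theta>: "dfun u False (\<lambda>e. \<theta> (f e) (g e))" if "dfun u False f" "dfun u False g" for f g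
    unfolding \<theta>_def using that by (intro dfun_if dfn_intros dfun_pair dfun_intros dfun_comp1[OF \<psi>])
  have dF: "dfun u False (\<lambda>e. pair 8 (pair (e 1) (\<theta> (e 0) (e 1))))"
    by (intro dfun_pair d\<theta> dfun_intros)
  have dW: "dfun u False (\<lambda>e. W (e 0))" using W dfun_mono by (auto simp: bound_seq_def)
  have z0: "pair 7 (\<psi> 0) \<le> W 0"
  proof -
    have "pair 7 (\<psi> 0) \<le> q" unfolding q_def by (simp add: le_addI2)
    moreover have "q \<le> W 0" using W by (simp add: bound_seq_def)
    ultimately show ?thesis by simp
  qed
  obtain a b where ab: "beta a b 0 = pair 7 (\<psi> 0)"
    "\<And>i. i < n \<Longrightarrow> beta a b (i + 1) = pair 8 (pair (beta a b i) (\<theta> i (beta a b i)))"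
    by (rule recursion[OF Fac I dF dW z0 step]) auto
  \<comment> \<open>For \<open>0 < i\<close>, this is the disjunction of the sentences
    \<open>\<theta> j (D j)\<close> with \<open>j < i\<close>.\<close>
  define D where "D i = beta a b i" for i
  have D: "D 0 = pair 7 (\<psi> 0)" "\<And>i. i < n \<Longrightarrow> D (i + 1) = pair 8 (pair (D i) (\<theta> i (D i)))"
    using ab by (simp_all add: D_def)
  have dD: "dfun u False (\<lambda>e. D (f e))" if "dfun u False f" for f
    unfolding D_def using that by (intro dfun_beta dfun_intros)
  \<comment> \<open>\<open>DC\<close> speaks of coded sequences, so the sequence of disjuncts is
    coded as well.\<close>
  obtain a' b' where ab': "\<And>i. i \<le> n \<Longrightarrow> beta a' b' i = \<theta> i (D i)"
    by (rule comprehension[where f = "\<lambda>i. \<theta> i (D i)", OF Fac I d\<theta>[OF dfun_var dD[OF dfun_var]]]) blast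
  have D_cases: "i = 0 \<and> D i = pair 7 (\<psi> 0) \<or>
      (\<exists>j. i = j + 1 \<and> j \<le> n \<and> j < i \<and> D i = pair 8 (pair (D j) (\<theta> j (D j))))" if i: "i \<le> n" for i
  proof (cases "i = 0")
    case False
    then obtain j where j: "i = j + 1" using el_cases by blast
    then have "j < i" "j < n" using i by (simp_all add: add_1_le)
    then show ?thesis using D(2)[of j] j by auto
  qed (use D in simp)
  \<comment> \<open>The set adds to \<open>X\<close> the three kinds of formula that occur on the
    way to \<open>D i\<close>; all their immediate subformulae are smaller members, as
    \<open>ind_set\<close> demands.\<close>
  have form_D: "ind form_rules (D n')" if n': "n' \<le> n" for n'
  proof (rule ind_set[OF _ I, where X = "\<lambda>y. X y \<or> (\<exists>i. i \<le> n \<and>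
        (y = D i \<or> y = \<theta> i (D i) \<or> y = pair 8 (pair (\<psi> i) (D i))))"])
    let ?X = "\<lambda>y. X y \<or> (\<exists>i. i \<le> n \<and> (y = D i \<or> y = \<theta> i (D i) \<or> y = pair 8 (pair (\<psi> i) (D i))))"
    show "mono_rules form_rules" by simp
    show "dfn u False (\<lambda>e. ?X (e 0))"
      by (intro dfn_intros X dD d\<theta> dfun_pair dfun_intros dfun_comp1[OF \<psi>])
    show "?X (D n')" using n' by blast
    have un: "form_rules (\<lambda>z. ?X z \<and> z < y) y" if "y = pair 7 s" "?X s" for y s
      using that less_pair[of 7 s] unfolding form_rules_def by auto
    have bin: "form_rules (\<lambda>z. ?X z \<and> z < y) y" if "y = pair 8 (pair s t)" "?X s" "?X t" for y s t
    proof -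
      have "s < y" "t < y" using that(1) less_pair[of 8 "pair s t"] le_pair[where x = s and y = t] by auto
      then show ?thesis using that unfolding form_rules_def by blast
    qed
    fix y assume "?X y"
    then consider "X y" | i where "i \<le> n" "y = D i" | i where "i \<le> n" "y = \<theta> i (D i)"
      | i where "i \<le> n" "y = pair 8 (pair (\<psi> i) (D i))" by blast
    then show "form_rules (\<lambda>z. ?X z \<and> z < y) y"
    proof cases
      case 1
      then show ?thesis using X(3) by (rule_tac mono_rulesD[OF mono_rules_syntax(2), where E = "\<lambda>z. X z \<and> z < y"]) auto
    next
      case (2 i)
      from D_cases[OF 2(1)] show ?thesis
      proof (elim disjE exE conjE)
        assume "D i = pair 7 (\<psi> 0)"
        then show ?thesis using un[of y "\<psi> 0"] 2 X(2)[of 0] by simp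
      next
        fix j assume "j \<le> n" "D i = pair 8 (pair (D j) (\<theta> j (D j)))"
        then show ?thesis using bin[of y "D j" "\<theta> j (D j)"] 2 by blast
      qed
    next
      case (3 i)
      show ?thesis
      proof (cases "i = 0")
        case True
        then show ?thesis using un[of y "\<psi> 0"] 3 X(2)[of 0] by (simp add: \<theta>_def)
      next
        case False
        then have "y = pair 7 (pair 8 (pair (\<psi> i) (D i)))" using 3 by (simp add: \<theta>_def)
        then show ?thesis using un[of y "pair 8 (pair (\<psi> i) (D i))"] 3(1) by blast
      qed
    next
      case (4 i)
      then show ?thesis using bin[of y "\<psi> i" "D i"] X(2)[of i] by blast
    qed
  qed
  \<comment> \<open>A free variable of a negation or disjunction comes from an immediate subformula,
    and the \<open>\<psi> i\<close> are sentences; hence no member of this family can enter a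
    derivation of freeness.\<close>
  have free_D: "\<not> ind (free_rules v) (D n')" if n': "n' \<le> n" for n' v
  proof
    let ?P = "\<lambda>y. \<forall>i. i \<le> n \<longrightarrow> y \<noteq> D i \<and> y \<noteq> \<theta> i (D i) \<and> y \<noteq> pair 8 (pair (\<psi> i) (D i))"
    assume "ind (free_rules v) (D n')"
    then have "?P (D n')"
    proof (rule ind_induct[OF I, where P = ?P, rotated])
      show "dfn u False (\<lambda>e. ?P (e 0))"
        by (intro dfn_intros dD d\<theta> dfun_pair dfun_intros dfun_comp1[OF \<psi>])
      fix y E assume E: "\<And>z. E z \<Longrightarrow> ?P z" "\<And>z. E z \<Longrightarrow> ind (free_rules v) z" and R: "free_rules v E y"
      have un: "y \<noteq> pair 7 s" if "\<not> E s" for s using R that by (auto simp: free_rules_def)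
      have bin: "y \<noteq> pair 8 (pair s t)" if "\<not> E s" "\<not> E t" for s t using R that by (auto simp: free_rules_def)
      have not_E: "\<not> E (\<psi> i)" "\<not> E (D i)" "\<not> E (\<theta> i (D i))" "\<not> E (pair 8 (pair (\<psi> i) (D i)))" if "i \<le> n" for i
        using E S[OF that] that unfolding Sent_def by blast+
      show "?P y"
      proof (intro allI impI conjI)
        fix i assume i: "i \<le> n"
        from D_cases[OF i] show "y \<noteq> D i"
        proof (elim disjE exE conjE)
          assume "D i = pair 7 (\<psi> 0)"
          then show ?thesis using un[OF not_E(1)[of 0]] by simp
        next
          fix j assume "j \<le> n" "D i = pair 8 (pair (D j) (\<theta> j (D j)))"
          then show ?thesis using bin[OF not_E(2)[of j] not_E(3)[of j]] by simp
        qed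
        show "y \<noteq> \<theta> i (D i)" using un[of "\<psi> 0"] un[OF not_E(4)[OF i]] not_E(1)[of 0] by (simp add: \<theta>_def)
        show "y \<noteq> pair 8 (pair (\<psi> i) (D i))" using bin not_E(1,2)[OF i] by blast
      qed
    qed
    then show False using n' by blast
  qed
  have SD: "Sent (D i)" if "i \<le> n" for i using form_D free_D that by (simp add: Sent_def)
  have S\<theta>: "Sent (\<theta> i (D i))" if "i \<le> n" for i
    using that S[of i] S[of 0] SD[of i] by (simp add: \<theta>_def Sent_neg Sent_or)
  have TT_D: "TT (D i) \<longleftrightarrow> (\<exists>j<i. TT (\<theta> j (D j)))" if i: "0 < i" "i \<le> n" for i
  proof -
    have "beta a' b' j = \<theta> j (D j)" if "j < i" for j using that i ab' by simp
    moreover have "ind (disj_rules a' b') (pair i (D i))"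
      by (rule disj_seq[where D = D and n = n, OF I dD[OF dfun_var]])
        (use D ab'[of 0] ab' i in \<open>auto simp: \<theta>_def\<close>)
    ultimately show ?thesis using DC[OF i(1), of a' b' "D i"] S\<theta> i(2) by (metis less_imp_le less_le_trans)
  qed
  have TT_\<theta>: "TT (\<theta> i (D i)) \<longleftrightarrow> \<not> TT (\<psi> i) \<and> (\<forall>j<i. \<not> TT (\<theta> j (D j)))" if i: "i \<le> n" for i
  proof (cases "i = 0")
    case True
    then show ?thesis using S[of 0] by (simp add: \<theta>_def T_neg)
  next
    case False
    then have "TT (\<theta> i (D i)) \<longleftrightarrow> \<not> (TT (\<psi> i) \<or> TT (D i))"
      using S[OF i] SD[OF i] by (simp add: \<theta>_def T_neg T_or Sent_or)
    then show ?thesis using TT_D[OF _ i] False by auto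
  qed
  show ?thesis
  proof (rule ccontr)
    assume no: "\<nexists>m. m \<le> n \<and> \<not> TT (\<psi> m) \<and> (\<forall>k<m. TT (\<psi> k))"
    have all: "\<not> TT (\<theta> i (D i))" if i: "i \<le> n" for i
    proof
      assume t: "TT (\<theta> i (D i))"
      then have "\<not> TT (\<psi> i)" using TT_\<theta>[OF i] by blast
      then obtain j where j: "j < i" "\<not> TT (\<psi> j)" using no i by blast
      then have "j \<le> n" using i by simp
      then obtain k where "k < j" "TT (\<theta> k (D k))" using TT_\<theta>[of j] TT_\<theta>[OF i] t j by blast
      then show False using TT_\<theta>[OF i] t j(1) less_trans by blast
    qed
    then show False using TT_\<theta>[of n] false less_imp_le by blast
  qed
qed

end

subsection \<open>Arithmetical induction\<close>

text \<open>A fixed \<open>A\<close> has finitely many subformulae, so the codes of their instances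
  form a definable set. The union over all numerical instances becomes the set \<open>X\<close> of
  \<open>least_false\<close>.\<close>

primrec subf :: "fm \<Rightarrow> (nat \<Rightarrow> el) \<Rightarrow> el \<Rightarrow> bool" where
  "subf (s \<^bold>= t) \<rho> y \<longleftrightarrow> y = fcode \<rho> (s \<^bold>= t)"
| "subf (s \<^bold>< t) \<rho> y \<longleftrightarrow> y = fcode \<rho> (s \<^bold>< t)"
| "subf (Tr t) \<rho> y \<longleftrightarrow> False"
| "subf (\<^bold>\<not> A) \<rho> y \<longleftrightarrow> y = fcode \<rho> (\<^bold>\<not> A) \<or> subf A \<rho> y"
| "subf (A \<^bold>\<or> B) \<rho> y \<longleftrightarrow> y = fcode \<rho> (A \<^bold>\<or> B) \<or> subf A \<rho> y \<or> subf B \<rho> y"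
| "subf (\<^bold>\<exists>n. A) \<rho> y \<longleftrightarrow> y = fcode \<rho> (\<^bold>\<exists>n. A) \<or> subf A (\<rho>(n := pair 1 (of_nat n))) y"

context expo
begin

lemma subf_self: "arithmetical A \<Longrightarrow> subf A \<rho> (fcode \<rho> A)"
  by (cases A) auto

lemma subf_form_rules:
  "arithmetical A \<Longrightarrow> inst \<rho> \<Longrightarrow> subf A \<rho> y \<Longrightarrow> form_rules (\<lambda>z. subf A \<rho> z \<and> z < y) y"
proof (induction A arbitrary: \<rho>)
  case (Eq s t)
  then show ?case by (auto simp: form_rules_def ind_tcode)
next
  case (Less s t)
  then show ?case by (auto simp: form_rules_def ind_tcode)
next
  case (Neg A)
  show ?case
  proof (cases "subf A \<rho> y")
    case True
    then have "form_rules (\<lambda>z. subf A \<rho> z \<and> z < y) y" using Neg by simp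
    then show ?thesis by (rule mono_rulesD[OF mono_rules_syntax(2)]) simp
  next
    case False
    then have y: "y = pair 7 (fcode \<rho> A)" using Neg.prems by simp
    then have "fcode \<rho> A < y" using less_pair[of 7] by simp
    then show ?thesis using y subf_self[of A \<rho>] Neg.prems by (auto simp: form_rules_def)
  qed
next
  case (Or A B)
  consider "subf A \<rho> y" | "subf B \<rho> y" | "y = pair 8 (pair (fcode \<rho> A) (fcode \<rho> B))"
    using Or.prems by auto
  then show ?case
  proof cases
    case 1
    then have "form_rules (\<lambda>z. subf A \<rho> z \<and> z < y) y" using Or by simp
    then show ?thesis by (rule mono_rulesD[OF mono_rules_syntax(2)]) simp
  next
    case 2
    then have "form_rules (\<lambda>z. subf B \<rho> z \<and> z < y) y" using Or by simp
    then show ?thesis by (rule mono_rulesD[OF mono_rules_syntax(2)]) simp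
  next
    case 3
    have "fcode \<rho> A < y" "fcode \<rho> B < y"
      using 3 less_pair[of 8 "pair (fcode \<rho> A) (fcode \<rho> B)"] le_pair[where x = "fcode \<rho> A" and y = "fcode \<rho> B"]
      by auto
    then show ?thesis using 3 subf_self[of A \<rho>] subf_self[of B \<rho>] Or.prems by (auto simp: form_rules_def)
  qed
next
  case (Ex n A)
  let ?\<rho> = "\<rho>(n := pair 1 (of_nat n))"
  show ?case
  proof (cases "subf A ?\<rho> y")
    case True
    then have "form_rules (\<lambda>z. subf A ?\<rho> z \<and> z < y) y" 
      using Ex.IH[of ?\<rho>] Ex.prems inst_upd_var by (simp del: fun_upd_apply)
    then show ?thesis by (rule mono_rulesD[OF mono_rules_syntax(2)]) simp
  next
    case False
    then have y: "y = pair 9 (pair (of_nat n) (fcode ?\<rho> A))" using Ex.prems by simp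
    then have "fcode ?\<rho> A < y"
      using less_pair[of 9 "pair (of_nat n) (fcode ?\<rho> A)"] le_pair(2)[of "fcode ?\<rho> A" "of_nat n"] by auto
    then show ?thesis using y subf_self[of A ?\<rho>] Ex.prems by (auto simp: form_rules_def simp del: fun_upd_apply)
  qed
qed simp

end

lemma dfun_tcode: "(\<And>m. dfun u w (\<lambda>e. r e m)) \<Longrightarrow> dfun u w (\<lambda>e. tcode (r e) t)"
  by (induction t) (auto intro: dfun_pair dfun_intros)

lemma dfun_upd: "(\<And>m. dfun u w (\<lambda>e. r e m)) \<Longrightarrow> dfun u w (\<lambda>e. ((r e)(n := c)) m)"
  by (cases "m = n") (auto intro: dfun_intros)

lemma dfun_fcode: "(\<And>m. dfun u w (\<lambda>e. r e m)) \<Longrightarrow> dfun u w (\<lambda>e. fcode (r e) A)"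
proof (induction A arbitrary: r)
  case (Ex n A)
  have "dfun u w (\<lambda>e. fcode ((r e)(n := pair 1 (of_nat n))) A)"
    by (rule Ex.IH) (rule dfun_upd[OF Ex.prems])
  then show ?case unfolding fcode.simps by (intro dfun_pair dfun_const)
qed (auto intro!: dfun_pair dfun_intros dfun_tcode)

lemma dfn_subf: "(\<And>m. dfun u w (\<lambda>e. r e m)) \<Longrightarrow> dfun u w f \<Longrightarrow> dfn u w (\<lambda>e. subf A (r e) (f e))"
proof (induction A arbitrary: r)
  case (Ex n A)
  have "dfn u w (\<lambda>e. subf A ((r e)(n := pair 1 (of_nat n))) (f e))"
    by (rule Ex.IH[OF _ Ex.prems(2)]) (rule dfun_upd[OF Ex.prems(1)])
  moreover have "dfun u w (\<lambda>e. fcode (r e) (\<^bold>\<exists>n. A))" by (rule dfun_fcode[OF Ex.prems(1)])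
  ultimately show ?case unfolding subf.simps by (intro dfn_intros Ex.prems(2))
next
  case (Neg A)
  have "dfun u w (\<lambda>e. fcode (r e) (\<^bold>\<not> A))" by (rule dfun_fcode[OF Neg.prems(1)])
  then show ?case unfolding subf.simps by (intro dfn_intros Neg)
next
  case (Or A B)
  have "dfun u w (\<lambda>e. fcode (r e) (A \<^bold>\<or> B))" by (rule dfun_fcode[OF Or.prems(1)])
  then show ?case unfolding subf.simps by (intro dfn_intros Or)
next
  case (Eq s t)
  have "dfun u w (\<lambda>e. fcode (r e) (s \<^bold>= t))" by (rule dfun_fcode[OF Eq(1)])
  then show ?case unfolding subf.simps by (intro dfn_intros Eq)
next
  case (Less s t)
  have "dfun u w (\<lambda>e. fcode (r e) (s \<^bold>< t))" by (rule dfun_fcode[OF Less(1)])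
  then show ?case unfolding subf.simps by (intro dfn_intros Less)
qed (simp add: dfn_const)

context ctdc
begin

lemma arithmetical_induction:
  assumes A: "arithmetical A"
  shows "models M0 {ind_axiom x A}"
proof -
  obtain B where B: "proper B" "\<And>\<sigma>. sat M0 \<sigma> B \<longleftrightarrow> sat M0 \<sigma> A" using proper_equivalent[OF A] by blast
  have "sat M0 (\<tau>(x := n)) A"
    if 0: "sat M0 (\<tau>(x := 0)) A" and Suc: "\<And>a. sat M0 (\<tau>(x := a)) A \<Longrightarrow> sat M0 (\<tau>(x := a + 1)) A" for \<tau> n
  proof (rule ccontr)
    assume n: "\<not> sat M0 (\<tau>(x := n)) A"
    obtain h where "num_upto n h" using num_upto_exists by blast
    note h = num_uptoD[OF this]
    \<comment> \<open>\<open>h\<close> replaces \<open>nm\<close> at the induction variable to make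
      the sentences a bounded definable function of \<open>i\<close>; the other numerals are
      constants.\<close>
    define r where "r i = (\<lambda>m. if m = x then h i else nm (\<tau> m))" for i
    define \<psi> where "\<psi> i = fcode (r i) B" for i
    have r: "r i = (\<lambda>m. nm ((\<tau>(x := i)) m))" if "i \<le> n" for i
      using h(2)[OF that] by (auto simp: r_def)
    have dr: "dfun False False (\<lambda>e. r (f e) m)" if "dfun False False f" for m f
      using that by (cases "m = x") (auto simp: r_def intro: dfun_intros dfun_comp1[OF h(1)])
    have TT: "TT (\<psi> i) \<longleftrightarrow> sat M0 (\<tau>(x := i)) A" if "i \<le> n" for i
      unfolding \<psi>_def r[OF that] using TT_fcode[OF B(1), of "\<tau>(x := i)"] B(2) by blast
    have arB: "arithmetical B" using B(1) by (rule proper_arithmetical)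
    have "\<exists>m. m \<le> n \<and> \<not> TT (\<psi> m) \<and> (\<forall>k<m. TT (\<psi> k))"
    proof (rule least_false[OF Ind_Delta0, where X = "\<lambda>y. \<exists>i. i \<le> n \<and> subf B (r i) y"])
      show "dfun False False (\<lambda>e. \<psi> (e 0))" unfolding \<psi>_def by (intro dfun_fcode dr dfun_intros)
      show "Sent (\<psi> i)" if "i \<le> n" for i
        unfolding \<psi>_def r[OF that] by (rule Sent_fcode[OF arB])
      show "dfn False False (\<lambda>e. \<exists>i. i \<le> n \<and> subf B (r i) (e 0))"
        by (intro dfn_intros dfn_subf dr dfun_intros)
      show "\<exists>j. j \<le> n \<and> subf B (r j) (\<psi> i)" if "i \<le> n" for i
        using that subf_self[OF arB] unfolding \<psi>_def by blast
      show "\<not> TT (\<psi> n)" using n TT[of n] by simp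
      fix y assume "\<exists>i. i \<le> n \<and> subf B (r i) y"
      then obtain i where i: "i \<le> n" "subf B (r i) y" by blast
      have "form_rules (\<lambda>z. subf B (r i) z \<and> z < y) y"
        by (rule subf_form_rules[OF arB _ i(2)]) (simp only: r[OF i(1)] inst_nm)
      then show "form_rules (\<lambda>z. (\<exists>i. i \<le> n \<and> subf B (r i) z) \<and> z < y) y"
        by (rule mono_rulesD[OF mono_rules_syntax(2)]) (use i in blast)
    qed
    then obtain m where m: "m \<le> n" "\<not> TT (\<psi> m)" "\<And>k. k < m \<Longrightarrow> TT (\<psi> k)" by blast
    show False
    proof (cases "m = 0")
      case True
      then show ?thesis using 0 m(1,2) TT by simp
    next
      case False
      then obtain j where j: "m = j + 1" using el_cases by blast
      then have "j < m" "j \<le> n" using m(1) by (simp_all add: add_1_le)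
      then have "sat M0 (\<tau>(x := j)) A" using m(3) TT by blast
      then show ?thesis using Suc[of j] m(1,2) TT[of m] j by simp
    qed
  qed
  then show ?thesis
    unfolding models_def by (simp add: sat_ind_axiom Sc_eq zero_el_def[symmetric] del: fun_upd_apply)
qed

lemma Ind_arithmetical: "Ind True False"
  by (rule Ind_of_axioms) (use arithmetical_induction in simp)

end

subsection \<open>Satisfaction of formulae as definable predicates\<close>

lemma trm_tval: "(\<And>n. trm (t n)) \<Longrightarrow> trm (\<lambda>e. tval M0 (\<lambda>n. t n e) s)"
proof (induction s)
  case Zero
  then show ?case by (simp add: trm_intros)
next
  case (Var x)
  then show ?case by simp
qed (auto intro!: trm_intros)

lemma trm_upd: "(\<And>n. trm (t n)) \<Longrightarrow> trm ((\<lambda>n. (if n = x then (\<lambda>e. e 0) else (\<lambda>e. t n (\<lambda>n. e (Suc n))))) m)"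
  by (auto intro: trm_intros trm_shift)

lemma upd_env: "(\<lambda>n. (if n = x then (\<lambda>e. e 0) else (\<lambda>e. t n (\<lambda>n. e (Suc n)))) (case_nat a e)) =
    (\<lambda>n. t n e)(x := a)"
  by (auto simp: fun_eq_iff)

text \<open>Converse of \<open>dfn_formula\<close>: a given formula becomes a definable predicate.
  Its variables are read through terms \<open>t n\<close> because each quantifier shifts the
  environment.\<close>

lemma dfn_sat_arithmetical:
  "arithmetical A \<Longrightarrow> (\<And>n. trm (t n)) \<Longrightarrow> dfn True w (\<lambda>e. sat M0 (\<lambda>n. t n e) A)"
proof (induction A arbitrary: t)
  case (Eq s1 s2)
  show ?case by (simp, intro dfn_eq0 trm_tval Eq.prems(2))
next
  case (Less s1 s2)
  show ?case by (simp, intro dfn_less0 trm_tval Less.prems(2))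
next
  case (Neg A)
  then show ?case by (auto intro: dfn_not)
next
  case (Or A B)
  then show ?case by (auto intro: dfn_disj)
next
  case (Ex x A)
  let ?t = "\<lambda>n. if n = x then (\<lambda>e. e 0) else (\<lambda>e. t n (\<lambda>n. e (Suc n)))"
  have "dfn True w (\<lambda>e. sat M0 (\<lambda>n. ?t n e) A)"
    using Ex.prems(1) by (intro Ex.IH trm_upd Ex.prems(2)) simp
  then have "dfn True w (\<lambda>e. \<exists>y. sat M0 (\<lambda>n. ?t n (case_nat y e)) A)"
    by (intro dfn_ex00) simp_all
  then show ?case unfolding upd_env by simp
qed simp

lemma dfn_sat_delta0:
  "delta0 A \<Longrightarrow> (\<And>n. trm (t n)) \<Longrightarrow> dfn False True (\<lambda>e. sat M0 (\<lambda>n. t n e) A)"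
proof (induction A arbitrary: t rule: delta0.induct)
  case (6 A x s)
  let ?t = "\<lambda>n. if n = x then (\<lambda>e. e 0) else (\<lambda>e. t n (\<lambda>n. e (Suc n)))"
  have "dfn False True (\<lambda>e. sat M0 (\<lambda>n. ?t n e) A)" by (intro 6 trm_upd)
  from dfn_bex00[OF trm_tval[of t s, OF 6(4)] this]
  show ?case unfolding upd_env using 6(2) by simp
next
  case (7 A x s)
  let ?t = "\<lambda>n. if n = x then (\<lambda>e. e 0) else (\<lambda>e. t n (\<lambda>n. e (Suc n)))"
  have "dfn False True (\<lambda>e. \<not> sat M0 (\<lambda>n. ?t n e) A)" by (intro dfn_not 7 trm_upd)
  from dfn_not[OF dfn_bex00[OF trm_tval[of t s, OF 7(4)] this]]
  show ?case unfolding upd_env using 7(2) by simp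
next
  case (1 s1 s2)
  then show ?case by (simp, intro dfn_eq0 trm_tval)
next
  case (2 s1 s2)
  then show ?case by (simp, intro dfn_less0 trm_tval)
next
  case (3 s)
  then show ?case by (simp, intro dfn_TT0 trm_tval) simp_all
qed (auto intro: dfn_not dfn_disj)

lemma axiom_of_Ind:
  assumes I: "Ind u w" and A: "\<And>t. (\<And>n. trm (t n)) \<Longrightarrow> dfn u w (\<lambda>e. sat M0 (\<lambda>n. t n e) A)"
  shows "sat M0 \<sigma> (ind_axiom x A)"
  unfolding sat_ind_axiom
proof (intro allI impI)
  fix \<tau> a
  assume 0: "sat M0 (\<tau>(x := Zr M0)) A"
    and Suc: "\<forall>a. sat M0 (\<tau>(x := a)) A \<longrightarrow> sat M0 (\<tau>(x := Sc M0 a)) A"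
  show "sat M0 (\<tau>(x := a)) A"
  proof (rule Ind_induct[OF I, where P = "\<lambda>a. sat M0 (\<tau>(x := a)) A"])
    let ?t = "\<lambda>n. if n = x then (\<lambda>e. e 0) else (\<lambda>e. \<tau> n)"
    have "trm (?t n)" for n by (simp add: trm_intros)
    then have "dfn u w (\<lambda>e. sat M0 (\<lambda>n. ?t n e) A)" by (rule A)
    moreover have "(\<lambda>e. sat M0 (\<lambda>n. ?t n e) A) = (\<lambda>e. sat M0 (\<tau>(x := e 0)) A)"
      by (rule ext, rule arg_cong[where f = "\<lambda>\<sigma>. sat M0 \<sigma> A"]) (auto simp: fun_eq_iff)
    ultimately show "dfn u w (\<lambda>e. sat M0 (\<tau>(x := e 0)) A)" by (rule back_subst[of "dfn u w"])
  qed (use 0 Suc in \<open>simp_all add: Sc_eq zero_el_def del: fun_upd_apply\<close>)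
qed

section \<open>Arithmetical definability of the coded syntax\<close>

lemma arithmetical_atoms [simp]:
  "arithmetical (PairF x y p)" "arithmetical (BetaF n a b i y)" "arithmetical (Node1 c s p)"
  "arithmetical (Node2 n c s t p)"
  by (simp_all add: PairF_def BetaF_def Node1_def Node2_def)

lemma arithmetical_IndF:
  assumes "\<And>m E y. (\<And>k z. arithmetical (E k z)) \<Longrightarrow> arithmetical (R m E y)"
  shows "arithmetical (IndF n R x)"
  using assms by (simp add: IndF_def Let_def)

lemma arithmetical_TermF: "arithmetical (TermF n x)"
  unfolding TermF_def by (rule arithmetical_IndF) (simp add: TermR_def Let_def)

lemma arithmetical_FormF: "arithmetical (FormF n x)"
  unfolding FormF_def by (rule arithmetical_IndF) (simp add: FormR_def Let_def arithmetical_TermF)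

lemma arithmetical_FreeF: "arithmetical (FreeF n v x)"
  unfolding FreeF_def by (rule arithmetical_IndF) (simp add: FreeR_def Let_def)

lemma arithmetical_Pow2F: "arithmetical (Pow2F n x p)"
  unfolding Pow2F_def Rel_def by (simp, rule arithmetical_IndF) (simp add: Pow2R_def Let_def Rel_def)

lemma dfn_Sent: "dfun True w f \<Longrightarrow> dfn True w (\<lambda>e. Sent (f e))"
proof (rule dfn_comp1[where P = Sent])
  have "arithmetical (SentF 1 (Var 0))" by (simp add: SentF_def arithmetical_FormF arithmetical_FreeF)
  then have "dfn True w (\<lambda>e. sat M0 (\<lambda>n. e 0) (SentF 1 (Var 0)))"
    by (rule dfn_sat_arithmetical) (rule trm_var)
  then show "dfn True w (\<lambda>e. Sent (e 0))" by (simp add: sat_SentF)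
qed

lemma dfn_Form: "dfun True w f \<Longrightarrow> dfn True w (\<lambda>e. ind form_rules (f e))"
proof (rule dfn_comp1[where P = "ind form_rules"])
  have "dfn True w (\<lambda>e. sat M0 (\<lambda>n. e 0) (FormF 1 (Var 0)))"
    by (rule dfn_sat_arithmetical[OF arithmetical_FormF]) (rule trm_var)
  then show "dfn True w (\<lambda>e. ind form_rules (e 0))" by (simp add: sat_FormF)
qed

subsection \<open>Coding the truth predicate\<close>

lemma form_rules_less:
  assumes "ind form_rules y"
  shows "form_rules (\<lambda>z. ind form_rules z \<and> z < y) y"
proof -
  have "form_rules (ind form_rules) y" by (rule ind_cases[OF mono_rules_syntax(2) assms])
  moreover have "s < pair 7 s" "s < pair 8 (pair s t)" "t < pair 8 (pair s t)" "t < pair 9 (pair s t)" for s t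
    using less_pair[of 7 s] less_pair[of 8 "pair s t"] less_pair[of 9 "pair s t"]
      le_pair[where x = s and y = t] by auto
  ultimately show ?thesis unfolding form_rules_def by blast
qed

context ctdc
begin

definition ff :: el where "ff = fcode (\<lambda>n. nm 0) fls"

lemma ff: "Sent ff" "\<not> TT ff" "Sent (pair 7 ff)" "TT (pair 7 ff)"
proof -
  show s: "Sent ff" unfolding ff_def using Sent_fcode[of fls "\<lambda>_. 0"] by simp
  show t: "\<not> TT ff" unfolding ff_def using TT_fcode[of fls "\<lambda>_. 0"] by simp
  show "Sent (pair 7 ff)" "TT (pair 7 ff)" using s t by (simp_all add: Sent_neg T_neg)
qed

text \<open>
  For \<open>s \<noteq> 0\<close> the sentence \<open>\<chi> s\<close> is the disjunction of those sentences \<open>i < c\<close> for which the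
  \<open>i\<close>th modulus does not divide \<open>s\<close>. If \<open>s\<close> is least such that \<open>\<chi> s\<close> is false, then the \<open>i\<close>th modulus
  divides \<open>s\<close> only if \<open>i\<close> is true, since otherwise \<open>s\<close> could be divided by this modulus.
\<close>

lemma truth_coded: "\<exists>s b. \<forall>i<c. TT i \<longleftrightarrow> modulus b i dvd s"
proof (cases "c = 0")
  case True
  then show ?thesis by simp
next
  case False
  note I = Ind_arithmetical
  \<comment> \<open>Makes the moduli with index up to \<open>c\<close> pairwise coprime.\<close>
  obtain b where b: "0 < b" "\<And>j. 0 < j \<Longrightarrow> j \<le> c \<Longrightarrow> j dvd b"
    using Fac unfolding Fac_def by metis
  \<comment> \<open>A multiple of all these moduli: the disjunction for \<open>P\<close> has no true
    disjunct, so the search for a false one ends by \<open>P\<close>.\<close>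
  obtain P where P: "0 < P" "\<And>j. 0 < j \<Longrightarrow> j \<le> modulus b c \<Longrightarrow> j dvd P"
    using Fac unfolding Fac_def by metis
  have P': "modulus b j dvd P" if "j \<le> c" for j
    using that by (intro P(2)) (auto intro: mult_right_mono)
  \<comment> \<open>\<open>DC\<close> wants sentences throughout, so excluded positions and numbers
    that are no sentences are filled with the false sentence \<open>ff\<close>.\<close>
  define \<rho> where "\<rho> s i = (if modulus b i dvd s then ff else if Sent i then i else ff)" for s i
  have S\<rho>: "Sent (\<rho> s i)" for s i using ff by (simp add: \<rho>_def)
  have TT\<rho>: "TT (\<rho> s i) \<longleftrightarrow> \<not> modulus b i dvd s \<and> TT i" for s i
    using ff T_sent by (auto simp: \<rho>_def)
  have d\<rho>: "dfun True False (\<lambda>e. \<rho> (f e) (g e))" if "dfun True False f" "dfun True False g" for f g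
    unfolding \<rho>_def using that by (intro dfun_intros dfn_dvd dfn_Sent)
  define q where "q = 8 + ff + c"
  \<comment> \<open>Two pairings per step: \<open>4^2 = 2^4\<close>.\<close>
  obtain W where W: "bound_seq c q 4 W" using growth[OF Exp] by blast
  have \<rho>q: "\<rho> s i \<le> q" if "i \<le> c" for s i
    unfolding \<rho>_def q_def using that by (auto intro: le_addI1 le_addI2)
  have Wq: "q \<le> W i" if "i \<le> c" for i using W that by (simp add: bound_seq_def)
  have step: "pair 8 (pair z (\<rho> s i)) \<le> W (i + 1)" if i: "i < c" and z: "z \<le> W i" for s i z
  proof -
    have Wi: "W (i + 1) = W i ^ 16" using W i by (auto simp: bound_seq_def)
    have "8 \<le> q" unfolding q_def by (intro le_addI1) simp
    then have le: "8 \<le> W i" "\<rho> s i \<le> W i" using Wq[of i] \<rho>q[of i s] less_imp_le[OF i] by auto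
    have le4: "4 \<le> W i" "1 \<le> W i"
      by (rule order_trans[OF _ le(1)]; simp)+
    have "pair z (\<rho> s i) \<le> W i ^ 4" using power_bound[of "W i" 1 z] le le4 z by simp
    then show ?thesis using power_bound[of "W i" 4 8] le(1) le4 le_power[of "W i" 4 8] by (simp add: Wi)
  qed
  \<comment> \<open>The code of the partial disjunctions is not canonical. Only its entry at
    \<open>c\<close> enters \<open>\<chi>\<close>, and \<open>R_uniq\<close> makes that entry well
    defined.\<close>
  define R where "R s a a' \<longleftrightarrow> beta a a' 0 = \<rho> s 0 \<and>
    (\<forall>i. i < c \<longrightarrow> beta a a' (i + 1) = pair 8 (pair (beta a a' i) (\<rho> s i)))" for s a a'
  have R_ex: "\<exists>a a'. R s a a' \<and> beta a a' c \<le> W c" for s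
  proof -
    have d1: "dfun True False (\<lambda>e. pair 8 (pair (e 1) (\<rho> s (e 0))))"
      by (intro dfun_pair dfun_intros d\<rho>)
    have d2: "dfun True False (\<lambda>e. W (e 0))" using W dfun_mono by (auto simp: bound_seq_def)
    have z0: "\<rho> s 0 \<le> W 0" using \<rho>q[of 0 s] Wq[of 0] by simp
    obtain a a' where "beta a a' 0 = \<rho> s 0"
      "\<And>i. i < c \<Longrightarrow> beta a a' (i + 1) = pair 8 (pair (beta a a' i) (\<rho> s i))"
      "\<And>i. i \<le> c \<Longrightarrow> beta a a' i \<le> W i"
      by (rule recursion[OF Fac I d1 d2 z0 step]) auto
    then show ?thesis unfolding R_def by blast
  qed
  have R_uniq: "i \<le> c \<longrightarrow> beta a a' i = beta d d' i" if R: "R s a a'" "R s d d'" for s a a' d d' i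
  proof (rule Ind_induct[OF I, where P = "\<lambda>i. i \<le> c \<longrightarrow> beta a a' i = beta d d' i"])
    show "dfn True False (\<lambda>e. e 0 \<le> c \<longrightarrow> beta a a' (e 0) = beta d d' (e 0))"
      by (intro dfn_intros dfun_beta dfun_intros)
    fix i assume "i \<le> c \<longrightarrow> beta a a' i = beta d d' i"
    then show "i + 1 \<le> c \<longrightarrow> beta a a' (i + 1) = beta d d' (i + 1)"
      using R unfolding R_def by (simp add: add_1_le)
  qed (use R in \<open>simp add: R_def\<close>)
  have R_Sent: "i \<le> c \<longrightarrow> Sent (beta a a' i)" if R: "R s a a'" for s a a' i
  proof (rule Ind_induct[OF I, where P = "\<lambda>i. i \<le> c \<longrightarrow> Sent (beta a a' i)"])
    show "dfn True False (\<lambda>e. e 0 \<le> c \<longrightarrow> Sent (beta a a' (e 0)))"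
      by (intro dfn_intros dfn_Sent dfun_beta dfun_intros)
    fix i assume "i \<le> c \<longrightarrow> Sent (beta a a' i)"
    then show "i + 1 \<le> c \<longrightarrow> Sent (beta a a' (i + 1))"
      using R S\<rho> unfolding R_def by (simp add: add_1_le Sent_or)
  qed (use R S\<rho> in \<open>simp add: R_def\<close>)
  have R_TT: "TT (beta a a' c) \<longleftrightarrow> (\<exists>i<c. TT (\<rho> s i))" if R: "R s a a'" for s a a'
  proof -
    have ds: "dfun True False (\<lambda>e. \<rho> s (e 0))" by (intro d\<rho> dfun_intros)
    obtain d d' where d: "\<And>i. i \<le> c \<Longrightarrow> beta d d' i = \<rho> s i"
      using comprehension[where f = "\<rho> s", OF Fac I ds] by blast
    have "ind (disj_rules d d') (pair c (beta a a' c))"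
    proof (rule disj_seq[where D = "beta a a'" and n = c, OF I])
      show "dfun True False (\<lambda>e. beta a a' (e 0))" by (intro dfun_beta dfun_intros)
    qed (use R d in \<open>auto simp: R_def\<close>)
    moreover have dd: "beta d d' i = \<rho> s i" if "i < c" for i using d that by simp
    ultimately have "TT (beta a a' c) \<longleftrightarrow> (\<exists>i<c. TT (beta d d' i))"
      using False S\<rho> by (intro DC) simp_all
    then show ?thesis by (simp add: dd cong: conj_cong)
  qed
  \<comment> \<open>Every modulus divides \<open>0\<close>, so the disjunction would be false there.
    A true sentence is put at \<open>0\<close> to keep the least \<open>s\<close> positive.\<close>
  define \<chi> where "\<chi> s = (if s = 0 then pair 7 ff else THE d. \<exists>a a'. R s a a' \<and> d = beta a a' c)" for s
  have \<chi>: "\<chi> s = beta a a' c" if "R s a a'" "s \<noteq> 0" for s a a'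
  proof -
    have "(THE d. \<exists>a a'. R s a a' \<and> d = beta a a' c) = beta a a' c"
    proof (rule the_equality)
      show "\<exists>d d'. R s d d' \<and> beta a a' c = beta d d' c" using that(1) by blast
      show "x = beta a a' c" if x: "\<exists>d d'. R s d d' \<and> x = beta d d' c" for x
        using x R_uniq[OF \<open>R s a a'\<close>, where i = c] by (elim exE conjE) simp
    qed
    then show ?thesis using that(2) by (simp add: \<chi>_def)
  qed
  have \<chi>_ex: "\<exists>a a'. R s a a' \<and> \<chi> s = beta a a' c \<and> beta a a' c \<le> W c" if "s \<noteq> 0" for s
    using R_ex[of s] \<chi> that by blast
  have \<chi>_Sent: "Sent (\<chi> s)" for s
  proof (cases "s = 0")
    case False
    then obtain a a' where "R s a a'" "\<chi> s = beta a a' c" using \<chi>_ex by blast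
    then show ?thesis using R_Sent[of s a a' c] by simp
  qed (use ff(3) in \<open>simp add: \<chi>_def\<close>)
  have \<chi>_TT: "TT (\<chi> s) \<longleftrightarrow> (\<exists>i<c. \<not> modulus b i dvd s \<and> TT i)" if s: "s \<noteq> 0" for s
  proof -
    obtain a a' where "R s a a'" "\<chi> s = beta a a' c" using \<chi>_ex[OF s] by blast
    then show ?thesis using R_TT[of s a a'] by (simp add: TT\<rho>)
  qed
  have "\<exists>m. m \<le> P \<and> \<not> TT (\<chi> m) \<and> (\<forall>k<m. TT (\<chi> k))"
  \<comment> \<open>Arithmetical induction is available now, so all formulae together form an
    admissible set \<open>X\<close>, and the graph of \<open>\<chi>\<close> may contain unbounded
    quantifiers.\<close>
  proof (rule least_false[OF I, where X = "ind form_rules"])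
    have graph: "d = \<chi> s \<longleftrightarrow> (s = 0 \<and> d = pair 7 ff) \<or> (s \<noteq> 0 \<and> (\<exists>a a'. R s a a' \<and> d = beta a a' c))" for d s
    proof (cases "s = 0")
      case False
      then obtain a a' where "R s a a'" "\<chi> s = beta a a' c" using \<chi>_ex by blast
      moreover have "d = \<chi> s" if "R s a a'" "d = beta a a' c" for a a'
        using \<chi>[OF that(1) False] that(2) by simp
      ultimately show ?thesis using False by blast
    qed (simp add: \<chi>_def)
    have dR: "dfn True False (\<lambda>e. R (f e) (g e) (h e))"
      if "dfun True False f" "dfun True False g" "dfun True False h" for f g h
      unfolding R_def using that by (intro dfn_intros dfun_beta dfun_pair dfun_intros d\<rho> dfun_shift)
    have "dfn True False (\<lambda>e. (e (Suc 0) = 0 \<and> e 0 = pair 7 ff) \<or>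
        (e (Suc 0) \<noteq> 0 \<and> (\<exists>a a'. R (e (Suc 0)) a a' \<and> e 0 = beta a a' c)))"
      by (intro dfn_disj dfn_conj dfn_not dfn_eq dfn_ex dR dfun_beta dfun_intros) simp_all
    then have "dfn True False (\<lambda>e. e 0 = \<chi> (e (Suc 0)))" by (simp only: graph)
    moreover have "\<chi> s \<le> pair 7 ff + W c" for s
      using \<chi>_ex[of s] by (cases "s = 0") (auto simp: \<chi>_def[of 0] intro: le_addI1 le_addI2)
    ultimately show "dfun True False (\<lambda>e. \<chi> (e 0))"
      by (intro dfunI[of _ _ _ "\<lambda>e. pair 7 ff + W c"] trm_intros)
    show "Sent (\<chi> s)" for s by (rule \<chi>_Sent)
    show "dfn True False (\<lambda>e. ind form_rules (e 0))" by (intro dfn_Form dfun_intros)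
    show "ind form_rules (\<chi> s)" for s using \<chi>_Sent by (simp add: Sent_def)
    show "form_rules (\<lambda>z. ind form_rules z \<and> z < y) y" if "ind form_rules y" for y
      using that by (rule form_rules_less)
    show "\<not> TT (\<chi> P)" using \<chi>_TT[of P] P(1) P' less_imp_le by auto
  qed
  then obtain m where m: "m \<le> P" "\<not> TT (\<chi> m)" "\<And>k. k < m \<Longrightarrow> TT (\<chi> k)" by blast
  have m0: "m \<noteq> 0" using m(2) ff(4) by (auto simp: \<chi>_def)
  have no: "modulus b i dvd m" if "i < c" "TT i" for i
    using m(2) \<chi>_TT[OF m0] that by blast
  have "TT i" if i: "i < c" and dvd: "modulus b i dvd m" for i
  proof (rule ccontr)
    assume n: "\<not> TT i"
    \<comment> \<open>The quotient is smaller, so its disjunction has a true disjunct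
      \<open>j\<close>. The modulus of \<open>j\<close> divides \<open>m\<close> and is coprime to
      the one divided out, so it divides \<open>s\<close> as well, contrary to the choice of
      \<open>j\<close>.\<close>
    obtain s where s: "m = modulus b i * s" using dvd by (rule dvdE)
    have s0: "s \<noteq> 0" using m0 s by auto
    have "1 * s < modulus b i * s" using b(1) s0 by (intro mult_strict_right_mono) auto
    then have "TT (\<chi> s)" using m(3) s by simp
    then obtain j where j: "j < c" "\<not> modulus b j dvd s" "TT j" using \<chi>_TT[OF s0] by blast
    then have "j \<noteq> i" using n by blast
    then consider "i < j" | "j < i" by (metis linorder_neqE)
    then have co: "coprime' (modulus b i) (modulus b j)"
    proof cases
      case 1
      show ?thesis by (rule moduli_coprime[where L = c, OF b(2)]) (use 1 j in auto)
    next
      case 2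
      show ?thesis
        by (rule coprime'_commute, rule moduli_coprime[where L = c, OF b(2)]) (use 2 i in auto)
    qed
    have "modulus b j dvd s * modulus b i" using no[OF j(1,3)] s by (simp add: mult.commute)
    then have "modulus b j dvd s" by (rule coprime_dvd_mult[OF co modulus_pos])
    then show False using j(2) by blast
  qed
  then show ?thesis using no by blast
qed

text \<open>When the environment is bounded, all arguments of truth lie below one number, and there
  truth is divisibility with two parameters by \<open>truth_coded\<close>. Quantifier bounds pass
  the restriction on to subformulae.\<close>

lemma truth_eliminated:
  assumes "dfn False True P"
  shows "\<exists>Q. dfn False False Q \<and> (\<forall>e. (\<forall>i. e i \<le> K) \<longrightarrow> (P e \<longleftrightarrow> Q e))"
  using assms
proof (induction arbitrary: K rule: dfn.induct)
  case (dfn_eq0 s t)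
  then show ?case using dfn.dfn_eq0 by blast
next
  case (dfn_less0 s t)
  then show ?case using dfn.dfn_less0 by blast
next
  case (dfn_TT0 t)
  obtain s b where sb: "\<And>i. i < t (\<lambda>_. K) + 1 \<Longrightarrow> TT i \<longleftrightarrow> modulus b i dvd s"
    using truth_coded[of "t (\<lambda>_. K) + 1"] by blast
  have "TT (t e) \<longleftrightarrow> modulus b (t e) dvd s" if "\<forall>i. e i \<le> K" for e
    using that by (intro sb) (simp add: trm_mono[OF dfn_TT0(2)])
  moreover have "dfn False False (\<lambda>e. modulus b (t e) dvd s)"
    by (intro dfn_dvd dfun_intros dfun_trm dfn_TT0)
  ultimately show ?case by blast
next
  case (dfn_not P)
  then obtain Q where "dfn False False Q" "\<forall>e. (\<forall>i. e i \<le> K) \<longrightarrow> (P e \<longleftrightarrow> Q e)" by blast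
  then show ?case by (intro exI[of _ "\<lambda>e. \<not> Q e"]) (auto intro: dfn.dfn_not)
next
  case (dfn_disj P P')
  obtain Q where Q: "dfn False False Q" "\<forall>e. (\<forall>i. e i \<le> K) \<longrightarrow> (P e \<longleftrightarrow> Q e)"
    using dfn_disj.IH(1) by blast
  obtain Q' where Q': "dfn False False Q'" "\<forall>e. (\<forall>i. e i \<le> K) \<longrightarrow> (P' e \<longleftrightarrow> Q' e)"
    using dfn_disj.IH(2) by blast
  show ?case
    by (intro exI[of _ "\<lambda>e. Q e \<or> Q' e"] conjI dfn.dfn_disj) (use Q Q' in auto)
next
  case (dfn_bex00 t P)
  \<comment> \<open>The bound grows by the largest value that the quantified variable may
    take.\<close>
  let ?K = "K + t (\<lambda>_. K)"
  obtain Q where Q: "dfn False False Q" "\<And>e. (\<forall>i. e i \<le> ?K) \<Longrightarrow> P e \<longleftrightarrow> Q e"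
    using dfn_bex00.IH by blast
  have "P (case_nat y e) \<longleftrightarrow> Q (case_nat y e)" if e: "\<forall>i. e i \<le> K" and y: "y < t e" for y e
  proof (rule Q(2), rule allI)
    fix i
    have "t e \<le> t (\<lambda>_. K)" using e by (intro trm_mono[OF dfn_bex00(1)]) simp
    then have "y \<le> t (\<lambda>_. K)" using y by simp
    then show "case_nat y e i \<le> ?K" using e by (cases i) (auto intro: le_addI1 le_addI2)
  qed
  then show ?case
    by (intro exI[of _ "\<lambda>e. \<exists>y. y < t e \<and> Q (case_nat y e)"] conjI dfn.dfn_bex00 dfn_bex00(1) Q(1)) blast
qed simp

lemma Ind_truth: "Ind False True"
  unfolding Ind_def
proof (intro allI impI)
  fix P :: "el \<Rightarrow> bool" and x
  assume P: "dfn False True (\<lambda>e. P (e 0))" "P 0" "\<forall>x. P x \<longrightarrow> P (x + 1)"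
  obtain Q where Q: "dfn False False Q" "\<And>e. (\<forall>i. e i \<le> x) \<Longrightarrow> P (e 0) \<longleftrightarrow> Q e"
    using truth_eliminated[OF P(1), of x] by blast
  have "y \<le> x \<longrightarrow> P y" for y
  proof -
    \<comment> \<open>\<open>Q\<close> is known to agree with \<open>P\<close> only on environments
      bounded by \<open>x\<close>; a constant environment is bounded in all its entries.\<close>
    have "y \<le> x \<longrightarrow> Q (\<lambda>_. y)"
    proof (rule induct_Delta0[where P = "\<lambda>y. y \<le> x \<longrightarrow> Q (\<lambda>_. y)"])
      have "dfn False False (\<lambda>e. Q (\<lambda>i. (\<lambda>i e. e 0) i e))" by (rule dfn_subst[OF Q(1)]) (rule trm_var)
      then show "dfn False False (\<lambda>e. e 0 \<le> x \<longrightarrow> Q (\<lambda>_. e 0))" by (intro dfn_intros dfun_intros) simp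
      show "0 \<le> x \<longrightarrow> Q (\<lambda>_. 0)" using P(2) Q(2)[of "\<lambda>_. 0"] by simp
      fix y assume IH: "y \<le> x \<longrightarrow> Q (\<lambda>_. y)"
      show "y + 1 \<le> x \<longrightarrow> Q (\<lambda>_. y + 1)"
      proof
        assume y: "y + 1 \<le> x"
        then have "y \<le> x" by (simp add: add_1_le)
        then have "P y" using IH Q(2)[of "\<lambda>_. y"] by simp
        then show "Q (\<lambda>_. y + 1)" using P(3) Q(2)[of "\<lambda>_. y + 1"] y by simp
      qed
    qed
    then show ?thesis using Q(2)[of "\<lambda>_. y"] by simp
  qed
  then show "P x" by simp
qed

end

section \<open>Bounded induction for truth yields disjunctive correctness\<close>

text \<open>Assembling a derivation of a power of two already requires \<open>Fac\<close>, so on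
  this side it comes directly from arithmetical induction, ahead of exponentiation.\<close>

lemma Fac_of_Ind:
  assumes I: "Ind True False"
  shows Fac
  unfolding Fac_def
proof
  fix N :: el
  show "\<exists>B>0. \<forall>j. 0 < j \<longrightarrow> j \<le> N \<longrightarrow> j dvd B"
  proof (rule Ind_induct[OF I, where P = "\<lambda>N. \<exists>B. 0 < B \<and> (\<forall>j. 0 < j \<longrightarrow> j \<le> N \<longrightarrow> j dvd B)"])
    show "dfn True False (\<lambda>e. \<exists>B. 0 < B \<and> (\<forall>j. 0 < j \<longrightarrow> j \<le> e 0 \<longrightarrow> j dvd B))"
      by (rule dfn_ex, simp, intro dfn_conj dfn_less dfn_all dfn_imp dfn_le dfn_dvd dfun_intros) simp
    show "\<exists>B :: el. 0 < B \<and> (\<forall>j. 0 < j \<longrightarrow> j \<le> 0 \<longrightarrow> j dvd B)" by (intro exI[of _ 1]) simp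
    fix N :: el assume "\<exists>B. 0 < B \<and> (\<forall>j. 0 < j \<longrightarrow> j \<le> N \<longrightarrow> j dvd B)"
    then obtain B where B: "0 < B" "\<And>j. 0 < j \<Longrightarrow> j \<le> N \<Longrightarrow> j dvd B" by blast
    have "j dvd B * (N + 1)" if "0 < j" "j \<le> N + 1" for j
    proof (cases "j = N + 1")
      case False
      then have "j \<le> N" using that(2) by (simp add: le_less)
      then show ?thesis using B(2) that(1) by (blast intro: dvd_mult2)
    qed simp
    then show "\<exists>B. 0 < B \<and> (\<forall>j. 0 < j \<longrightarrow> j \<le> N + 1 \<longrightarrow> j dvd B)"
      using B(1) by (intro exI[of _ "B * (N + 1)"]) simp
  qed
qed

lemma Exp_of_Ind:
  assumes I: "Ind True False"
  shows Exp
  unfolding Exp_def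
proof
  fix x :: el
  interpret fac by unfold_locales (rule Fac_of_Ind[OF I])
  have mono: "mono_rules pow2_rules" by (auto simp: mono_rules_def pow2_rules_def)
  show "\<exists>p. ind pow2_rules (pair x p)"
  proof (rule Ind_induct[OF I, where P = "\<lambda>x. \<exists>p. ind pow2_rules (pair x p)"])
    have "dfn True False (\<lambda>e. sat M0 (\<lambda>n. e 0) (\<^bold>\<exists>1. Pow2F 2 (Var 0) (Var 1)))"
      by (rule dfn_sat_arithmetical) (simp_all add: arithmetical_Pow2F trm_var)
    then show "dfn True False (\<lambda>e. \<exists>p. ind pow2_rules (pair (e 0) p))" by (simp add: sat_Pow2F)
    have "ind pow2_rules (pair 0 1)" by (rule ind_intro0) (simp add: pow2_rules_def)
    then show "\<exists>p. ind pow2_rules (pair 0 p)" by blast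
    fix x assume "\<exists>p. ind pow2_rules (pair x p)"
    then obtain p where p: "ind pow2_rules (pair x p)" by blast
    have "ind pow2_rules (pair (x + 1) (p + p))"
      by (rule ind_intro1[OF mono p]) (auto simp: pow2_rules_def)
    then show "\<exists>p. ind pow2_rules (pair (x + 1) p)" by blast
  qed
qed

context ct
begin

text \<open>Two inductions along the derivation are made. Being a sentence is arithmetical with
  unbounded quantifiers, the truth condition is bounded but contains truth, and neither of the two
  schemes covers both in one formula.\<close>

lemma disjunctive_correctness:
  assumes I: "Ind True False" and IT: "Ind False True"
    and s: "0 < s" and S: "\<And>i. i < s \<Longrightarrow> Sent (beta a b i)" and d: "ind (disj_rules a b) (pair s d)"
  shows "TT d \<longleftrightarrow> (\<exists>i<s. TT (beta a b i))"
proof -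
  have Sent: "Sent d'" if t: "t \<le> s" and d': "ind (disj_rules a b) (pair t d')" for t d'
  proof -
    let ?P = "\<lambda>y. \<forall>t. t \<le> s \<longrightarrow> (\<forall>d'. d' \<le> y \<longrightarrow> y = pair t d' \<longrightarrow> Sent d')"
    have "?P (pair t d')"
    proof (rule ind_induct[OF I _ d', where P = ?P])
      show "dfn True False (\<lambda>e. ?P (e 0))"
        by (intro dfn_ball_le dfn_imp dfn_eq dfn_Sent dfun_pair dfun_intros)
      fix y E assume E: "\<And>z. E z \<Longrightarrow> ?P z" and R: "disj_rules a b E y"
      show "?P y"
      proof (intro allI impI)
        fix t d' assume t: "t \<le> s" and y: "y = pair t d'"
        from R consider "t = 0" "d' = beta a b 0"
          | t1 d1 where "t = t1 + 1" "d' = pair 8 (pair d1 (beta a b t1))" "E (pair t1 d1)"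
          unfolding disj_rules_def y by auto
        then show "Sent d'"
        proof cases
          case 1
          then show ?thesis using S s by simp
        next
          case 2
          then have "t1 < s" using t by (simp add: add_1_le)
          moreover have "Sent d1" using E[OF 2(3)] le_pair(2)[of d1 t1] calculation less_imp_le by blast
          ultimately show ?thesis using 2(2) S by (simp add: Sent_or)
        qed
      qed
    qed
    then show ?thesis using t le_pair(2)[of d' t] by blast
  qed
  \<comment> \<open>At index \<open>0\<close> the disjunction is entry \<open>0\<close> although no
    index lies below \<open>0\<close>, so this case records the sentence itself; the step to index
    \<open>1\<close> draws on it.\<close>
  let ?P = "\<lambda>y. \<forall>t. t \<le> s \<longrightarrow> (\<forall>d'. d' \<le> y \<longrightarrow> y = pair t d' \<longrightarrow>
    (t = 0 \<longrightarrow> d' = beta a b 0) \<and> (t \<noteq> 0 \<longrightarrow> (TT d' \<longleftrightarrow> (\<exists>i. i < t \<and> TT (beta a b i)))))"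
  have "?P (pair s d)"
  proof (rule ind_induct[OF IT _ d, where P = ?P])
    show "dfn False True (\<lambda>e. ?P (e 0))"
      by (intro dfn_intros dfun_pair dfun_beta dfun_intros) simp_all
    fix y E assume E: "\<And>z. E z \<Longrightarrow> ?P z" "\<And>z. E z \<Longrightarrow> ind (disj_rules a b) z"
      and R: "disj_rules a b E y"
    show "?P y"
    proof (intro allI impI)
      fix t d' assume t: "t \<le> s" and y: "y = pair t d'"
      from R consider "t = 0" "d' = beta a b 0"
        | t1 d1 where "t = t1 + 1" "d' = pair 8 (pair d1 (beta a b t1))" "E (pair t1 d1)"
        unfolding disj_rules_def y by auto
      then show "(t = 0 \<longrightarrow> d' = beta a b 0) \<and> (t \<noteq> 0 \<longrightarrow> (TT d' \<longleftrightarrow> (\<exists>i. i < t \<and> TT (beta a b i))))"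
      proof cases
        case 1
        then show ?thesis by simp
      next
        case 2
        then have t1: "t1 < s" using t by (simp add: add_1_le)
        have "Sent d1" using Sent[OF less_imp_le[OF t1] E(2)[OF 2(3)]] .
        then have d': "TT d' \<longleftrightarrow> TT d1 \<or> TT (beta a b t1)" using 2(2) S[OF t1] by (simp add: T_or)
        have IH: "(t1 = 0 \<longrightarrow> d1 = beta a b 0) \<and> (t1 \<noteq> 0 \<longrightarrow> (TT d1 \<longleftrightarrow> (\<exists>i. i < t1 \<and> TT (beta a b i))))"
          using E(1)[OF 2(3)] t1 le_pair(2)[of d1 t1] less_imp_le by blast
        have "i < t \<longleftrightarrow> i < t1 \<or> i = t1" for i using 2(1) by (auto simp: le_less)
        then have "(\<exists>i. i < t \<and> TT (beta a b i)) \<longleftrightarrow> (\<exists>i. i < t1 \<and> TT (beta a b i)) \<or> TT (beta a b t1)"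
          by blast
        moreover have "t \<noteq> 0" using 2(1) by simp
        ultimately show ?thesis using d' IH by (cases "t1 = 0") auto
      qed
    qed
  qed
  then show ?thesis using s le_pair(2)[of d s] by auto
qed

end

section \<open>Comparison of the models\<close>

lemma models_mono: "models M \<Gamma> \<Longrightarrow> \<Delta> \<subseteq> \<Gamma> \<Longrightarrow> models M \<Delta>"
  by (auto simp: models_def)

lemma models_Un: "models M (\<Gamma> \<union> \<Delta>) \<longleftrightarrow> models M \<Gamma> \<and> models M \<Delta>"
  by (auto simp: models_def)

lemma ctI:
  assumes Exp and T: "models M0 {T_sent, T_eq, T_neg, T_or, T_ex}"
  shows ct
proof -
  have "models M0 {T_sent}" "models M0 {T_eq}" "models M0 {T_neg}" "models M0 {T_or}" "models M0 {T_ex}"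
    by (rule models_mono[OF T]; simp)+
  note T = this[unfolded models_T_sent models_T_eq models_T_neg models_T_or models_T_ex]
  show ?thesis by unfold_locales (use assms(1) T in blast)+
qed

lemma M0_not_separating: "\<not> separating M0"
proof -
  let ?T = "{T_sent, T_eq, T_neg, T_or, T_ex}"
  have "models M0 (CT0 PA)" if T1: "models M0 (CT_minus IDelta0_Exp \<union> {DC})"
  proof -
    have T: "models M0 ?T" "models M0 {Exp_total}" "models M0 {DC}" "models M0 Robinson_Q"
      by (rule models_mono[OF T1]; auto simp: CT_minus_def IDelta0_Exp_def)+
    interpret ct by (rule ctI) (use T in \<open>simp_all add: models_Exp_total\<close>)
    interpret ctdc by unfold_locales (use T(3) in \<open>simp add: models_DC\<close>)
    have "sat M0 \<sigma> (ind_axiom x A)" if "arithmetical A" for \<sigma> x A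
      using arithmetical_induction[OF that] by (simp add: models_def)
    moreover have "sat M0 \<sigma> (ind_axiom x A)" if "delta0 A" for \<sigma> x A
      using that by (intro axiom_of_Ind[OF Ind_truth] dfn_sat_delta0)
    ultimately show ?thesis
      using T(1,4) unfolding CT0_def CT_minus_def PA_def models_Un by (auto simp: models_def)
  qed
  moreover have "models M0 (CT_minus IDelta0_Exp \<union> {DC})" if T2: "models M0 (CT0 PA)"
  proof -
    have T: "models M0 ?T" by (rule models_mono[OF T2]) (auto simp: CT0_def CT_minus_def)
    have I: "Ind True False" "Ind False True"
      by (rule Ind_of_axioms, rule models_mono[OF T2], force simp: CT0_def CT_minus_def PA_def)+
    have E: Exp by (rule Exp_of_Ind[OF I(1)])
    interpret ct by (rule ctI[OF E T])
    have "models M0 {DC}" using disjunctive_correctness[OF I] by (simp add: models_DC)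
    then show ?thesis
      using T E M0_properties(1)
      unfolding CT_minus_def IDelta0_Exp_def IDelta0_def models_Un models_Exp_total by blast
  qed
  ultimately have "models M0 (CT_minus IDelta0_Exp \<union> {DC}) \<longleftrightarrow> models M0 (CT0 PA)" by (rule iffI)
  then show ?thesis by (simp only: separating_def simp_thms)
qed

theorem theorem1:
  shows "theorems (CT_minus IDelta0_Exp \<union> {DC}) = theorems (CT0 PA)"
proof (rule theorems_eqI[where 'a = el])
  show "Robinson_Q \<subseteq> CT_minus IDelta0_Exp \<union> {DC}" "Robinson_Q \<subseteq> CT0 PA"
    unfolding CT_minus_def IDelta0_Exp_def CT0_def PA_def by blast+
  show "\<exists>h :: el \<Rightarrow> nat. bij h"
  proof (intro exI bijI injI)
    show "x = y" if "un_El x = un_El y" for x y using that by (cases x; cases y) simp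
    show "surj un_El" by (rule surjI[of _ El]) simp
  qed
  fix N :: "el str"
  show "models N (CT_minus IDelta0_Exp \<union> {DC}) \<longleftrightarrow> models N (CT0 PA)"
  proof (rule ccontr)
    assume n: "\<not> ?thesis"
    \<comment> \<open>A model that tells the theories apart satisfies one of them and hence
      \<open>IDelta0\<close>, so \<open>M0\<close> would tell them apart too.\<close>
    have "IDelta0 \<subseteq> CT_minus IDelta0_Exp \<union> {DC}" "IDelta0 \<subseteq> CT0 PA"
      unfolding IDelta0_def CT_minus_def IDelta0_Exp_def CT0_def PA_def by blast+
    then have "models N IDelta0" "separating N"
      using n models_mono[of N] unfolding separating_def by blast+
    then show False using M0_properties(2) M0_not_separating by blast
  qed
qed

end
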